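(* Let $K$ be a field, let $\ell, m \in \mathbb{N}$ and let $E$ be the natural $2$-dimensional representation of $\mathrm{GL}_2(K)$. Then there is an isomorphism of representations of $\mathrm{GL}_2(K)$ $$\bigwedge\nolimits^\ell \mathrm{Sym}^{\ell+m-1} E \cong \bigwedge\nolimits^m \mathrm{Sym}_{\ell+m-1} E \otimes (\det E)^{\otimes \frac{1}{2} (\ell-m)(\ell+m-1)}.$$
   Context: For a $K$-vector space $V$, the symmetric group $S_r$ acts on $V^{\otimes r}$ by place permutation. $\mathrm{Sym}_r V=(V^{\otimes r})^{S_r}$ is the space of invariants, and $\mathrm{Sym}^r V$ is the usual symmetric power (coinvariants: the quotient of $V^{\otimes r}$ by the span of all $w\cdot\sigma-w$). $\bigwedge^r V$ is the usual exterior power and $\det E=\bigwedge^2 E$ is the determinant representation; a negative tensor exponent $-n$ means the $n$-th tensor power of the dual of $\det E$. *)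

theory Defs
  imports
    "HOL-Analysis.Analysis"
    "HOL-Algebra.Algebraic_Closure_Type"
    "HOL-Combinatorics.Permutations"
    "HOL-Library.Poly_Mapping"
begin

section \<open>Linear representations on carriers\<close>

text \<open>
  The scalar field is a type of class \<open>field\<close>; as a HOL-Algebra ring it is
  \<open>ring_of_type_algebra\<close>. A representation extends the HOL-Algebra record of modules
  by an action map. As usual for that record, the inherited ring multiplication and unit play
  no role and are left unspecified. The acting group \<open>G\<close> enters only where the set of
  group elements or inversion matters: in isomorphisms and duals.
\<close>

record ('k, 'v, 'g) representation = "('k, 'v) module" +
  act :: "'g \<Rightarrow> 'v \<Rightarrow> 'v"

definition rep_iso ::
    "'g monoid \<Rightarrow> ('k, 'v, 'g) representation \<Rightarrow> ('k, 'w, 'g) representation \<Rightarrow> bool" where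
  "rep_iso G V W \<longleftrightarrow> (\<exists>\<phi>. bij_betw \<phi> (carrier V) (carrier W) \<and>
     (\<forall>x\<in>carrier V. \<forall>y\<in>carrier V. \<phi> (x \<oplus>\<^bsub>V\<^esub> y) = \<phi> x \<oplus>\<^bsub>W\<^esub> \<phi> y) \<and>
     (\<forall>c. \<forall>x\<in>carrier V. \<phi> (c \<odot>\<^bsub>V\<^esub> x) = c \<odot>\<^bsub>W\<^esub> \<phi> x) \<and>
     (\<forall>g\<in>carrier G. \<forall>x\<in>carrier V. \<phi> (act V g x) = act W g (\<phi> x)))"

definition lin_span :: "('k::field, 'v, 'g) representation \<Rightarrow> 'v set \<Rightarrow> 'v set" where
  "lin_span V S = (\<lambda>W. submodule W (ring_of_type_algebra :: 'k ring) V) hull S"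

text \<open>
  The map induced on cosets of \<open>W\<close> by a linear map \<open>f\<close> preserving \<open>W\<close>:
  it sends \<open>W + x\<close> to \<open>W + f x\<close>. Adding \<open>W\<close> to the image
  is needed because \<open>f\<close> may fail to be surjective.
\<close>

definition quot_map :: "('k, 'v, 'g) representation \<Rightarrow> 'v set \<Rightarrow> ('v \<Rightarrow> 'v) \<Rightarrow> 'v set \<Rightarrow> 'v set" where
  "quot_map V W f S = W <+>\<^bsub>V\<^esub> f ` S"

definition quot_rep :: "('k, 'v, 'g) representation \<Rightarrow> 'v set \<Rightarrow> ('k, 'v set, 'g) representation" where
  "quot_rep V W =
     \<lparr>carrier = a_rcosets\<^bsub>V\<^esub> W, monoid.mult = undefined, one = undefined,
      ring.zero = W, add = set_add V,
      smult = (\<lambda>c. quot_map V W (smult V c)),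
      act = (\<lambda>g. quot_map V W (act V g))\<rparr>"

definition dual_rep ::
    "'g monoid \<Rightarrow> ('k::field, 'v, 'g) representation \<Rightarrow> ('k, 'v \<Rightarrow> 'k, 'g) representation" where
  "dual_rep G V =
     \<lparr>carrier = {f \<in> extensional (carrier V).
        (\<forall>x\<in>carrier V. \<forall>y\<in>carrier V. f (x \<oplus>\<^bsub>V\<^esub> y) = f x + f y) \<and>
        (\<forall>c. \<forall>x\<in>carrier V. f (c \<odot>\<^bsub>V\<^esub> x) = c * f x)},
      monoid.mult = undefined, one = undefined,
      ring.zero = (\<lambda>x\<in>carrier V. 0), add = (\<lambda>f h. \<lambda>x\<in>carrier V. f x + h x),
      smult = (\<lambda>c f. \<lambda>x\<in>carrier V. c * f x),
      act = (\<lambda>g f. \<lambda>x\<in>carrier V. f (act V (inv\<^bsub>G\<^esub> g) x))\<rparr>"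


section \<open>Free vector spaces and tensor products\<close>

definition push :: "('x \<Rightarrow> 'y) \<Rightarrow> ('x \<Rightarrow>\<^sub>0 'k::field) \<Rightarrow> ('y \<Rightarrow>\<^sub>0 'k)" where
  "push h p = (\<Sum>x\<in>Poly_Mapping.keys p. Poly_Mapping.single (h x) (Poly_Mapping.lookup p x))"

definition free_rep :: "'x set \<Rightarrow> ('g \<Rightarrow> 'x \<Rightarrow> 'x) \<Rightarrow> ('k::field, 'x \<Rightarrow>\<^sub>0 'k, 'g) representation" where
  "free_rep S \<alpha> =
     \<lparr>carrier = {p. Poly_Mapping.keys p \<subseteq> S}, monoid.mult = undefined, one = undefined,
      ring.zero = 0, add = (+),
      smult = (\<lambda>c. Poly_Mapping.map ((*) c)),
      act = (\<lambda>g. push (\<alpha> g))\<rparr>"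

definition tensor_rels ::
    "('k::field, 'v, 'g) representation \<Rightarrow> ('k, 'w, 'g) representation \<Rightarrow> ('v \<times> 'w \<Rightarrow>\<^sub>0 'k) set" where
  "tensor_rels V W =
     {Poly_Mapping.single (x \<oplus>\<^bsub>V\<^esub> x', y) 1 - Poly_Mapping.single (x, y) 1 - Poly_Mapping.single (x', y) 1
        | x x' y. x \<in> carrier V \<and> x' \<in> carrier V \<and> y \<in> carrier W} \<union>
     {Poly_Mapping.single (x, y \<oplus>\<^bsub>W\<^esub> y') 1 - Poly_Mapping.single (x, y) 1 - Poly_Mapping.single (x, y') 1
        | x y y'. x \<in> carrier V \<and> y \<in> carrier W \<and> y' \<in> carrier W} \<union>
     {Poly_Mapping.single (c \<odot>\<^bsub>V\<^esub> x, y) 1 - Poly_Mapping.single (x, y) c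
        | c x y. x \<in> carrier V \<and> y \<in> carrier W} \<union>
     {Poly_Mapping.single (x, c \<odot>\<^bsub>W\<^esub> y) 1 - Poly_Mapping.single (x, y) c
        | c x y. x \<in> carrier V \<and> y \<in> carrier W}"

definition tensor_rep ::
    "('k::field, 'v, 'g) representation \<Rightarrow> ('k, 'w, 'g) representation
       \<Rightarrow> ('k, ('v \<times> 'w \<Rightarrow>\<^sub>0 'k) set, 'g) representation" where
  "tensor_rep V W =
     (let F = free_rep (carrier V \<times> carrier W) (\<lambda>g. map_prod (act V g) (act W g))
      in quot_rep F (lin_span F (tensor_rels V W)))"

text \<open>
  The \<open>r\<close>-th tensor power is built in one step from lists of \<open>r\<close> vectors, so that
  its type does not depend on \<open>r\<close>. For \<open>r = 0\<close> it is the trivial representation,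
  spanned by the empty list.
\<close>

definition power_lists :: "nat \<Rightarrow> ('k, 'v, 'g) representation \<Rightarrow> 'v list set" where
  "power_lists r V = {xs. set xs \<subseteq> carrier V \<and> length xs = r}"

definition power_rels :: "nat \<Rightarrow> ('k::field, 'v, 'g) representation \<Rightarrow> ('v list \<Rightarrow>\<^sub>0 'k) set" where
  "power_rels r V =
     {Poly_Mapping.single (xs[i := x \<oplus>\<^bsub>V\<^esub> y]) 1
          - Poly_Mapping.single (xs[i := x]) 1 - Poly_Mapping.single (xs[i := y]) 1
        | xs i x y. xs \<in> power_lists r V \<and> i < r \<and> x \<in> carrier V \<and> y \<in> carrier V} \<union>
     {Poly_Mapping.single (xs[i := c \<odot>\<^bsub>V\<^esub> x]) 1 - Poly_Mapping.single (xs[i := x]) c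
        | xs i c x. xs \<in> power_lists r V \<and> i < r \<and> x \<in> carrier V}"

definition power_free ::
    "nat \<Rightarrow> ('k::field, 'v, 'g) representation \<Rightarrow> ('k, 'v list \<Rightarrow>\<^sub>0 'k, 'g) representation" where
  "power_free r V = free_rep (power_lists r V) (\<lambda>g. map (act V g))"

definition power_kernel :: "nat \<Rightarrow> ('k::field, 'v, 'g) representation \<Rightarrow> ('v list \<Rightarrow>\<^sub>0 'k) set" where
  "power_kernel r V = lin_span (power_free r V) (power_rels r V)"

definition tensor_power ::
    "nat \<Rightarrow> ('k::field, 'v, 'g) representation \<Rightarrow> ('k, ('v list \<Rightarrow>\<^sub>0 'k) set, 'g) representation" where
  "tensor_power r V = quot_rep (power_free r V) (power_kernel r V)"

definition pure_tensor ::
    "nat \<Rightarrow> ('k::field, 'v, 'g) representation \<Rightarrow> 'v list \<Rightarrow> ('v list \<Rightarrow>\<^sub>0 'k) set" where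
  "pure_tensor r V xs = power_kernel r V +>\<^bsub>power_free r V\<^esub> Poly_Mapping.single xs 1"


section \<open>Exterior and symmetric powers\<close>

text \<open>
  The alternating relations are imposed in every characteristic, including 2: a pure tensor
  with two equal factors vanishes.
\<close>

definition ext_power ::
    "nat \<Rightarrow> ('k::field, 'v, 'g) representation \<Rightarrow> ('k, ('v list \<Rightarrow>\<^sub>0 'k) set set, 'g) representation" where
  "ext_power r V =
     quot_rep (tensor_power r V)
       (lin_span (tensor_power r V)
          {pure_tensor r V xs | xs. xs \<in> power_lists r V \<and> \<not> distinct xs})"

text \<open>
  Place permutation is the right action
  \<open>(x\<^sub>0 \<otimes> \<dots> \<otimes> x\<^sub>{r-1}) \<cdot> \<sigma> = x\<^sub>{\<sigma>(0)} \<otimes> \<dots> \<otimes> x\<^sub>{\<sigma>(r-1)}\<close>.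
\<close>

definition place_perm ::
    "nat \<Rightarrow> ('k::field, 'v, 'g) representation \<Rightarrow> (nat \<Rightarrow> nat)
       \<Rightarrow> ('v list \<Rightarrow>\<^sub>0 'k) set \<Rightarrow> ('v list \<Rightarrow>\<^sub>0 'k) set" where
  "place_perm r V \<sigma> = quot_map (power_free r V) (power_kernel r V) (push (permute_list \<sigma>))"

definition sym_invariants ::
    "nat \<Rightarrow> ('k::field, 'v, 'g) representation \<Rightarrow> ('k, ('v list \<Rightarrow>\<^sub>0 'k) set, 'g) representation" where
  "sym_invariants r V =
     (tensor_power r V)\<lparr>carrier :=
        {w \<in> carrier (tensor_power r V). \<forall>\<sigma>. \<sigma> permutes {..<r} \<longrightarrow> place_perm r V \<sigma> w = w}\<rparr>"

definition sym_coinvariants ::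
    "nat \<Rightarrow> ('k::field, 'v, 'g) representation \<Rightarrow> ('k, ('v list \<Rightarrow>\<^sub>0 'k) set set, 'g) representation" where
  "sym_coinvariants r V =
     quot_rep (tensor_power r V)
       (lin_span (tensor_power r V)
          {place_perm r V \<sigma> w \<ominus>\<^bsub>tensor_power r V\<^esub> w
             | \<sigma> w. \<sigma> permutes {..<r} \<and> w \<in> carrier (tensor_power r V)})"


section \<open>The general linear group of rank 2\<close>

definition GL2 :: "('k::field^2^2) monoid" where
  "GL2 = \<lparr>carrier = {A. invertible A}, monoid.mult = (**), one = mat 1\<rparr>"

definition natural_rep :: "('k::field, 'k^2, 'k^2^2) representation" where
  "natural_rep =
     \<lparr>carrier = UNIV, monoid.mult = undefined, one = undefined, ring.zero = 0, add = (+),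
      smult = (*s), act = (*v)\<rparr>"

definition det_rep :: "('k::field, (('k^2) list \<Rightarrow>\<^sub>0 'k) set set, 'k^2^2) representation" where
  "det_rep = ext_power 2 natural_rep"

end

(* With r = l + m - 1, the area form x1*y2 - x2*y1 on E induces a perfect pairing between the invariants
   U = Sym_r E and the coinvariants V = Sym^r E, which g multiplies by (det g)^r. Let u_0, ..., u_r and
   v_0, ..., v_r be dual bases and vol(x_0, ..., x_r) = det (u_i, x_j). Both exterior powers embed into
   alternating m-forms on V: x_1 ^ ... ^ x_l is sent to w |-> vol(x, w), and y_1 ^ ... ^ y_m to
   w |-> det (y_i, w_j). On w running through increasing lists of basis vectors both families are
   diagonal, so both maps are bijective, and composing one with the inverse of the other gives the
   isomorphism. The two actions on forms differ by det(g on V) / (det g)^(r*m), and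
   det(g on V) = (det g)^(r(r+1)/2) because GL_2 is generated by triangular matrices. *)

theory Submission
  imports Defs "Jordan_Normal_Form.Determinant"
begin

section \<open>Representations, subspaces and functionals\<close>

text \<open>The classical route is \<Lambda>^l V = \<Lambda>^m V* \<otimes> det V, followed by an
  identification of V* with a twist of U. Both maps are replaced here by evaluation on lists of
  vectors: forms on V are a common target that requires neither a duality theorem for exterior
  powers nor the dual representation of V. Invariants and coinvariants have to sit on opposite sides
  because in small characteristic Sym_r E is a space of divided powers, dual to Sym^r E up to a
  twist but in general not isomorphic to it. For the same reason the dual basis of invariants is
  prescribed by its values under the pairing, never by averaging over S_r. The exponent is r(r+1)/2
  - rm with r + 1 = l + m, that is (l - m)(l + m - 1)/2. Its sign does not affect the argument: the
  power of det E enters only as a one-dimensional space with a known character, so positive powers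
  and powers of the dual are two instances of one theorem. The case l = m = 0 stands apart since r +
  1 = l + m fails there.\<close>

lemma ring_of_type_algebra_simps [simp]:
  "carrier (ring_of_type_algebra :: 'k::field ring) = UNIV"
  "x \<oplus>\<^bsub>ring_of_type_algebra\<^esub> y = (x + y :: 'k)"
  "x \<otimes>\<^bsub>ring_of_type_algebra\<^esub> y = (x * y :: 'k)"
  "\<one>\<^bsub>ring_of_type_algebra\<^esub> = (1 :: 'k)"
  "\<zero>\<^bsub>ring_of_type_algebra\<^esub> = (0 :: 'k)"
  by (simp_all add: ring_of_type_algebra_def)

definition subspace_of :: "('k::field, 'v, 'g) representation \<Rightarrow> 'v set \<Rightarrow> bool" where
  "subspace_of V Y \<longleftrightarrow> Y \<subseteq> carrier V \<and> \<zero>\<^bsub>V\<^esub> \<in> Y \<and>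
     (\<forall>x\<in>Y. \<forall>y\<in>Y. x \<oplus>\<^bsub>V\<^esub> y \<in> Y) \<and> (\<forall>c. \<forall>x\<in>Y. c \<odot>\<^bsub>V\<^esub> x \<in> Y)"

text \<open>Stated through subspaces rather than linear combinations: a condition that cuts out a
  subspace holds everywhere once it holds on B, so a spanning set works as an induction
  principle.\<close>

definition spans :: "('k::field, 'v, 'g) representation \<Rightarrow> 'v set \<Rightarrow> bool" where
  "spans V B \<longleftrightarrow> B \<subseteq> carrier V \<and> (\<forall>Y. subspace_of V Y \<longrightarrow> B \<subseteq> Y \<longrightarrow> carrier V \<subseteq> Y)"

definition functional :: "('k::field, 'v, 'g) representation \<Rightarrow> ('v \<Rightarrow> 'k) \<Rightarrow> bool" where
  "functional V f \<longleftrightarrow> (\<forall>x\<in>carrier V. \<forall>y\<in>carrier V. f (x \<oplus>\<^bsub>V\<^esub> y) = f x + f y) \<and>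
     (\<forall>c. \<forall>x\<in>carrier V. f (c \<odot>\<^bsub>V\<^esub> x) = c * f x)"

definition linear_between ::
    "('k::field, 'v, 'g) representation \<Rightarrow> ('k, 'w, 'g) representation \<Rightarrow> ('v \<Rightarrow> 'w) \<Rightarrow> bool" where
  "linear_between V W f \<longleftrightarrow> f \<in> carrier V \<rightarrow> carrier W \<and>
     (\<forall>x\<in>carrier V. \<forall>y\<in>carrier V. f (x \<oplus>\<^bsub>V\<^esub> y) = f x \<oplus>\<^bsub>W\<^esub> f y) \<and>
     (\<forall>c. \<forall>x\<in>carrier V. f (c \<odot>\<^bsub>V\<^esub> x) = c \<odot>\<^bsub>W\<^esub> f x)"

lemma subspace_of_span_arg: "subspace_of V Y \<Longrightarrow> spans V B \<Longrightarrow> B \<subseteq> Y \<Longrightarrow> x \<in> carrier V \<Longrightarrow> x \<in> Y"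
  by (auto simp: spans_def)

lemma functional_add: "functional V f \<Longrightarrow> x \<in> carrier V \<Longrightarrow> y \<in> carrier V \<Longrightarrow> f (x \<oplus>\<^bsub>V\<^esub> y) = f x + f y"
  and functional_smult: "functional V f \<Longrightarrow> x \<in> carrier V \<Longrightarrow> f (c \<odot>\<^bsub>V\<^esub> x) = c * f x"
  by (auto simp: functional_def)

lemma functional_plus: "functional V f \<Longrightarrow> functional V g \<Longrightarrow> functional V (\<lambda>x. f x + g x)"
  and functional_times: "functional V f \<Longrightarrow> functional V (\<lambda>x. c * f x)"
  and functional_times_right: "functional V f \<Longrightarrow> functional V (\<lambda>x. f x * c)"
  and functional_null: "functional V (\<lambda>x. 0)"
  by (auto simp: functional_def algebra_simps)

lemma linear_betweenD:
  assumes "linear_between V W f"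
  shows "x \<in> carrier V \<Longrightarrow> f x \<in> carrier W"
    and "x \<in> carrier V \<Longrightarrow> y \<in> carrier V \<Longrightarrow> f (x \<oplus>\<^bsub>V\<^esub> y) = f x \<oplus>\<^bsub>W\<^esub> f y"
    and "x \<in> carrier V \<Longrightarrow> f (c \<odot>\<^bsub>V\<^esub> x) = c \<odot>\<^bsub>W\<^esub> f x"
  using assms by (auto simp: linear_between_def)

lemma functional_comp: "functional W f \<Longrightarrow> linear_between V W h \<Longrightarrow> functional V (\<lambda>x. f (h x))"
  by (auto simp: functional_def linear_between_def Pi_def)

lemma linear_between_comp:
  "linear_between V W f \<Longrightarrow> linear_between W B h \<Longrightarrow> linear_between V B (\<lambda>x. h (f x))"
  by (auto simp: linear_between_def Pi_def)

lemma spans_trans: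
  assumes "spans V B" "Z \<subseteq> carrier V" "\<And>Y x. subspace_of V Y \<Longrightarrow> Z \<subseteq> Y \<Longrightarrow> x \<in> B \<Longrightarrow> x \<in> Y"
  shows "spans V Z"
  unfolding spans_def using assms subspace_of_span_arg[OF _ assms(1)] by blast

locale linear_space = module "ring_of_type_algebra :: 'k::field ring" V
  for V :: "('k::field, 'v, 'g) representation" (structure)
begin

lemma smult_in [simp, intro]: "x \<in> carrier V \<Longrightarrow> c \<odot> x \<in> carrier V"
  by simp

lemma smult_plus: "x \<in> carrier V \<Longrightarrow> (a + b) \<odot> x = a \<odot> x \<oplus> b \<odot> x"
  using smult_l_distr[of a b x] by simp

lemma smult_times: "x \<in> carrier V \<Longrightarrow> (a * b) \<odot> x = a \<odot> (b \<odot> x)"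
  using smult_assoc1[of a b x] by simp

lemma smult_1 [simp]: "x \<in> carrier V \<Longrightarrow> 1 \<odot> x = x"
  using smult_one[of x] by simp

lemma smult_0 [simp]: "x \<in> carrier V \<Longrightarrow> 0 \<odot> x = \<zero>"
  using smult_l_null[of x] by simp

lemma smult_zero [simp]: "c \<odot> \<zero> = \<zero>"
  using smult_r_null[of c] by simp

lemma minus_one_smult: "x \<in> carrier V \<Longrightarrow> (- 1) \<odot> x = \<ominus> x"
proof -
  assume x: "x \<in> carrier V"
  have "x \<oplus> (- 1) \<odot> x = (1 + - 1) \<odot> x"
    unfolding smult_plus[OF x] by (simp only: smult_1[OF x])
  also have "\<dots> = \<zero>" using x by simp
  finally show ?thesis
    using x by (metis M.minus_equality M.a_comm smult_in)
qed

lemma subspace_of_iff: "subspace_of V Y \<longleftrightarrow> submodule Y (ring_of_type_algebra :: 'k ring) V"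
proof
  assume Y: "subspace_of V Y"
  then have "\<ominus> a \<in> Y" if "a \<in> Y" for a
    using that minus_one_smult[of a] unfolding subspace_of_def by (metis in_mono)
  with Y show "submodule Y (ring_of_type_algebra :: 'k ring) V"
    by (intro submoduleI) (auto simp: subspace_of_def)
next
  assume Y: "submodule Y (ring_of_type_algebra :: 'k ring) V"
  show "subspace_of V Y"
    unfolding subspace_of_def
    using submoduleE[OF Y] subgroup.one_closed[OF submodule.axioms(1)[OF Y]] by auto
qed

lemma subspace_ofD:
  assumes "subspace_of V Y"
  shows "x \<in> Y \<Longrightarrow> x \<in> carrier V" "\<zero> \<in> Y" "x \<in> Y \<Longrightarrow> y \<in> Y \<Longrightarrow> x \<oplus> y \<in> Y"
    "x \<in> Y \<Longrightarrow> c \<odot> x \<in> Y" "x \<in> Y \<Longrightarrow> \<ominus> x \<in> Y" "x \<in> Y \<Longrightarrow> y \<in> Y \<Longrightarrow> x \<ominus> y \<in> Y"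
proof -
  have sub: "submodule Y (ring_of_type_algebra :: 'k ring) V"
    using assms by (simp add: subspace_of_iff)
  show "x \<in> Y \<Longrightarrow> x \<in> carrier V" "\<zero> \<in> Y" "x \<in> Y \<Longrightarrow> y \<in> Y \<Longrightarrow> x \<oplus> y \<in> Y"
    "x \<in> Y \<Longrightarrow> c \<odot> x \<in> Y" using assms by (auto simp: subspace_of_def)
  show neg: "x \<in> Y \<Longrightarrow> \<ominus> x \<in> Y" for x using submoduleE[OF sub] by auto
  show "x \<in> Y \<Longrightarrow> y \<in> Y \<Longrightarrow> x \<ominus> y \<in> Y"
    using assms neg[of y] by (auto simp: subspace_of_def a_minus_def)
qed

lemma subspace_of_carrier: "subspace_of V (carrier V)"
  by (simp add: subspace_of_def)

lemma lin_span_eq: "lin_span V S = \<Inter>{Y. subspace_of V Y \<and> S \<subseteq> Y}"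
  unfolding lin_span_def hull_def subspace_of_iff by simp

lemma lin_span_subspace:
  assumes "S \<subseteq> carrier V"
  shows "subspace_of V (lin_span V S)"
proof -
  have "lin_span V S \<subseteq> carrier V"
    unfolding lin_span_eq using subspace_of_carrier assms by blast
  then show ?thesis
    unfolding lin_span_eq by (auto simp: subspace_of_def)
qed

lemma lin_span_superset: "S \<subseteq> lin_span V S"
  unfolding lin_span_eq by auto

lemma lin_span_minimal: "subspace_of V Y \<Longrightarrow> S \<subseteq> Y \<Longrightarrow> lin_span V S \<subseteq> Y"
  unfolding lin_span_eq by auto

lemma functional_zero: "functional V f \<Longrightarrow> f \<zero> = 0"
  using functional_smult[of V f \<zero> 0] by simp

lemma functional_minus:
  assumes "functional V f" "x \<in> carrier V" "y \<in> carrier V"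
  shows "f (x \<ominus> y) = f x - f y"
  unfolding a_minus_def minus_one_smult[OF assms(3), symmetric]
  using assms by (simp add: functional_add functional_smult)

lemma kernel_subspace: "functional V f \<Longrightarrow> subspace_of V {x \<in> carrier V. f x = 0}"
  by (auto simp: subspace_of_def functional_add functional_smult functional_zero)

lemma functional_eq_on_span:
  assumes "functional V f" "functional V h" "spans V B" "\<And>x. x \<in> B \<Longrightarrow> f x = h x" "x \<in> carrier V"
  shows "f x = h x"
proof -
  have "subspace_of V {x \<in> carrier V. f x + (- 1) * h x = 0}"
    using assms by (intro kernel_subspace functional_plus functional_times)
  from subspace_of_span_arg[OF this assms(3) _ assms(5)] show ?thesis
    using assms(3,4) by (auto simp: spans_def)
qed

lemma functional_vanishes_on_lin_span:
  assumes "functional V f" "S \<subseteq> carrier V" "\<And>x. x \<in> S \<Longrightarrow> f x = 0" "x \<in> lin_span V S"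
  shows "f x = 0"
  using lin_span_minimal[OF kernel_subspace[OF assms(1)], of S] assms by auto

lemma linear_between_zero:
  assumes "linear_between V W f" "linear_space W"
  shows "f \<zero> = \<zero>\<^bsub>W\<^esub>"
  using linear_betweenD[OF assms(1), of \<zero>] linear_space.smult_0[OF assms(2)] smult_0[of \<zero>]
  by (metis zero_closed)

lemma linear_between_preimage:
  assumes "linear_between V W f" "linear_space W" "subspace_of W Y"
  shows "subspace_of V {x \<in> carrier V. f x \<in> Y}"
  using assms linear_between_zero[OF assms(1,2)]
  by (auto simp: subspace_of_def linear_between_def)

lemma linear_between_eq_on_span:
  assumes f: "linear_between V W f" and h: "linear_between V W h"
    and W: "linear_space W" and B: "spans V B" "\<And>x. x \<in> B \<Longrightarrow> f x = h x" "x \<in> carrier V"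
  shows "f x = h x"
proof -
  have "subspace_of V {x \<in> carrier V. f x = h x}"
    using f h linear_between_zero[OF f W] linear_between_zero[OF h W]
    by (auto simp: subspace_of_def linear_between_def)
  from subspace_of_span_arg[OF this B(1) _ B(3)] show ?thesis
    using B(1,2) by (auto simp: spans_def)
qed

lemma linear_between_lin_span:
  assumes f: "linear_between V W f" and W: "linear_space W" and S: "S \<subseteq> carrier V"
    and Y: "subspace_of W Y" "\<And>x. x \<in> S \<Longrightarrow> f x \<in> Y" and x: "x \<in> lin_span V S"
  shows "f x \<in> Y"
  using lin_span_minimal[OF linear_between_preimage[OF f W Y(1)], of S] S Y(2) x by auto

lemma spans_image:
  assumes f: "linear_between V W f" "linear_space W" "f ` carrier V = carrier W" and B: "spans V B"
  shows "spans W (f ` B)"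
  unfolding spans_def
proof (intro conjI allI impI)
  show "f ` B \<subseteq> carrier W" using B f by (auto simp: spans_def)
  fix Y assume Y: "subspace_of W Y" "f ` B \<subseteq> Y"
  have "x \<in> {x \<in> carrier V. f x \<in> Y}" if "x \<in> carrier V" for x
    using subspace_of_span_arg[OF linear_between_preimage[OF f(1,2) Y(1)] B _ that] Y B
    by (auto simp: spans_def)
  then show "carrier W \<subseteq> Y" unfolding f(3)[symmetric] by auto
qed

section \<open>Families of vectors and functionals in diagonal position\<close>

lemma functional_finsum:
  assumes "functional V f" "finite A" "h \<in> A \<rightarrow> carrier V"
  shows "f (\<Oplus>i\<in>A. h i) = (\<Sum>i\<in>A. f (h i))"
  using assms(2,3)
proof (induction A rule: finite_induct)
  case empty
  show ?case using functional_zero[OF assms(1)] by simp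
next
  case (insert i A)
  then show ?case using assms(1) by (simp add: functional_add Pi_def)
qed

lemma finsum_in_subspace:
  assumes "subspace_of V Y" "finite A" "\<And>i. i \<in> A \<Longrightarrow> h i \<in> Y"
  shows "(\<Oplus>i\<in>A. h i) \<in> Y"
  using assms(2,3)
proof (induction A rule: finite_induct)
  case empty
  show ?case using subspace_ofD(2)[OF assms(1)] by simp
next
  case (insert i A)
  then have "h \<in> A \<rightarrow> carrier V" "h i \<in> carrier V" using subspace_ofD(1)[OF assms(1)] by auto
  with insert show ?case using subspace_ofD(3)[OF assms(1)] by simp
qed

text \<open>The witness is the combination of the \<open>b t\<close> with coefficients
  \<open>c t / f t (b t)\<close>. Asking the diagonal values merely to be nonzero avoids computing
  signs of permuted determinants, and allowing any subspace Y is what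
  \<open>separating_imp_spans\<close> exploits.\<close>

lemma diagonal_surj:
  assumes S: "finite S" and b: "\<And>s. s \<in> S \<Longrightarrow> b s \<in> carrier V"
    and f: "\<And>s. s \<in> S \<Longrightarrow> functional V (f s)"
    and diag: "\<And>s t. s \<in> S \<Longrightarrow> t \<in> S \<Longrightarrow> s \<noteq> t \<Longrightarrow> f s (b t) = 0"
    and nz: "\<And>s. s \<in> S \<Longrightarrow> f s (b s) \<noteq> 0"
    and Y: "subspace_of V Y" "\<And>s. s \<in> S \<Longrightarrow> b s \<in> Y"
  shows "\<exists>y\<in>Y. \<forall>s\<in>S. f s y = c s"
proof
  let ?y = "\<Oplus>t\<in>S. (c t / f t (b t)) \<odot> b t"
  show "?y \<in> Y" using Y S by (intro finsum_in_subspace subspace_ofD(4)) auto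
  show "\<forall>s\<in>S. f s ?y = c s"
  proof
    fix s assume s: "s \<in> S"
    have "f s ?y = (\<Sum>t\<in>S. f s ((c t / f t (b t)) \<odot> b t))"
      using S b f[OF s] by (intro functional_finsum) auto
    also have "\<dots> = (\<Sum>t\<in>S. if t = s then c s else 0)"
      using s b diag nz by (intro sum.cong refl) (auto simp: functional_smult[OF f[OF s]])
    finally show "f s ?y = c s" using s S by simp
  qed
qed

text \<open>The combinations of the \<open>b t\<close> form a subspace, so x is one of them;
  applying \<open>f s\<close> then isolates the coefficient of \<open>b s\<close>.\<close>

lemma diagonal_inj:
  assumes S: "finite S" and span: "spans V (b ` S)"
    and f: "\<And>s. s \<in> S \<Longrightarrow> functional V (f s)"
    and diag: "\<And>s t. s \<in> S \<Longrightarrow> t \<in> S \<Longrightarrow> s \<noteq> t \<Longrightarrow> f s (b t) = 0"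
    and nz: "\<And>s. s \<in> S \<Longrightarrow> f s (b s) \<noteq> 0"
    and x: "x \<in> carrier V" "\<And>s. s \<in> S \<Longrightarrow> f s x = 0"
  shows "x = \<zero>"
proof -
  have b: "b s \<in> carrier V" if "s \<in> S" for s using span that by (auto simp: spans_def)
  let ?L = "\<lambda>c. \<Oplus>t\<in>S. c t \<odot> b t"
  have in_carrier: "?L c \<in> carrier V" for c using b by (intro finsum_closed) auto
  have "subspace_of V (range ?L)"
    unfolding subspace_of_def
  proof (intro conjI ballI allI)
    show "range ?L \<subseteq> carrier V" using in_carrier by auto
    have "?L (\<lambda>_. 0) = (\<Oplus>t\<in>S. \<zero>)" using b by (intro finsum_cong') auto
    then have "?L (\<lambda>_. 0) = \<zero>" by simp
    then show "\<zero> \<in> range ?L" by (intro range_eqI[where x = "\<lambda>_. 0"]) simp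
  next
    fix x y assume "x \<in> range ?L" "y \<in> range ?L"
    then obtain c d where *: "x = ?L c" "y = ?L d" by auto
    have "x \<oplus> y = (\<Oplus>t\<in>S. c t \<odot> b t \<oplus> d t \<odot> b t)"
      unfolding * using b by (subst finsum_addf) auto
    also have "\<dots> = ?L (\<lambda>t. c t + d t)" using b by (intro finsum_cong') (auto simp: smult_plus)
    finally show "x \<oplus> y \<in> range ?L" by (rule range_eqI[where x = "\<lambda>t. c t + d t"])
  next
    fix x a assume "x \<in> range ?L"
    then obtain c where *: "x = ?L c" by auto
    have "a \<odot> x = (\<Oplus>t\<in>S. a \<odot> (c t \<odot> b t))"
      unfolding * using b S by (subst finsum_smult_ldistr) auto
    also have "\<dots> = ?L (\<lambda>t. a * c t)" using b by (intro finsum_cong') (auto simp: smult_times)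
    finally show "a \<odot> x \<in> range ?L" by (rule range_eqI[where x = "\<lambda>t. a * c t"])
  qed
  moreover have "b ` S \<subseteq> range ?L"
  proof
    fix y assume "y \<in> b ` S"
    then obtain s where s: "s \<in> S" "y = b s" by auto
    have "?L (\<lambda>t. if t = s then 1 else 0) = (\<Oplus>t\<in>S. if s = t then b t else \<zero>)"
      using b s by (intro finsum_cong') auto
    also have "\<dots> = b s" using s b S by (intro finsum_singleton) auto
    finally show "y \<in> range ?L"
      unfolding s(2) by (intro range_eqI[where x = "\<lambda>t. if t = s then 1 else 0"]) (rule sym)
  qed
  ultimately have "x \<in> range ?L"
    using subspace_of_span_arg[OF _ span _ x(1)] by blast
  then obtain c where c: "x = ?L c" by auto
  have "c s = 0" if s: "s \<in> S" for s
  proof -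
    have "f s x = (\<Sum>t\<in>S. f s (c t \<odot> b t))"
      unfolding c using S b f[OF s] by (intro functional_finsum) auto
    also have "\<dots> = (\<Sum>t\<in>S. if t = s then c s * f s (b s) else 0)"
      using s b diag by (intro sum.cong refl) (auto simp: functional_smult[OF f[OF s]])
    finally show ?thesis using x(2)[OF s] nz[OF s] s S by simp
  qed
  then have "x = (\<Oplus>t\<in>S. \<zero>)" unfolding c using b by (intro finsum_cong') auto
  then show ?thesis by simp
qed

text \<open>Turns separation into spanning: a given subspace Y contains some y with the same values
  as x, and x - y is killed by every \<open>f s\<close>. This yields a spanning set where no
  generators are at hand, as for the symmetric tensors.\<close>

lemma separating_imp_spans:
  assumes S: "finite S" and b: "\<And>s. s \<in> S \<Longrightarrow> b s \<in> carrier V"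
    and f: "\<And>s. s \<in> S \<Longrightarrow> functional V (f s)"
    and diag: "\<And>s t. s \<in> S \<Longrightarrow> t \<in> S \<Longrightarrow> s \<noteq> t \<Longrightarrow> f s (b t) = 0"
    and nz: "\<And>s. s \<in> S \<Longrightarrow> f s (b s) \<noteq> 0"
    and sep: "\<And>x. x \<in> carrier V \<Longrightarrow> (\<And>s. s \<in> S \<Longrightarrow> f s x = 0) \<Longrightarrow> x = \<zero>"
  shows "spans V (b ` S)"
  unfolding spans_def
proof (intro conjI allI impI subsetI)
  show "x \<in> carrier V" if "x \<in> b ` S" for x using that b by auto
  fix Y x assume Y: "subspace_of V Y" "b ` S \<subseteq> Y" and x: "x \<in> carrier V"
  obtain y where y: "y \<in> Y" "\<forall>s\<in>S. f s y = f s x"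
    using diagonal_surj[where b = b and f = f and c = "\<lambda>s. f s x", OF S b f diag nz Y(1)] Y(2) by blast
  have yV: "y \<in> carrier V" using subspace_ofD(1)[OF Y(1)] y(1) .
  have "x \<ominus> y = \<zero>"
    using x yV y(2) by (intro sep) (auto simp: functional_minus[OF f])
  moreover have "x = (x \<ominus> y) \<oplus> y" using x yV by (simp add: a_minus_def M.a_assoc M.l_neg)
  ultimately show "x \<in> Y" using y(1) yV by simp
qed

end

text \<open>Only linearity of each operator is recorded. The group law is established for the
  coinvariants in \<open>act_coinvariants_mult\<close>, and inverses enter the complement theorem as
  an explicit function.\<close>

locale linear_rep = linear_space V for V :: "('k::field, 'v, 'g) representation" (structure) +
  assumes act_linear: "linear_between V V (act V g)"
begin

lemma act_closed [simp, intro]: "x \<in> carrier V \<Longrightarrow> act V g x \<in> carrier V"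
  using linear_betweenD(1)[OF act_linear] .

lemma act_add: "x \<in> carrier V \<Longrightarrow> y \<in> carrier V \<Longrightarrow> act V g (x \<oplus> y) = act V g x \<oplus> act V g y"
  using linear_betweenD(2)[OF act_linear] .

lemma act_smult: "x \<in> carrier V \<Longrightarrow> act V g (c \<odot> x) = c \<odot> act V g x"
  using linear_betweenD(3)[OF act_linear] .

end

lemma linear_spaceI:
  fixes V :: "('k::field, 'v, 'g) representation" (structure)
  assumes "\<zero> \<in> carrier V"
    and "\<And>x y. x \<in> carrier V \<Longrightarrow> y \<in> carrier V \<Longrightarrow> x \<oplus> y \<in> carrier V"
    and "\<And>x y z. x \<in> carrier V \<Longrightarrow> y \<in> carrier V \<Longrightarrow> z \<in> carrier V \<Longrightarrow> (x \<oplus> y) \<oplus> z = x \<oplus> (y \<oplus> z)"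
    and "\<And>x y. x \<in> carrier V \<Longrightarrow> y \<in> carrier V \<Longrightarrow> x \<oplus> y = y \<oplus> x"
    and "\<And>x. x \<in> carrier V \<Longrightarrow> \<zero> \<oplus> x = x"
    and "\<And>x. x \<in> carrier V \<Longrightarrow> (- 1) \<odot> x \<oplus> x = \<zero>"
    and "\<And>c x. x \<in> carrier V \<Longrightarrow> c \<odot> x \<in> carrier V"
    and "\<And>c d x. x \<in> carrier V \<Longrightarrow> (c + d) \<odot> x = c \<odot> x \<oplus> d \<odot> x"
    and "\<And>c x y. x \<in> carrier V \<Longrightarrow> y \<in> carrier V \<Longrightarrow> c \<odot> (x \<oplus> y) = c \<odot> x \<oplus> c \<odot> y"
    and "\<And>c d x. x \<in> carrier V \<Longrightarrow> (c * d) \<odot> x = c \<odot> (d \<odot> x)"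
    and "\<And>x. x \<in> carrier V \<Longrightarrow> 1 \<odot> x = x"
  shows "linear_space V"
proof -
  have "abelian_group V"
    using assms by (intro abelian_groupI) (auto, meson)
  then show ?thesis
    unfolding linear_space_def using assms by (intro moduleI cring_from_type_algebra) auto
qed

section \<open>Quotients\<close>

definition coset_of :: "('k, 'v, 'g) representation \<Rightarrow> 'v set \<Rightarrow> 'v \<Rightarrow> 'v set" where
  "coset_of V W x = W +>\<^bsub>V\<^esub> x"

text \<open>Only meaningful for functions that are constant on the coset \<open>C\<close>.\<close>

definition descend :: "('v \<Rightarrow> 'a) \<Rightarrow> 'v set \<Rightarrow> 'a" where
  "descend f C = f (SOME x. x \<in> C)"

locale quotient_space = linear_space V for V :: "('k::field, 'v, 'g) representation" (structure) +
  fixes W assumes W: "subspace_of V W"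
begin

sublocale sub: abelian_subgroup W V
proof -
  have "additive_subgroup W V"
    using submodule.axioms(1) W subspace_of_iff by (intro additive_subgroupI) blast
  then show "abelian_subgroup W V"
    by (intro abelian_subgroupI3 M.abelian_group_axioms)
qed

lemma quot_carrier: "carrier (quot_rep V W) = coset_of V W ` carrier V"
  by (auto simp: quot_rep_def coset_of_def A_RCOSETS_defs a_r_coset_def)

lemma coset_of_add: "x \<in> carrier V \<Longrightarrow> y \<in> carrier V \<Longrightarrow>
    coset_of V W x \<oplus>\<^bsub>quot_rep V W\<^esub> coset_of V W y = coset_of V W (x \<oplus> y)"
  using sub.a_rcos_sum by (simp add: quot_rep_def coset_of_def)

lemma coset_of_set: "coset_of V W x = {w \<oplus> x | w. w \<in> W}"
  by (auto simp: coset_of_def a_r_coset_def')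

lemma mem_coset_of_iff:
  "x \<in> carrier V \<Longrightarrow> y \<in> carrier V \<Longrightarrow> y \<in> coset_of V W x \<longleftrightarrow> y \<ominus> x \<in> W"
  unfolding coset_of_def a_minus_def by (rule sub.a_rcos_module)

lemma mem_coset_of_self: "x \<in> carrier V \<Longrightarrow> x \<in> coset_of V W x"
  unfolding coset_of_def by (rule sub.a_rcos_self)

lemma coset_of_eq_iff:
  assumes "x \<in> carrier V" "y \<in> carrier V"
  shows "coset_of V W x = coset_of V W y \<longleftrightarrow> x \<ominus> y \<in> W"
proof
  show "x \<ominus> y \<in> W" if "coset_of V W x = coset_of V W y"
    using that mem_coset_of_self[OF assms(1)] mem_coset_of_iff[OF assms(2,1)] by simp
  show "coset_of V W x = coset_of V W y" if "x \<ominus> y \<in> W"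
    using that mem_coset_of_iff[OF assms(2,1)] sub.a_repr_independence'[of x y] assms
    by (simp add: coset_of_def)
qed

lemma coset_of_zero: "coset_of V W \<zero> = W"
  unfolding coset_of_set using subspace_ofD(1)[OF W] by force

lemma coset_of_eq_zero_iff: "x \<in> carrier V \<Longrightarrow> coset_of V W x = \<zero>\<^bsub>quot_rep V W\<^esub> \<longleftrightarrow> x \<in> W"
  using coset_of_eq_iff[of x \<zero>] coset_of_zero minus_one_smult[of \<zero>, symmetric]
  by (simp add: quot_rep_def a_minus_def)

text \<open>f maps W + x onto f W + f x, possibly a proper part of a coset. The summand W in
  \<open>quot_map\<close> fills it up, and it absorbs f W because f preserves W.\<close>

lemma quot_map_coset_of:
  assumes f: "linear_between V V f" "\<And>w. w \<in> W \<Longrightarrow> f w \<in> W" and x: "x \<in> carrier V"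
  shows "quot_map V W f (coset_of V W x) = coset_of V W (f x)"
proof -
  note in_carrier = subspace_ofD(1)[OF W] linear_betweenD(1)[OF f(1)]
  have fw: "w' \<oplus> f (w \<oplus> x) = (w' \<oplus> f w) \<oplus> f x" if "w \<in> W" "w' \<in> W" for w w'
    using that x in_carrier linear_betweenD(2)[OF f(1)] by (simp add: M.a_assoc)
  have "quot_map V W f (coset_of V W x) = {w' \<oplus> f (w \<oplus> x) | w w'. w \<in> W \<and> w' \<in> W}"
    unfolding quot_map_def coset_of_set set_add_def' by blast
  also have "\<dots> = {(w' \<oplus> f w) \<oplus> f x | w w'. w \<in> W \<and> w' \<in> W}"
    using fw by (intro Collect_cong ex_cong1) auto
  also have "\<dots> = {w \<oplus> f x | w. w \<in> W}"
  proof -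
    have zero: "w = w \<oplus> f \<zero>" if "w \<in> W" for w
      using that in_carrier linear_between_zero[OF f(1) linear_space_axioms] by simp
    have "\<exists>w0 w'. w \<oplus> f x = (w' \<oplus> f w0) \<oplus> f x \<and> w0 \<in> W \<and> w' \<in> W" if "w \<in> W" for w
      using that zero[OF that] subspace_ofD(2)[OF W] by (intro exI[of _ \<zero>] exI[of _ w]) simp
    moreover have "w' \<oplus> f w \<in> W" if "w \<in> W" "w' \<in> W" for w w'
      using that f(2) subspace_ofD(3)[OF W] by simp
    ultimately show ?thesis by auto
  qed
  finally show ?thesis unfolding coset_of_set .
qed

lemma scale_linear: "linear_between V V (\<lambda>x. c \<odot> x)"
  by (auto simp: linear_between_def smult_r_distr mult.commute simp flip: smult_times)

lemma coset_of_smult: "x \<in> carrier V \<Longrightarrow> c \<odot>\<^bsub>quot_rep V W\<^esub> coset_of V W x = coset_of V W (c \<odot> x)"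
  using quot_map_coset_of[OF scale_linear subspace_ofD(4)[OF W]] by (simp add: quot_rep_def)

lemma linear_space_quot: "linear_space (quot_rep V W)"
proof (rule linear_spaceI)
  have z: "\<zero>\<^bsub>quot_rep V W\<^esub> = coset_of V W \<zero>"
    by (simp add: coset_of_zero quot_rep_def)
  show "\<zero>\<^bsub>quot_rep V W\<^esub> \<in> carrier (quot_rep V W)" unfolding quot_carrier z by simp
  show "\<zero>\<^bsub>quot_rep V W\<^esub> \<oplus>\<^bsub>quot_rep V W\<^esub> x = x" "(- 1) \<odot>\<^bsub>quot_rep V W\<^esub> x \<oplus>\<^bsub>quot_rep V W\<^esub> x = \<zero>\<^bsub>quot_rep V W\<^esub>"
    if "x \<in> carrier (quot_rep V W)" for x
    using that unfolding quot_carrier z by (auto simp: coset_of_add coset_of_smult minus_one_smult M.l_neg)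
qed (auto simp: quot_carrier coset_of_add coset_of_smult M.a_ac smult_plus smult_times smult_r_distr)

lemma coset_of_linear: "linear_between V (quot_rep V W) (coset_of V W)"
  by (auto simp: linear_between_def quot_carrier coset_of_add coset_of_smult)

lemma linear_between_quot_map:
  assumes f: "linear_between V V f" "\<And>w. w \<in> W \<Longrightarrow> f w \<in> W"
  shows "linear_between (quot_rep V W) (quot_rep V W) (quot_map V W f)"
  using linear_betweenD[OF f(1)]
  by (auto simp: linear_between_def quot_carrier coset_of_add coset_of_smult quot_map_coset_of[OF f])

lemma spans_quot: "spans V B \<Longrightarrow> spans (quot_rep V W) (coset_of V W ` B)"
  by (rule spans_image[OF coset_of_linear linear_space_quot]) (simp_all add: quot_carrier)

text \<open>All elements of the coset have the same value, so the arbitrary representative chosen in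
  \<open>descend\<close> is harmless.\<close>

lemma descend_coset_of:
  assumes f: "functional V f" "\<And>w. w \<in> W \<Longrightarrow> f w = 0" and x: "x \<in> carrier V"
  shows "descend f (coset_of V W x) = f x"
proof -
  have const: "f y = f x" if "y \<in> coset_of V W x" for y
    using that f(2) x subspace_ofD(1)[OF W] unfolding coset_of_set by (auto simp: functional_add[OF f(1)])
  show ?thesis
    unfolding descend_def by (rule const, rule someI, rule mem_coset_of_self[OF x])
qed

lemma functional_descend:
  assumes f: "functional V f" "\<And>w. w \<in> W \<Longrightarrow> f w = 0"
  shows "functional (quot_rep V W) (descend f)"
  unfolding functional_def quot_carrier
proof (intro conjI ballI allI)
  note [simp] = coset_of_add coset_of_smult descend_coset_of[OF f]
  fix x assume "x \<in> coset_of V W ` carrier V"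
  then obtain x' where x: "x = coset_of V W x'" "x' \<in> carrier V" by auto
  show "descend f (c \<odot>\<^bsub>quot_rep V W\<^esub> x) = c * descend f x" for c
    using x by (simp add: functional_smult[OF f(1)])
  fix y assume "y \<in> coset_of V W ` carrier V"
  then obtain y' where "y = coset_of V W y'" "y' \<in> carrier V" by auto
  with x show "descend f (x \<oplus>\<^bsub>quot_rep V W\<^esub> y) = descend f x + descend f y"
    by (simp add: functional_add[OF f(1)])
qed

end

locale quotient_rep = linear_rep V + quotient_space V W
  for V :: "('k::field, 'v, 'g) representation" (structure) and W +
  assumes act_stable: "w \<in> W \<Longrightarrow> act V g w \<in> W"
begin

lemma act_coset_of: "x \<in> carrier V \<Longrightarrow> act (quot_rep V W) g (coset_of V W x) = coset_of V W (act V g x)"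
  using quot_map_coset_of[OF act_linear act_stable] by (simp add: quot_rep_def)

lemma linear_rep_quot: "linear_rep (quot_rep V W)"
proof -
  have "act (quot_rep V W) g = quot_map V W (act V g)" for g by (simp add: quot_rep_def)
  then show ?thesis
    using linear_between_quot_map[OF act_linear act_stable] linear_space_quot
    by (simp add: linear_rep_def linear_rep_axioms_def)
qed

end

text \<open>The preimage of the span under a linear operator is a subspace, so stability can be
  tested on the generators.\<close>

lemma (in linear_rep) quotient_rep_lin_span:
  assumes S: "S \<subseteq> carrier V" and act: "\<And>g s. s \<in> S \<Longrightarrow> act V g s \<in> lin_span V S"
  shows "quotient_rep V (lin_span V S)"
proof
  show "subspace_of V (lin_span V S)" by (rule lin_span_subspace[OF S])
  show "act V g w \<in> lin_span V S" if "w \<in> lin_span V S" for g w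
    using linear_between_lin_span[OF act_linear linear_space_axioms S lin_span_subspace[OF S] act that] .
qed

section \<open>Free spaces and their quotients\<close>

definition extend_free :: "('x \<Rightarrow> 'k::field) \<Rightarrow> ('x \<Rightarrow>\<^sub>0 'k) \<Rightarrow> 'k" where
  "extend_free f p = (\<Sum>x\<in>Poly_Mapping.keys p. Poly_Mapping.lookup p x * f x)"

lemma extend_free_superset:
  assumes "finite A" "Poly_Mapping.keys p \<subseteq> A"
  shows "extend_free f p = (\<Sum>x\<in>A. Poly_Mapping.lookup p x * f x)"
  unfolding extend_free_def using assms by (intro sum.mono_neutral_left) (auto simp: in_keys_iff)

lemma extend_free_add: "extend_free f (p + q) = extend_free f p + extend_free f q"
proof -
  let ?A = "Poly_Mapping.keys p \<union> Poly_Mapping.keys q"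
  have "Poly_Mapping.keys (p + q) \<subseteq> ?A" by (rule keys_add)
  then show ?thesis
    using extend_free_superset[of ?A p f] extend_free_superset[of ?A q f] extend_free_superset[of ?A "p + q" f]
    by (simp add: lookup_add distrib_right sum.distrib)
qed

lemma extend_free_diff: "extend_free f (p - q) = extend_free f p - extend_free f q"
  using extend_free_add[of f "p - q" q] by simp

lemma lookup_map_times: "Poly_Mapping.lookup (Poly_Mapping.map ((*) c) p) x = c * Poly_Mapping.lookup p x"
  for p :: "'x \<Rightarrow>\<^sub>0 'k::field"
  by (simp add: map.rep_eq when_def)

lemma extend_free_map_times: "extend_free f (Poly_Mapping.map ((*) c) p) = c * extend_free f p"
proof -
  have "Poly_Mapping.keys (Poly_Mapping.map ((*) c) p) \<subseteq> Poly_Mapping.keys p"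
    by (auto simp: in_keys_iff lookup_map_times)
  then show ?thesis
    using extend_free_superset[of "Poly_Mapping.keys p" "Poly_Mapping.map ((*) c) p" f]
    by (simp add: lookup_map_times extend_free_def sum_distrib_left mult.assoc)
qed

lemma extend_free_single [simp]: "extend_free f (Poly_Mapping.single x a) = a * f x"
  using extend_free_superset[of "{x}" "Poly_Mapping.single x a" f] by simp

lemma push_superset:
  assumes "finite A" "Poly_Mapping.keys p \<subseteq> A"
  shows "push h p = (\<Sum>x\<in>A. Poly_Mapping.single (h x) (Poly_Mapping.lookup p x))"
  unfolding push_def using assms by (intro sum.mono_neutral_left) (auto simp: in_keys_iff)

lemma push_add: "push h (p + q) = push h p + push h q"
proof -
  let ?A = "Poly_Mapping.keys p \<union> Poly_Mapping.keys q"
  have "Poly_Mapping.keys (p + q) \<subseteq> ?A" by (rule keys_add)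
  then show ?thesis
    using push_superset[of ?A p h] push_superset[of ?A q h] push_superset[of ?A "p + q" h]
    by (simp add: lookup_add single_add sum.distrib)
qed

lemma push_diff: "push h (p - q) = push h p - push h q"
  using push_add[of h "p - q" q] by simp

lemma map_times_single: "Poly_Mapping.map ((*) c) (Poly_Mapping.single x a) = Poly_Mapping.single x (c * a :: 'k::field)"
  by (rule poly_mapping_eqI) (simp add: lookup_map_times lookup_single when_def)

lemma map_times_add: "Poly_Mapping.map ((*) c) (p + q) = Poly_Mapping.map ((*) c) p + Poly_Mapping.map ((*) c) q"
  for p :: "'x \<Rightarrow>\<^sub>0 'k::field"
  by (rule poly_mapping_eqI) (simp add: lookup_map_times lookup_add distrib_left)

lemma map_times_sum: "Poly_Mapping.map ((*) c) (sum f A) = (\<Sum>x\<in>A. Poly_Mapping.map ((*) c) (f x))"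
  for f :: "'y \<Rightarrow> 'x \<Rightarrow>\<^sub>0 'k::field"
proof (induction A rule: infinite_finite_induct)
  case (insert x A)
  then show ?case by (simp add: map_times_add)
qed (auto intro: poly_mapping_eqI simp: lookup_map_times)

lemma push_map_times: "push h (Poly_Mapping.map ((*) c) p) = Poly_Mapping.map ((*) c) (push h p)"
proof -
  have "Poly_Mapping.keys (Poly_Mapping.map ((*) c) p) \<subseteq> Poly_Mapping.keys p"
    by (auto simp: in_keys_iff lookup_map_times)
  then show ?thesis
    using push_superset[of "Poly_Mapping.keys p" "Poly_Mapping.map ((*) c) p" h]
    by (simp add: lookup_map_times push_def map_times_sum map_times_single)
qed

lemma push_single [simp]: "push h (Poly_Mapping.single x a) = Poly_Mapping.single (h x) a"
  using push_superset[of "{x}" "Poly_Mapping.single x a" h] by simp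

lemma keys_push: "Poly_Mapping.keys (push h p) \<subseteq> h ` Poly_Mapping.keys p"
proof -
  have "Poly_Mapping.keys (push h p) \<subseteq> (\<Union>x\<in>Poly_Mapping.keys p. Poly_Mapping.keys (Poly_Mapping.single (h x) (Poly_Mapping.lookup p x)))"
    unfolding push_def by (rule keys_sum)
  also have "\<dots> \<subseteq> h ` Poly_Mapping.keys p" by (auto split: if_splits)
  finally show ?thesis .
qed

lemma free_rep_simps:
  "carrier (free_rep S \<alpha>) = {p. Poly_Mapping.keys p \<subseteq> S}" "\<zero>\<^bsub>free_rep S \<alpha>\<^esub> = 0"
  "p \<oplus>\<^bsub>free_rep S \<alpha>\<^esub> q = p + q" "c \<odot>\<^bsub>free_rep S \<alpha>\<^esub> p = Poly_Mapping.map ((*) c) p"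
  "act (free_rep S \<alpha>) g p = push (\<alpha> g) p"
  by (simp_all add: free_rep_def)

lemma linear_space_free_rep: "linear_space (free_rep S \<alpha>)"
proof (rule linear_spaceI, goal_cases)
  case (2 x y)
  then show ?case using keys_add[of x y] by (auto simp: free_rep_simps)
next
  case (7 c x)
  then show ?case by (auto simp: free_rep_simps in_keys_iff lookup_map_times subset_iff)
qed (auto simp: free_rep_simps lookup_map_times lookup_add algebra_simps intro: poly_mapping_eqI)

lemma linear_between_push:
  "h ` S \<subseteq> S' \<Longrightarrow> linear_between (free_rep S \<alpha>) (free_rep S' \<alpha>') (push h)"
  using keys_push[of h] by (force simp: linear_between_def free_rep_simps push_add push_map_times)

lemma linear_rep_free_rep: "(\<And>g. \<alpha> g ` S \<subseteq> S) \<Longrightarrow> linear_rep (free_rep S \<alpha>)"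
  unfolding linear_rep_def linear_rep_axioms_def free_rep_simps(5)[abs_def]
  by (intro conjI allI linear_space_free_rep linear_between_push)

lemma free_rep_minus: "q \<in> carrier (free_rep S \<alpha>) \<Longrightarrow> p \<ominus>\<^bsub>free_rep S \<alpha>\<^esub> q = p - q"
proof -
  assume q: "q \<in> carrier (free_rep S \<alpha>)"
  have "\<ominus>\<^bsub>free_rep S \<alpha>\<^esub> q = - q"
    unfolding linear_space.minus_one_smult[OF linear_space_free_rep q, symmetric]
    by (rule poly_mapping_eqI) (simp add: free_rep_simps lookup_map_times)
  then show ?thesis by (simp add: a_minus_def free_rep_simps)
qed

lemma functional_extend_free: "functional (free_rep S \<alpha>) (extend_free h)"
  by (simp add: functional_def free_rep_simps extend_free_add extend_free_map_times)

lemma sum_single_lookup: "(\<Sum>x\<in>Poly_Mapping.keys p. Poly_Mapping.single x (Poly_Mapping.lookup p x)) = p"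
  by (rule poly_mapping_eqI) (auto simp: lookup_sum lookup_single when_def in_keys_iff)

lemma spans_free_rep:
  fixes S :: "'x set"
  shows "spans (free_rep S \<alpha> :: ('k::field, 'x \<Rightarrow>\<^sub>0 'k, 'g) representation) ((\<lambda>x. Poly_Mapping.single x 1) ` S)"
    (is "spans ?F _")
  unfolding spans_def
proof (intro conjI allI impI subsetI)
  show "p \<in> carrier ?F" if "p \<in> (\<lambda>x. Poly_Mapping.single x 1) ` S" for p
    using that by (auto simp: free_rep_simps split: if_splits)
  fix Y p assume Y: "subspace_of ?F Y" "(\<lambda>x. Poly_Mapping.single x 1) ` S \<subseteq> Y"
    and p: "p \<in> carrier ?F"
  have single: "Poly_Mapping.single x a \<in> Y" if "x \<in> S" for x a
  proof -
    have "a \<odot>\<^bsub>?F\<^esub> Poly_Mapping.single x 1 \<in> Y"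
      using Y that unfolding subspace_of_def by blast
    then show ?thesis by (simp add: free_rep_simps map_times_single)
  qed
  have "(\<Sum>x\<in>A. Poly_Mapping.single x (Poly_Mapping.lookup p x)) \<in> Y" if "finite A" "A \<subseteq> S" for A
    using that
  proof (induction A rule: finite_induct)
    case empty
    show ?case using Y(1) by (simp add: subspace_of_def free_rep_simps)
  next
    case (insert x A)
    then show ?case using Y(1) single[of x] by (simp add: subspace_of_def free_rep_simps)
  qed
  from this[of "Poly_Mapping.keys p"] p show "p \<in> Y"
    by (simp add: free_rep_simps sum_single_lookup)
qed

section \<open>Representations given by generators and relations\<close>

definition free_lift :: "('x \<Rightarrow> 'k::field) \<Rightarrow> ('x \<Rightarrow>\<^sub>0 'k) set \<Rightarrow> 'k" where
  "free_lift h = descend (extend_free h)"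

text \<open>Tensor powers and tensor products of two representations are both instances, so
  generation by the symbols and the universal property for functionals are proved once. Closing R
  itself under the maps induced by \<open>\<alpha> g\<close> makes the action on the quotient well
  defined.\<close>

locale presented_rep =
  fixes S :: "'x set" and \<alpha> :: "'g \<Rightarrow> 'x \<Rightarrow> 'x" and R :: "('x \<Rightarrow>\<^sub>0 'k::field) set"
    and F :: "('k, 'x \<Rightarrow>\<^sub>0 'k, 'g) representation" and Q
  defines "F \<equiv> free_rep S \<alpha>" and "Q \<equiv> quot_rep F (lin_span F R)"
  assumes maps: "x \<in> S \<Longrightarrow> \<alpha> g x \<in> S"
    and R: "r \<in> R \<Longrightarrow> Poly_Mapping.keys r \<subseteq> S"
    and push_R: "r \<in> R \<Longrightarrow> push (\<alpha> g) r \<in> R"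
begin

definition gen :: "'x \<Rightarrow> ('x \<Rightarrow>\<^sub>0 'k) set" where
  "gen x = coset_of F (lin_span F R) (Poly_Mapping.single x 1)"

sublocale free: linear_rep F
  unfolding F_def by (rule linear_rep_free_rep) (auto intro: maps)

lemma R_carrier: "R \<subseteq> carrier F"
  using R by (auto simp: F_def free_rep_simps)

sublocale quotient_rep F "lin_span F R"
proof (rule free.quotient_rep_lin_span[OF R_carrier])
  show "act F g r \<in> lin_span F R" if "r \<in> R" for g r
    using free.lin_span_superset push_R[OF that] by (auto simp: F_def free_rep_simps)
qed

lemma single_carrier: "x \<in> S \<Longrightarrow> Poly_Mapping.single x a \<in> carrier F"
  by (simp add: F_def free_rep_simps)

lemma linear_rep_Q: "linear_rep Q"
  unfolding Q_def by (rule linear_rep_quot)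

lemma spans_F: "spans F ((\<lambda>x. Poly_Mapping.single x 1) ` S)"
  unfolding F_def by (rule spans_free_rep)

lemma functional_F: "functional F (extend_free h)"
  unfolding F_def by (rule functional_extend_free)

lemma spans_gen: "spans Q (gen ` S)"
  using spans_quot[OF spans_F] by (simp add: Q_def gen_def image_image)

lemma act_gen: "x \<in> S \<Longrightarrow> act Q g (gen x) = gen (\<alpha> g x)"
  using act_coset_of[OF single_carrier] by (simp add: Q_def gen_def F_def free_rep_simps)

lemma gen_add:
  assumes "Poly_Mapping.single x 1 - Poly_Mapping.single y 1 - Poly_Mapping.single z 1 \<in> R"
    "x \<in> S" "y \<in> S" "z \<in> S"
  shows "gen x = gen y \<oplus>\<^bsub>Q\<^esub> gen z"
proof -
  let ?s = "\<lambda>x. Poly_Mapping.single x (1::'k)"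
  have c: "?s x \<in> carrier F" "?s y \<in> carrier F" "?s z \<in> carrier F" "?s y \<oplus>\<^bsub>F\<^esub> ?s z \<in> carrier F"
    using single_carrier assms by auto
  have "?s x \<ominus>\<^bsub>F\<^esub> (?s y \<oplus>\<^bsub>F\<^esub> ?s z) = ?s x - ?s y - ?s z"
    using free_rep_minus[of "?s y \<oplus>\<^bsub>F\<^esub> ?s z" S \<alpha> "?s x"] c(4)
    by (simp add: F_def[symmetric]) (simp add: F_def free_rep_simps)
  with assms(1) have "?s x \<ominus>\<^bsub>F\<^esub> (?s y \<oplus>\<^bsub>F\<^esub> ?s z) \<in> lin_span F R"
    using free.lin_span_superset[of R] by auto
  then show ?thesis
    unfolding Q_def gen_def coset_of_add[OF c(2,3)] coset_of_eq_iff[OF c(1,4)] .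
qed

lemma gen_smult:
  assumes "Poly_Mapping.single x 1 - Poly_Mapping.single y c \<in> R" "x \<in> S" "y \<in> S"
  shows "gen x = c \<odot>\<^bsub>Q\<^esub> gen y"
proof -
  let ?s = "\<lambda>x. Poly_Mapping.single x (1::'k)"
  have c: "?s x \<in> carrier F" "?s y \<in> carrier F" "c \<odot>\<^bsub>F\<^esub> ?s y \<in> carrier F"
    using single_carrier assms by auto
  have "?s x \<ominus>\<^bsub>F\<^esub> (c \<odot>\<^bsub>F\<^esub> ?s y) = ?s x - Poly_Mapping.single y c"
    using free_rep_minus[of "c \<odot>\<^bsub>F\<^esub> ?s y" S \<alpha> "?s x"] c(3)
    by (simp add: F_def[symmetric]) (simp add: F_def free_rep_simps map_times_single)
  with assms(1) have "?s x \<ominus>\<^bsub>F\<^esub> (c \<odot>\<^bsub>F\<^esub> ?s y) \<in> lin_span F R"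
    using free.lin_span_superset[of R] by auto
  then show ?thesis
    unfolding Q_def gen_def coset_of_smult[OF c(2)] coset_of_eq_iff[OF c(1,3)] .
qed

context
  fixes h :: "'x \<Rightarrow> 'k"
  assumes h: "\<And>r. r \<in> R \<Longrightarrow> extend_free h r = 0"
begin

lemma extend_free_vanishes: "w \<in> lin_span F R \<Longrightarrow> extend_free h w = 0"
  using free.functional_vanishes_on_lin_span[OF functional_F R_carrier h] .

text \<open>The universal property: a function on symbols that respects the relations induces a
  functional on the quotient. As \<open>free_lift\<close> evaluates at a chosen representative, it
  is meaningful only for such functions.\<close>

lemma functional_lift: "functional Q (free_lift h)"
  unfolding Q_def free_lift_def
  by (rule functional_descend[OF functional_F extend_free_vanishes])

lemma lift_gen: "x \<in> S \<Longrightarrow> free_lift h (gen x) = h x"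
  unfolding gen_def free_lift_def
  by (subst descend_coset_of[OF functional_F extend_free_vanishes])
    (simp_all add: single_carrier)

end

end

section \<open>Tensor powers\<close>

definition multilinear :: "nat \<Rightarrow> ('k::field, 'v, 'g) representation \<Rightarrow> ('v list \<Rightarrow> 'k) \<Rightarrow> bool" where
  "multilinear r V h \<longleftrightarrow>
     (\<forall>xs\<in>power_lists r V. \<forall>i<r. \<forall>x\<in>carrier V. \<forall>y\<in>carrier V.
        h (xs[i := x \<oplus>\<^bsub>V\<^esub> y]) = h (xs[i := x]) + h (xs[i := y])) \<and>
     (\<forall>xs\<in>power_lists r V. \<forall>i<r. \<forall>c. \<forall>x\<in>carrier V. h (xs[i := c \<odot>\<^bsub>V\<^esub> x]) = c * h (xs[i := x]))"

lemma power_lists_update: "xs \<in> power_lists r V \<Longrightarrow> x \<in> carrier V \<Longrightarrow> xs[i := x] \<in> power_lists r V"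
  using set_update_subset_insert[of xs i x] by (auto simp: power_lists_def)

context linear_rep
begin

lemma power_lists_map_act: "xs \<in> power_lists r V \<Longrightarrow> map (act V g) xs \<in> power_lists r V"
  by (auto simp: power_lists_def)

lemma push_power_rels:
  assumes "r \<in> power_rels n V"
  shows "push (map (act V g)) r \<in> power_rels n V"
  using assms unfolding power_rels_def
proof (elim UnE CollectE exE conjE, goal_cases)
  case (1 xs i x y)
  show ?case
    unfolding 1 by (intro UnI1 CollectI exI[of _ "map (act V g) xs"] exI[of _ i] exI[of _ "act V g x"]
        exI[of _ "act V g y"]) (use 1 in \<open>simp add: push_diff map_update act_add power_lists_map_act\<close>)
next
  case (2 xs i c x)
  show ?case
    unfolding 2 by (intro UnI2 CollectI exI[of _ "map (act V g) xs"] exI[of _ i] exI[of _ c]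
        exI[of _ "act V g x"]) (use 2 in \<open>simp add: push_diff map_update act_smult power_lists_map_act\<close>)
qed

lemma keys_power_rels:
  assumes "r \<in> power_rels n V"
  shows "Poly_Mapping.keys r \<subseteq> power_lists n V"
proof -
  note [simp] = power_lists_update
  have d: "Poly_Mapping.keys (p - q) \<subseteq> Poly_Mapping.keys p \<union> Poly_Mapping.keys q" for p q :: "'v list \<Rightarrow>\<^sub>0 'k"
    by (rule keys_diff)
  from assms show ?thesis
    unfolding power_rels_def
    by (elim UnE CollectE exE conjE) (force dest!: subsetD[OF d] split: if_splits)+
qed

lemma presented_tensor_power: "presented_rep (power_lists n V) (\<lambda>g. map (act V g)) (power_rels n V)"
  by unfold_locales (use power_lists_map_act push_power_rels keys_power_rels in auto)

lemma tensor_power_eq: "tensor_power n V =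
    quot_rep (free_rep (power_lists n V) (\<lambda>g. map (act V g)))
      (lin_span (free_rep (power_lists n V) (\<lambda>g. map (act V g))) (power_rels n V))"
  unfolding tensor_power_def power_kernel_def power_free_def ..

lemma gen_eq_pure_tensor:
  "presented_rep.gen (power_lists n V) (\<lambda>g. map (act V g)) (power_rels n V) xs = pure_tensor n V xs"
  unfolding presented_rep.gen_def[OF presented_tensor_power] pure_tensor_def power_kernel_def
    power_free_def coset_of_def ..

lemma linear_rep_tensor_power: "linear_rep (tensor_power n V)"
  using presented_rep.linear_rep_Q[OF presented_tensor_power] by (simp add: tensor_power_eq)

lemma spans_pure_tensor: "spans (tensor_power n V) (pure_tensor n V ` power_lists n V)"
  using presented_rep.spans_gen[OF presented_tensor_power]
  by (simp add: tensor_power_eq gen_eq_pure_tensor)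

lemma pure_tensor_carrier: "xs \<in> power_lists n V \<Longrightarrow> pure_tensor n V xs \<in> carrier (tensor_power n V)"
  using spans_pure_tensor by (auto simp: spans_def)

lemma act_pure_tensor:
  "xs \<in> power_lists n V \<Longrightarrow> act (tensor_power n V) g (pure_tensor n V xs) = pure_tensor n V (map (act V g) xs)"
  using presented_rep.act_gen[OF presented_tensor_power]
  by (simp add: tensor_power_eq gen_eq_pure_tensor)

lemma pure_tensor_add:
  assumes "xs \<in> power_lists n V" "i < n" "x \<in> carrier V" "y \<in> carrier V"
  shows "pure_tensor n V (xs[i := x \<oplus> y]) =
    pure_tensor n V (xs[i := x]) \<oplus>\<^bsub>tensor_power n V\<^esub> pure_tensor n V (xs[i := y])"
proof -
  have "Poly_Mapping.single (xs[i := x \<oplus> y]) 1 - Poly_Mapping.single (xs[i := x]) 1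
      - Poly_Mapping.single (xs[i := y]) 1 \<in> power_rels n V"
    unfolding power_rels_def using assms by blast
  from presented_rep.gen_add[OF presented_tensor_power this] show ?thesis
    using assms by (simp add: tensor_power_eq gen_eq_pure_tensor power_lists_update)
qed

lemma pure_tensor_smult:
  assumes "xs \<in> power_lists n V" "i < n" "x \<in> carrier V"
  shows "pure_tensor n V (xs[i := c \<odot> x]) = c \<odot>\<^bsub>tensor_power n V\<^esub> pure_tensor n V (xs[i := x])"
proof -
  have "Poly_Mapping.single (xs[i := c \<odot> x]) 1 - Poly_Mapping.single (xs[i := x]) c \<in> power_rels n V"
    unfolding power_rels_def using assms by blast
  from presented_rep.gen_smult[OF presented_tensor_power this] show ?thesis
    using assms by (simp add: tensor_power_eq gen_eq_pure_tensor power_lists_update)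
qed

lemma pure_tensor_linear:
  "xs \<in> power_lists n V \<Longrightarrow> i < n \<Longrightarrow> linear_between V (tensor_power n V) (\<lambda>x. pure_tensor n V (xs[i := x]))"
  by (simp add: linear_between_def pure_tensor_carrier power_lists_update pure_tensor_add pure_tensor_smult)

lemma multilinear_vanishes_on_power_rels:
  "multilinear n V h \<Longrightarrow> r \<in> power_rels n V \<Longrightarrow> extend_free h r = 0"
  unfolding power_rels_def multilinear_def by (auto simp: extend_free_diff)

lemma functional_tensor_power: "multilinear n V h \<Longrightarrow> functional (tensor_power n V) (free_lift h)"
  using presented_rep.functional_lift[OF presented_tensor_power multilinear_vanishes_on_power_rels]
  by (simp add: tensor_power_eq)

lemma free_lift_pure_tensor:
  "multilinear n V h \<Longrightarrow> xs \<in> power_lists n V \<Longrightarrow> free_lift h (pure_tensor n V xs) = h xs"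
  using presented_rep.lift_gen[OF presented_tensor_power multilinear_vanishes_on_power_rels]
  by (simp add: gen_eq_pure_tensor)

lemma spans_pure_tensor_basis:
  assumes B: "spans V B"
  shows "spans (tensor_power n V) (pure_tensor n V ` {xs. set xs \<subseteq> B \<and> length xs = n})"
proof (rule spans_trans[OF spans_pure_tensor])
  have BV: "B \<subseteq> carrier V" using B by (simp add: spans_def)
  show "pure_tensor n V ` {xs. set xs \<subseteq> B \<and> length xs = n} \<subseteq> carrier (tensor_power n V)"
    using BV by (auto intro!: pure_tensor_carrier simp: power_lists_def)
  fix Y t
  assume Y: "subspace_of (tensor_power n V) Y" "pure_tensor n V ` {xs. set xs \<subseteq> B \<and> length xs = n} \<subseteq> Y"
    and t: "t \<in> pure_tensor n V ` power_lists n V"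
  \<comment> \<open>From position j on, the entries already lie in B; each induction step frees one
    more position. The vectors that may stand at position j while the tensor stays in Y form a
    subspace containing B, hence they exhaust V.\<close>
  have "pure_tensor n V xs \<in> Y"
    if "xs \<in> power_lists n V" "\<And>i. i < n \<Longrightarrow> j \<le> i \<Longrightarrow> xs ! i \<in> B" for j xs
    using that
  proof (induction j arbitrary: xs)
    case 0
    then have "set xs \<subseteq> B" "length xs = n" by (auto simp: power_lists_def in_set_conv_nth)
    then show ?case using Y(2) by auto
  next
    case (Suc j)
    show ?case
    proof (cases "j < n")
      case True
      have xs: "xs ! j \<in> carrier V" using Suc.prems(1) True by (auto simp: power_lists_def)
      have len: "length xs = n" using Suc.prems(1) by (simp add: power_lists_def)
      have "pure_tensor n V (xs[j := b]) \<in> Y" if "b \<in> B" for b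
        using that BV Suc.prems True len
        by (intro Suc.IH power_lists_update) (auto simp: nth_list_update)
      then have "xs ! j \<in> {x \<in> carrier V. pure_tensor n V (xs[j := x]) \<in> Y}"
        using linear_between_preimage[OF pure_tensor_linear[OF Suc.prems(1) True] _ Y(1)]
          linear_rep.axioms(1)[OF linear_rep_tensor_power] BV
        by (intro subspace_of_span_arg[OF _ B _ xs]) auto
      then show ?thesis by simp
    next
      case False
      then show ?thesis using Suc by auto
    qed
  qed
  from this[of _ n] t show "t \<in> Y" by auto
qed

end

section \<open>Exterior powers\<close>

text \<open>Vanishing on repeated entries, rather than a sign change under swaps, is the condition
  that matches the relations of \<open>ext_power\<close> also in characteristic 2.\<close>

definition alternating :: "nat \<Rightarrow> ('k::field, 'v, 'g) representation \<Rightarrow> ('v list \<Rightarrow> 'k) \<Rightarrow> bool" where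
  "alternating r V h \<longleftrightarrow> multilinear r V h \<and> (\<forall>xs\<in>power_lists r V. \<not> distinct xs \<longrightarrow> h xs = 0)"

definition wedge ::
    "nat \<Rightarrow> ('k::field, 'v, 'g) representation \<Rightarrow> 'v list \<Rightarrow> ('v list \<Rightarrow>\<^sub>0 'k) set set" where
  "wedge r V xs =
     coset_of (tensor_power r V)
       (lin_span (tensor_power r V) {pure_tensor r V xs | xs. xs \<in> power_lists r V \<and> \<not> distinct xs})
       (pure_tensor r V xs)"

text \<open>Descends twice, from the free space to the tensor power and on to a quotient of it, and
  serves exterior and symmetric powers alike.\<close>

definition quot_lift :: "('v list \<Rightarrow> 'k::field) \<Rightarrow> ('v list \<Rightarrow>\<^sub>0 'k) set set \<Rightarrow> 'k" where
  "quot_lift h = descend (free_lift h)"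

lemma permute_list_transpose:
  assumes "i < length xs" "j < length xs"
  shows "permute_list (Transposition.transpose i j) xs = xs[i := xs ! j, j := xs ! i]"
  by (rule nth_equalityI)
    (use assms in \<open>auto simp: permute_list_def Transposition.transpose_def nth_list_update\<close>)

lemma map_sorted_list_power_lists:
  fixes v :: "nat \<Rightarrow> 'v"
  assumes "\<And>i. i < n \<Longrightarrow> v i \<in> carrier V" "S \<subseteq> {..<n}" "card S = r"
  shows "map v (sorted_list_of_set S) \<in> power_lists r V"
proof -
  have "finite S" using assms(2) by (rule finite_subset) simp
  then show ?thesis using assms by (auto simp: power_lists_def)
qed

context linear_rep
begin

abbreviation (input) "ext_rels r \<equiv> {pure_tensor r V xs | xs. xs \<in> power_lists r V \<and> \<not> distinct xs}"

text \<open>A list with a repeated entry is mapped to a list with a repeated entry, so every group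
  element takes generating relations to generating relations.\<close>

lemma quotient_ext_power: "quotient_rep (tensor_power r V) (lin_span (tensor_power r V) (ext_rels r))"
proof (rule linear_rep.quotient_rep_lin_span[OF linear_rep_tensor_power])
  show "ext_rels r \<subseteq> carrier (tensor_power r V)" by (auto intro: pure_tensor_carrier)
  show "act (tensor_power r V) g s \<in> lin_span (tensor_power r V) (ext_rels r)" if s: "s \<in> ext_rels r" for g s
  proof -
    obtain xs where xs: "s = pure_tensor r V xs" "xs \<in> power_lists r V" "\<not> distinct xs"
      using s by auto
    then have "act (tensor_power r V) g s = pure_tensor r V (map (act V g) xs)"
      "map (act V g) xs \<in> power_lists r V" "\<not> distinct (map (act V g) xs)"
      by (simp_all add: act_pure_tensor power_lists_map_act distinct_map)
    then have "act (tensor_power r V) g s \<in> ext_rels r" by blast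
    then show ?thesis
      by (rule subsetD[OF linear_space.lin_span_superset[OF linear_rep.axioms(1)[OF linear_rep_tensor_power]]])
  qed
qed

lemmas quotient_space_ext_power = quotient_rep.axioms(2)[OF quotient_ext_power]

lemma linear_rep_ext_power: "linear_rep (ext_power r V)"
  unfolding ext_power_def by (rule quotient_rep.linear_rep_quot[OF quotient_ext_power])

lemma linear_space_ext_power: "linear_space (ext_power r V)"
  using linear_rep_ext_power by (rule linear_rep.axioms)

lemma wedge_linear_pure:
  "linear_between (tensor_power r V) (ext_power r V)
     (coset_of (tensor_power r V) (lin_span (tensor_power r V) (ext_rels r)))"
  unfolding ext_power_def by (rule quotient_space.coset_of_linear[OF quotient_space_ext_power])

lemma wedge_carrier: "xs \<in> power_lists r V \<Longrightarrow> wedge r V xs \<in> carrier (ext_power r V)"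
  unfolding wedge_def by (intro linear_betweenD(1)[OF wedge_linear_pure] pure_tensor_carrier)

lemma wedge_linear:
  "xs \<in> power_lists r V \<Longrightarrow> i < r \<Longrightarrow> linear_between V (ext_power r V) (\<lambda>x. wedge r V (xs[i := x]))"
  unfolding wedge_def by (rule linear_between_comp[OF pure_tensor_linear wedge_linear_pure])

lemma act_wedge:
  "xs \<in> power_lists r V \<Longrightarrow> act (ext_power r V) g (wedge r V xs) = wedge r V (map (act V g) xs)"
  unfolding ext_power_def wedge_def
  by (simp add: quotient_rep.act_coset_of[OF quotient_ext_power] pure_tensor_carrier act_pure_tensor)

lemma wedge_eq_zero:
  assumes "xs \<in> power_lists r V" "\<not> distinct xs"
  shows "wedge r V xs = \<zero>\<^bsub>ext_power r V\<^esub>"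
proof -
  have "pure_tensor r V xs \<in> lin_span (tensor_power r V) (ext_rels r)"
    using assms linear_space.lin_span_superset[OF linear_rep.axioms(1)[OF linear_rep_tensor_power], of "ext_rels r"]
    by blast
  then show ?thesis
    unfolding ext_power_def wedge_def
    using quotient_space.coset_of_eq_zero_iff[OF quotient_space_ext_power pure_tensor_carrier[OF assms(1)]]
    by simp
qed

lemma free_lift_vanishes_on_ext_rels:
  assumes "alternating r V h" "w \<in> lin_span (tensor_power r V) (ext_rels r)"
  shows "free_lift h w = 0"
proof -
  have h: "multilinear r V h" using assms by (simp add: alternating_def)
  show ?thesis
    by (rule linear_space.functional_vanishes_on_lin_span[OF linear_rep.axioms(1)[OF linear_rep_tensor_power]
          functional_tensor_power[OF h] _ _ assms(2)])
      (use assms(1) in \<open>auto intro: pure_tensor_carrier simp: free_lift_pure_tensor[OF h] alternating_def\<close>)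
qed

lemma functional_ext_power:
  assumes "alternating r V h"
  shows "functional (ext_power r V) (quot_lift h)"
  unfolding ext_power_def quot_lift_def
  using assms free_lift_vanishes_on_ext_rels[OF assms]
  by (intro quotient_space.functional_descend[OF quotient_space_ext_power] functional_tensor_power)
    (simp_all add: alternating_def)

lemma quot_lift_wedge:
  assumes "alternating r V h" "xs \<in> power_lists r V"
  shows "quot_lift h (wedge r V xs) = h xs"
proof -
  have h: "multilinear r V h" using assms by (simp add: alternating_def)
  show ?thesis
    unfolding quot_lift_def wedge_def
    using quotient_space.descend_coset_of[OF quotient_space_ext_power functional_tensor_power[OF h]
        free_lift_vanishes_on_ext_rels[OF assms(1)] pure_tensor_carrier[OF assms(2)]]
    by (simp add: free_lift_pure_tensor[OF h assms(2)])
qed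

section \<open>Generation of exterior powers by increasing wedges\<close>

lemma spans_wedge_basis:
  "spans V B \<Longrightarrow> spans (ext_power r V) (wedge r V ` {xs. set xs \<subseteq> B \<and> length xs = r})"
  using quotient_space.spans_quot[OF quotient_space_ext_power spans_pure_tensor_basis]
  unfolding ext_power_def wedge_def by (simp add: image_image)

lemma spans_wedge: "spans (ext_power r V) (wedge r V ` power_lists r V)"
  using quotient_space.spans_quot[OF quotient_space_ext_power spans_pure_tensor]
  unfolding ext_power_def wedge_def by (simp add: image_image)

text \<open>Expand the vanishing wedge that has x + y in both places; the two terms with equal
  entries drop out and the mixed ones add up to zero.\<close>

lemma wedge_transpose:
  assumes xs: "xs \<in> power_lists r V" and ij: "i < r" "j < r" "i \<noteq> j"
  shows "wedge r V (permute_list (Transposition.transpose i j) xs) = \<ominus>\<^bsub>ext_power r V\<^esub> wedge r V xs"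
proof -
  interpret L: linear_space "ext_power r V" by (rule linear_space_ext_power)
  let ?w = "\<lambda>x y. wedge r V (xs[i := x, j := y])"
  have len: "length xs = r" using xs by (simp add: power_lists_def)
  let ?x = "xs ! i" and ?y = "xs ! j"
  have c: "?x \<in> carrier V" "?y \<in> carrier V" using xs ij by (auto simp: power_lists_def)
  have in_carrier: "?w x y \<in> carrier (ext_power r V)" if "x \<in> carrier V" "y \<in> carrier V" for x y
    using that xs by (intro wedge_carrier power_lists_update)
  have same: "?w x x = \<zero>\<^bsub>ext_power r V\<^esub>" if "x \<in> carrier V" for x
  proof (rule wedge_eq_zero)
    have "xs[i := x, j := x] ! i = xs[i := x, j := x] ! j" using ij len by simp
    then show "\<not> distinct (xs[i := x, j := x])" using ij len by (metis length_list_update nth_eq_iff_index_eq)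
  qed (use that xs in \<open>intro power_lists_update\<close>)
  have add1: "?w (x \<oplus> x') y = ?w x y \<oplus>\<^bsub>ext_power r V\<^esub> ?w x' y"
    if "x \<in> carrier V" "x' \<in> carrier V" "y \<in> carrier V" for x x' y
    using linear_betweenD(2)[OF wedge_linear[of "xs[j := y]" r i] that(1,2)] that xs ij
    by (simp add: power_lists_update list_update_swap)
  have add2: "?w x (y \<oplus> y') = ?w x y \<oplus>\<^bsub>ext_power r V\<^esub> ?w x y'"
    if "x \<in> carrier V" "y \<in> carrier V" "y' \<in> carrier V" for x y y'
    using linear_betweenD(2)[OF wedge_linear[of "xs[i := x]" r j] that(2,3)] that xs ij
    by (simp add: power_lists_update)
  have "?w y x = \<ominus>\<^bsub>ext_power r V\<^esub> ?w x y" if c: "x \<in> carrier V" "y \<in> carrier V" for x y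
  proof -
    have "\<zero>\<^bsub>ext_power r V\<^esub> = ?w (x \<oplus> y) (x \<oplus> y)" using same c by simp
    also have "\<dots> = ?w y x \<oplus>\<^bsub>ext_power r V\<^esub> ?w x y"
      using c in_carrier by (simp add: add1 add2 same[OF c(1)] same[OF c(2)] L.M.a_comm)
    finally show ?thesis
      using L.M.minus_equality[of "?w y x" "?w x y"] c in_carrier by simp
  qed
  from this[OF c] show ?thesis using ij len by (simp add: permute_list_transpose)
qed

text \<open>A transposition negates the wedge and subspaces are closed under negation. Phrasing the
  result as membership avoids tracking the sign of the permutation.\<close>

lemma wedge_permute_in_subspace:
  assumes Y: "subspace_of (ext_power r V) Y" and p: "p permutes {..<r}"
  shows "xs \<in> power_lists r V \<Longrightarrow> wedge r V xs \<in> Y \<Longrightarrow> wedge r V (permute_list p xs) \<in> Y"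
  using p finite_lessThan
proof (induction p arbitrary: xs rule: permutes_induct)
  case id
  then show ?case by simp
next
  case (swap a b p)
  have len: "length xs = r" using swap.prems by (simp add: power_lists_def)
  have "permute_list (Transposition.transpose a b) xs \<in> power_lists r V"
    using swap.prems(1) swap.hyps(1,2) len
    by (auto simp: power_lists_def permute_list_transpose dest!: set_update_subset_insert[THEN subsetD])
  moreover have "wedge r V (permute_list (Transposition.transpose a b) xs) \<in> Y"
    using swap.prems swap.hyps wedge_transpose[of xs r a b] linear_space.subspace_ofD(5)[OF linear_space_ext_power Y]
    by simp
  ultimately have "wedge r V (permute_list p (permute_list (Transposition.transpose a b) xs)) \<in> Y"
    by (rule swap.IH)
  then show ?case using swap.hyps len by (subst permute_list_compose) auto
qed

text \<open>The argument runs over lists of indices, not of vectors: a repeated index gives zero,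
  and a list without repetition is a permutation of the increasing list of its index set.\<close>

lemma spans_wedge_sorted:
  fixes v :: "nat \<Rightarrow> 'v"
  assumes span: "spans V (v ` {..<n})"
  shows "spans (ext_power r V)
    ((\<lambda>S. wedge r V (map v (sorted_list_of_set S))) ` {S. S \<subseteq> {..<n} \<and> card S = r})" (is "spans _ ?Z")
proof (rule spans_trans[OF spans_wedge_basis[OF span]])
  have v: "v i \<in> carrier V" if "i < n" for i using span that by (auto simp: spans_def)
  show "?Z \<subseteq> carrier (ext_power r V)"
    using map_sorted_list_power_lists[of n v V, OF v] wedge_carrier by auto
  fix Y z
  assume Y: "subspace_of (ext_power r V) Y" "?Z \<subseteq> Y"
    and "z \<in> wedge r V ` {xs. set xs \<subseteq> v ` {..<n} \<and> length xs = r}"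
  then obtain xs where xs: "set xs \<subseteq> v ` {..<n}" "length xs = r" "z = wedge r V xs" by auto
  from xs(1) have "xs \<in> map v ` lists {..<n}" unfolding lists_image[symmetric] by auto
  then obtain "is" where is_map: "set is \<subseteq> {..<n}" "xs = map v is" by auto
  have z: "z = wedge r V (map v is)" and len: "length is = r" using xs is_map by auto
  have "map v is \<in> power_lists r V" using is_map len v by (auto simp: power_lists_def)
  show "z \<in> Y"
  proof (cases "distinct is")
    case False
    then have "z = \<zero>\<^bsub>ext_power r V\<^esub>"
      unfolding z using \<open>map v is \<in> power_lists r V\<close> by (intro wedge_eq_zero) (auto simp: distinct_map)
    then show ?thesis using Y(1) by (simp add: subspace_of_def)
  next
    case True
    let ?s = "sorted_list_of_set (set is)"
    have "mset ?s = mset is" using True by (intro set_eq_iff_mset_eq_distinct[THEN iffD1]) auto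
    then obtain p where p: "p permutes {..<length ?s}" "permute_list p ?s = is"
      using mset_eq_permutation[of "is" ?s] by metis
    have card: "card (set is) = r" using True len by (simp add: distinct_card)
    have "wedge r V (map v ?s) \<in> Y" using Y(2) is_map(1) card by blast
    moreover have "map v ?s \<in> power_lists r V" using is_map card v by (auto simp: power_lists_def)
    ultimately have "wedge r V (permute_list p (map v ?s)) \<in> Y"
      using p card by (intro wedge_permute_in_subspace[OF Y(1)]) auto
    then show ?thesis unfolding z using p by (simp add: permute_list_map)
  qed
qed

text \<open>Both forms are functionals on the exterior power, which increasing wedges span.
  Identities between forms thereby reduce to finitely many values.\<close>

lemma alternating_eqI:
  fixes v :: "nat \<Rightarrow> 'v"
  assumes span: "spans V (v ` {..<n})" and F: "alternating r V F" "alternating r V F'"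
    and eq: "\<And>S. S \<subseteq> {..<n} \<Longrightarrow> card S = r \<Longrightarrow>
      F (map v (sorted_list_of_set S)) = F' (map v (sorted_list_of_set S))"
    and xs: "xs \<in> power_lists r V"
  shows "F xs = F' xs"
proof -
  have "quot_lift F (wedge r V xs) = quot_lift F' (wedge r V xs)"
  proof (rule linear_space.functional_eq_on_span[OF linear_space_ext_power functional_ext_power[OF F(1)]
        functional_ext_power[OF F(2)] spans_wedge_sorted[OF span] _ wedge_carrier[OF xs]])
    fix z assume "z \<in> (\<lambda>S. wedge r V (map v (sorted_list_of_set S))) ` {S. S \<subseteq> {..<n} \<and> card S = r}"
    then obtain S where S: "S \<subseteq> {..<n}" "card S = r" "z = wedge r V (map v (sorted_list_of_set S))" by auto
    have "map v (sorted_list_of_set S) \<in> power_lists r V"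
      using S span by (intro map_sorted_list_power_lists) (auto simp: spans_def)
    then show "quot_lift F z = quot_lift F' z"
      unfolding S using quot_lift_wedge F eq[OF S(1,2)] by simp
  qed
  then show ?thesis using quot_lift_wedge F xs by simp
qed

end

section \<open>Symmetric powers\<close>

definition sym_class ::
    "nat \<Rightarrow> ('k::field, 'v, 'g) representation \<Rightarrow> 'v list \<Rightarrow> ('v list \<Rightarrow>\<^sub>0 'k) set set" where
  "sym_class r V xs =
     coset_of (tensor_power r V)
       (lin_span (tensor_power r V)
          {place_perm r V \<tau> w \<ominus>\<^bsub>tensor_power r V\<^esub> w
             | \<tau> w. \<tau> permutes {..<r} \<and> w \<in> carrier (tensor_power r V)})
       (pure_tensor r V xs)"

definition symmetric :: "nat \<Rightarrow> ('k::field, 'v, 'g) representation \<Rightarrow> ('v list \<Rightarrow> 'k) \<Rightarrow> bool" where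
  "symmetric r V h \<longleftrightarrow> (\<forall>\<tau>. \<forall>xs\<in>power_lists r V. \<tau> permutes {..<r} \<longrightarrow> h (permute_list \<tau> xs) = h xs)"

text \<open>Entry k of the permuted list is entry \<tau> k of xs, so a change at position i shows up
  at the position k with \<tau> k = i.\<close>

lemma permute_list_update:
  assumes "\<tau> permutes {..<length xs}" "i < length xs"
  shows "permute_list \<tau> (xs[i := x]) = (permute_list \<tau> xs)[inv_into UNIV \<tau> i := x]"
proof (rule nth_equalityI)
  fix k assume "k < length (permute_list \<tau> (xs[i := x]))"
  then have k: "k < length xs" by simp
  have "\<tau> k < length xs" using permutes_in_image[OF assms(1)] k by simp
  moreover have "\<tau> k = i \<longleftrightarrow> k = inv_into UNIV \<tau> i" using permutes_inv_eq[OF assms(1)] by metis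
  moreover have "inv_into UNIV \<tau> i < length xs" using permutes_in_image[OF permutes_inv[OF assms(1)]] assms(2) by simp
  ultimately show "permute_list \<tau> (xs[i := x]) ! k = (permute_list \<tau> xs)[inv_into UNIV \<tau> i := x] ! k"
    using k by (auto simp: permute_list_def nth_list_update)
qed simp

lemma permute_list_power_lists:
  "\<tau> permutes {..<n} \<Longrightarrow> xs \<in> power_lists n V \<Longrightarrow> permute_list \<tau> xs \<in> power_lists n V"
  by (auto simp: power_lists_def)

context linear_rep
begin

lemma push_permute_power_rels:
  assumes \<tau>: "\<tau> permutes {..<n}" and "r \<in> power_rels n V"
  shows "push (permute_list \<tau>) r \<in> power_rels n V"
proof -
  have inv: "inv_into UNIV \<tau> i < n" if "i < n" for i
    using permutes_in_image[OF permutes_inv[OF \<tau>]] that by simp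
  have upd: "permute_list \<tau> (xs[i := x]) = (permute_list \<tau> xs)[inv_into UNIV \<tau> i := x]"
    if "xs \<in> power_lists n V" "i < n" for xs i x
    using permute_list_update[of \<tau> xs i x] \<tau> that by (simp add: power_lists_def)
  from assms(2) show ?thesis unfolding power_rels_def
  proof (elim UnE CollectE exE conjE, goal_cases)
    case (1 xs i x y)
    show ?case
      unfolding 1 by (intro UnI1 CollectI exI[of _ "permute_list \<tau> xs"] exI[of _ "inv_into UNIV \<tau> i"] exI[of _ x]
        exI[of _ y]) (use 1 in \<open>simp add: push_diff upd permute_list_power_lists[OF \<tau>] inv\<close>)
  next
    case (2 xs i c x)
    show ?case
      unfolding 2 by (intro UnI2 CollectI exI[of _ "permute_list \<tau> xs"] exI[of _ "inv_into UNIV \<tau> i"] exI[of _ c]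
          exI[of _ x]) (use 2 in \<open>simp add: push_diff upd permute_list_power_lists[OF \<tau>] inv\<close>)
  qed
qed

text \<open>Permuting the places turns multilinearity relations into multilinearity relations, so
  place permutation is well defined on the tensor power.\<close>

lemma place_perm_aux:
  assumes \<tau>: "\<tau> permutes {..<n}"
  shows "quotient_space (power_free n V) (power_kernel n V)"
    and "linear_between (power_free n V) (power_free n V) (push (permute_list \<tau>))"
    and "w \<in> power_kernel n V \<Longrightarrow> push (permute_list \<tau>) w \<in> power_kernel n V"
proof -
  interpret P: presented_rep "power_lists n V" "\<lambda>g. map (act V g)" "power_rels n V" "power_free n V"
      "tensor_power n V"
    using presented_tensor_power
    by (simp_all add: power_free_def tensor_power_eq)
  show "quotient_space (power_free n V) (power_kernel n V)"
    unfolding power_kernel_def by (rule P.quotient_space_axioms)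
  show lin: "linear_between (power_free n V) (power_free n V) (push (permute_list \<tau>))"
    unfolding power_free_def by (rule linear_between_push) (auto intro: permute_list_power_lists[OF \<tau>])
  show "w \<in> power_kernel n V \<Longrightarrow> push (permute_list \<tau>) w \<in> power_kernel n V"
    unfolding power_kernel_def
    by (rule P.free.linear_between_lin_span[OF lin P.free.linear_space_axioms P.R_carrier
          P.free.lin_span_subspace[OF P.R_carrier]])
      (use push_permute_power_rels[OF \<tau>] P.free.lin_span_superset[of "power_rels n V"] in auto)
qed

lemma place_perm_linear:
  assumes \<tau>: "\<tau> permutes {..<n}"
  shows "linear_between (tensor_power n V) (tensor_power n V) (place_perm n V \<tau>)"
  unfolding tensor_power_def place_perm_def
  by (rule quotient_space.linear_between_quot_map[OF place_perm_aux[OF \<tau>]])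

lemma place_perm_pure_tensor:
  assumes \<tau>: "\<tau> permutes {..<n}" and xs: "xs \<in> power_lists n V"
  shows "place_perm n V \<tau> (pure_tensor n V xs) = pure_tensor n V (permute_list \<tau> xs)"
proof -
  have "Poly_Mapping.single xs 1 \<in> carrier (power_free n V)"
    using xs by (simp add: power_free_def free_rep_simps)
  from quotient_space.quot_map_coset_of[OF place_perm_aux[OF \<tau>] this] show ?thesis
    unfolding place_perm_def pure_tensor_def coset_of_def by simp
qed

lemma linear_space_tensor_power: "linear_space (tensor_power n V)"
  using linear_rep_tensor_power by (rule linear_rep.axioms)

lemma tensor_act_linear: "linear_between (tensor_power n V) (tensor_power n V) (act (tensor_power n V) g)"
  using linear_rep.act_linear[OF linear_rep_tensor_power] .

text \<open>On pure tensors one operation rearranges the entries and the other transforms each of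
  them, so they commute. This makes both invariants and coinvariants stable under the group.\<close>

lemma place_perm_act:
  assumes \<tau>: "\<tau> permutes {..<n}" and t: "t \<in> carrier (tensor_power n V)"
  shows "place_perm n V \<tau> (act (tensor_power n V) g t) = act (tensor_power n V) g (place_perm n V \<tau> t)"
proof (rule linear_space.linear_between_eq_on_span[OF linear_space_tensor_power
      linear_between_comp[OF tensor_act_linear place_perm_linear[OF \<tau>]]
      linear_between_comp[OF place_perm_linear[OF \<tau>] tensor_act_linear]
      linear_space_tensor_power spans_pure_tensor _ t])
  fix x assume "x \<in> pure_tensor n V ` power_lists n V"
  then obtain xs where xs: "xs \<in> power_lists n V" "x = pure_tensor n V xs" by auto
  then have "permute_list \<tau> (map (act V g) xs) = map (act V g) (permute_list \<tau> xs)"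
    using \<tau> by (intro permute_list_map) (simp add: power_lists_def)
  then show "place_perm n V \<tau> (act (tensor_power n V) g x) = act (tensor_power n V) g (place_perm n V \<tau> x)"
    using xs \<tau> by (simp add: act_pure_tensor place_perm_pure_tensor permute_list_power_lists
        power_lists_map_act)
qed

abbreviation (input) "sym_rels r \<equiv> {place_perm r V \<tau> w \<ominus>\<^bsub>tensor_power r V\<^esub> w
             | \<tau> w. \<tau> permutes {..<r} \<and> w \<in> carrier (tensor_power r V)}"

lemma sym_rels_carrier: "sym_rels r \<subseteq> carrier (tensor_power r V)"
proof -
  interpret T: linear_rep "tensor_power r V" by (rule linear_rep_tensor_power)
  show ?thesis using linear_betweenD(1)[OF place_perm_linear] by auto
qed

lemma quotient_sym_coinvariants: "quotient_rep (tensor_power r V) (lin_span (tensor_power r V) (sym_rels r))"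
proof (rule linear_rep.quotient_rep_lin_span[OF linear_rep_tensor_power sym_rels_carrier])
  interpret T: linear_rep "tensor_power r V" by (rule linear_rep_tensor_power)
  show "act (tensor_power r V) g s \<in> lin_span (tensor_power r V) (sym_rels r)" if s: "s \<in> sym_rels r" for g s
  proof -
    obtain \<tau> w where w: "s = place_perm r V \<tau> w \<ominus>\<^bsub>tensor_power r V\<^esub> w"
        and \<tau>: "\<tau> permutes {..<r}" and wc: "w \<in> carrier (tensor_power r V)"
      using s by auto
    have pc: "place_perm r V \<tau> w \<in> carrier (tensor_power r V)"
      using linear_betweenD(1)[OF place_perm_linear[OF \<tau>] wc] .
    have "act (tensor_power r V) g s
        = place_perm r V \<tau> (act (tensor_power r V) g w) \<ominus>\<^bsub>tensor_power r V\<^esub> act (tensor_power r V) g w"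
      unfolding w a_minus_def T.minus_one_smult[OF wc, symmetric]
        T.minus_one_smult[OF T.act_closed[OF wc], symmetric] place_perm_act[OF \<tau> wc]
      using pc wc by (simp add: T.act_add T.act_smult)
    then have "act (tensor_power r V) g s \<in> sym_rels r" using \<tau> T.act_closed[OF wc] by blast
    then show ?thesis by (rule subsetD[OF T.lin_span_superset])
  qed
qed

lemmas quotient_space_sym_coinvariants = quotient_rep.axioms(2)[OF quotient_sym_coinvariants]

lemma linear_rep_sym_coinvariants: "linear_rep (sym_coinvariants r V)"
  unfolding sym_coinvariants_def by (rule quotient_rep.linear_rep_quot[OF quotient_sym_coinvariants])

lemma sym_class_carrier:
  "xs \<in> power_lists r V \<Longrightarrow> sym_class r V xs \<in> carrier (sym_coinvariants r V)"
  unfolding sym_coinvariants_def sym_class_def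
  by (simp add: quotient_space.quot_carrier[OF quotient_space_sym_coinvariants] pure_tensor_carrier)

lemma act_sym_class:
  "xs \<in> power_lists r V \<Longrightarrow> act (sym_coinvariants r V) g (sym_class r V xs) = sym_class r V (map (act V g) xs)"
  unfolding sym_coinvariants_def sym_class_def
  by (simp add: quotient_rep.act_coset_of[OF quotient_sym_coinvariants] pure_tensor_carrier act_pure_tensor)

lemma sym_class_permute:
  assumes \<tau>: "\<tau> permutes {..<r}" and xs: "xs \<in> power_lists r V"
  shows "sym_class r V (permute_list \<tau> xs) = sym_class r V xs"
proof -
  interpret T: linear_rep "tensor_power r V" by (rule linear_rep_tensor_power)
  have "place_perm r V \<tau> (pure_tensor r V xs) \<ominus>\<^bsub>tensor_power r V\<^esub> pure_tensor r V xs \<in> sym_rels r"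
    using \<tau> pure_tensor_carrier[OF xs] by blast
  then have "pure_tensor r V (permute_list \<tau> xs) \<ominus>\<^bsub>tensor_power r V\<^esub> pure_tensor r V xs
      \<in> lin_span (tensor_power r V) (sym_rels r)"
    unfolding place_perm_pure_tensor[OF \<tau> xs] by (rule subsetD[OF T.lin_span_superset])
  then show ?thesis
    unfolding sym_class_def
    using quotient_space.coset_of_eq_iff[OF quotient_space_sym_coinvariants] pure_tensor_carrier
      xs permute_list_power_lists[OF \<tau> xs] by blast
qed

lemma spans_sym_class_basis:
  "spans V B \<Longrightarrow> spans (sym_coinvariants r V) (sym_class r V ` {xs. set xs \<subseteq> B \<and> length xs = r})"
  using quotient_space.spans_quot[OF quotient_space_sym_coinvariants spans_pure_tensor_basis]
  unfolding sym_coinvariants_def sym_class_def by (simp add: image_image)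

lemma free_lift_vanishes_on_sym_rels:
  assumes h: "multilinear r V h" "symmetric r V h" and w: "w \<in> lin_span (tensor_power r V) (sym_rels r)"
  shows "free_lift h w = 0"
proof (rule linear_space.functional_vanishes_on_lin_span[OF linear_space_tensor_power
      functional_tensor_power[OF h(1)] sym_rels_carrier _ w])
  fix s assume "s \<in> sym_rels r"
  then obtain \<tau> w where w: "s = place_perm r V \<tau> w \<ominus>\<^bsub>tensor_power r V\<^esub> w"
        and \<tau>: "\<tau> permutes {..<r}" and wc: "w \<in> carrier (tensor_power r V)" by auto
  have "free_lift h (place_perm r V \<tau> w) = free_lift h w"
    by (rule linear_space.functional_eq_on_span[OF linear_space_tensor_power
        functional_comp[OF functional_tensor_power[OF h(1)] place_perm_linear[OF \<tau>]]
        functional_tensor_power[OF h(1)] spans_pure_tensor _ wc])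
     (use h \<tau> in \<open>auto simp: place_perm_pure_tensor free_lift_pure_tensor permute_list_power_lists symmetric_def\<close>)
  then show "free_lift h s = 0"
    unfolding w using linear_betweenD(1)[OF place_perm_linear[OF \<tau>] wc] wc
    by (simp add: linear_space.functional_minus[OF linear_space_tensor_power functional_tensor_power[OF h(1)]])
qed

lemma functional_sym_coinvariants:
  assumes h: "multilinear r V h" "symmetric r V h"
  shows "functional (sym_coinvariants r V) (quot_lift h)"
  unfolding sym_coinvariants_def quot_lift_def
  using free_lift_vanishes_on_sym_rels[OF h]
  by (intro quotient_space.functional_descend[OF quotient_space_sym_coinvariants]
      functional_tensor_power[OF h(1)]) simp_all

lemma quot_lift_sym_class:
  assumes h: "multilinear r V h" "symmetric r V h" and xs: "xs \<in> power_lists r V"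
  shows "quot_lift h (sym_class r V xs) = h xs"
  unfolding quot_lift_def sym_class_def
  using quotient_space.descend_coset_of[OF quotient_space_sym_coinvariants functional_tensor_power[OF h(1)]
      free_lift_vanishes_on_sym_rels[OF h] pure_tensor_carrier[OF xs]]
  by (simp add: free_lift_pure_tensor[OF h(1) xs])

lemma linear_rep_sym_invariants: "linear_rep (sym_invariants r V)"
proof -
  interpret T: linear_rep "tensor_power r V" by (rule linear_rep_tensor_power)
  let ?C = "{w \<in> carrier (tensor_power r V). \<forall>\<tau>. \<tau> permutes {..<r} \<longrightarrow> place_perm r V \<tau> w = w}"
  have sub: "subspace_of (tensor_power r V) ?C"
    unfolding subspace_of_def
    using linear_betweenD[OF place_perm_linear] T.linear_between_zero[OF place_perm_linear T.linear_space_axioms]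
    by auto
  have "module (ring_of_type_algebra :: 'k ring) (tensor_power r V)"
    using T.linear_space_axioms by (simp add: linear_space_def)
  then have "linear_space (sym_invariants r V)"
    unfolding linear_space_def sym_invariants_def
    using submodule.submodule_is_module T.subspace_of_iff sub by blast
  moreover have "linear_between (sym_invariants r V) (sym_invariants r V) (act (sym_invariants r V) g)" for g
    using T.act_add T.act_smult place_perm_act by (auto simp: linear_between_def sym_invariants_def)
  ultimately show ?thesis by (simp add: linear_rep_def linear_rep_axioms_def)
qed

end

section \<open>Tensor products\<close>

definition tensor_pair ::
    "('k::field, 'v, 'g) representation \<Rightarrow> ('k, 'w, 'g) representation \<Rightarrow> 'v \<Rightarrow> 'w \<Rightarrow> ('v \<times> 'w \<Rightarrow>\<^sub>0 'k) set" where
  "tensor_pair V W x y =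
     presented_rep.gen (carrier V \<times> carrier W) (\<lambda>g. map_prod (act V g) (act W g)) (tensor_rels V W) (x, y)"

definition bilinear_form ::
    "('k::field, 'v, 'g) representation \<Rightarrow> ('k, 'w, 'g) representation \<Rightarrow> ('v \<Rightarrow> 'w \<Rightarrow> 'k) \<Rightarrow> bool" where
  "bilinear_form V W h \<longleftrightarrow>
     (\<forall>y\<in>carrier W. functional V (\<lambda>x. h x y)) \<and> (\<forall>x\<in>carrier V. functional W (h x))"

locale tensor_pair_reps = V: linear_rep V + W: linear_rep W
  for V :: "('k::field, 'v, 'g) representation" and W :: "('k, 'w, 'g) representation"
begin

lemma presented_tensor_rep:
  "presented_rep (carrier V \<times> carrier W) (\<lambda>g. map_prod (act V g) (act W g)) (tensor_rels V W)"
proof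
  fix r g assume "r \<in> tensor_rels V W"
  then show "push (map_prod (act V g) (act W g)) r \<in> tensor_rels V W"
    unfolding tensor_rels_def
  proof (elim UnE CollectE exE conjE, goal_cases)
    case (1 x x' y)
    show ?case
      unfolding 1 by (intro UnI1 CollectI exI[of _ "act V g x"] exI[of _ "act V g x'"] exI[of _ "act W g y"])
        (use 1 in \<open>simp add: push_diff V.act_add\<close>)
  next
    case (2 x y y')
    show ?case
      unfolding 2
      by (rule UnI1, rule UnI1, rule UnI2)
        (intro CollectI exI[of _ "act V g x"] exI[of _ "act W g y"] exI[of _ "act W g y'"],
          use 2 in \<open>simp add: push_diff W.act_add\<close>)
  next
    case (3 c x y)
    show ?case
      unfolding 3
      by (rule UnI1, rule UnI2)
        (intro CollectI exI[of _ c] exI[of _ "act V g x"] exI[of _ "act W g y"],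
          use 3 in \<open>simp add: push_diff V.act_smult\<close>)
  next
    case (4 c x y)
    show ?case
      unfolding 4
      by (rule UnI2)
        (intro CollectI exI[of _ c] exI[of _ "act V g x"] exI[of _ "act W g y"],
          use 4 in \<open>simp add: push_diff W.act_smult\<close>)
  qed
next
  have d: "Poly_Mapping.keys (p - q) \<subseteq> Poly_Mapping.keys p \<union> Poly_Mapping.keys q" for p q :: "'v \<times> 'w \<Rightarrow>\<^sub>0 'k"
    by (rule keys_diff)
  fix r assume "r \<in> tensor_rels V W"
  then show "Poly_Mapping.keys r \<subseteq> carrier V \<times> carrier W"
    unfolding tensor_rels_def
    by (elim UnE CollectE exE conjE) (force dest!: subsetD[OF d] split: if_splits)+
qed auto

lemma tensor_rep_eq:
  "tensor_rep V W = quot_rep (free_rep (carrier V \<times> carrier W) (\<lambda>g. map_prod (act V g) (act W g)))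
    (lin_span (free_rep (carrier V \<times> carrier W) (\<lambda>g. map_prod (act V g) (act W g))) (tensor_rels V W))"
  by (simp add: tensor_rep_def Let_def)

lemma linear_rep_tensor_rep: "linear_rep (tensor_rep V W)"
  unfolding tensor_rep_eq by (rule presented_rep.linear_rep_Q[OF presented_tensor_rep])

lemma linear_space_tensor_rep: "linear_space (tensor_rep V W)"
  using linear_rep_tensor_rep by (rule linear_rep.axioms)

lemma spans_tensor_pair: "spans (tensor_rep V W) ((\<lambda>(x, y). tensor_pair V W x y) ` (carrier V \<times> carrier W))"
  using presented_rep.spans_gen[OF presented_tensor_rep]
  by (simp add: tensor_rep_eq tensor_pair_def split_def)

lemma tensor_pair_carrier:
  "x \<in> carrier V \<Longrightarrow> y \<in> carrier W \<Longrightarrow> tensor_pair V W x y \<in> carrier (tensor_rep V W)"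
  using spans_tensor_pair by (auto simp: spans_def)

lemma act_tensor_pair:
  "x \<in> carrier V \<Longrightarrow> y \<in> carrier W \<Longrightarrow>
    act (tensor_rep V W) g (tensor_pair V W x y) = tensor_pair V W (act V g x) (act W g y)"
  using presented_rep.act_gen[OF presented_tensor_rep]
  by (simp add: tensor_rep_eq tensor_pair_def)

lemma tensor_pair_linear_left:
  assumes y: "y \<in> carrier W"
  shows "linear_between V (tensor_rep V W) (\<lambda>x. tensor_pair V W x y)"
  unfolding linear_between_def
proof (intro conjI ballI allI Pi_I)
  fix x assume x: "x \<in> carrier V"
  show "tensor_pair V W x y \<in> carrier (tensor_rep V W)" using x y by (rule tensor_pair_carrier)
  show "tensor_pair V W (x \<oplus>\<^bsub>V\<^esub> x') y = tensor_pair V W x y \<oplus>\<^bsub>tensor_rep V W\<^esub> tensor_pair V W x' y"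
    if "x' \<in> carrier V" for x'
    unfolding tensor_pair_def tensor_rep_eq
    by (rule presented_rep.gen_add[OF presented_tensor_rep])
      (use x y that in \<open>auto simp: tensor_rels_def\<close>)
  show "tensor_pair V W (c \<odot>\<^bsub>V\<^esub> x) y = c \<odot>\<^bsub>tensor_rep V W\<^esub> tensor_pair V W x y" for c
    unfolding tensor_pair_def tensor_rep_eq
    by (rule presented_rep.gen_smult[OF presented_tensor_rep])
      (use x y in \<open>auto simp: tensor_rels_def\<close>)
qed

lemma tensor_pair_linear_right:
  assumes x: "x \<in> carrier V"
  shows "linear_between W (tensor_rep V W) (tensor_pair V W x)"
  unfolding linear_between_def
proof (intro conjI ballI allI Pi_I)
  fix y assume y: "y \<in> carrier W"
  show "tensor_pair V W x y \<in> carrier (tensor_rep V W)" using x y by (rule tensor_pair_carrier)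
  show "tensor_pair V W x (y \<oplus>\<^bsub>W\<^esub> y') = tensor_pair V W x y \<oplus>\<^bsub>tensor_rep V W\<^esub> tensor_pair V W x y'"
    if "y' \<in> carrier W" for y'
    unfolding tensor_pair_def tensor_rep_eq
    by (rule presented_rep.gen_add[OF presented_tensor_rep])
      (use x y that in \<open>auto simp: tensor_rels_def\<close>)
  show "tensor_pair V W x (c \<odot>\<^bsub>W\<^esub> y) = c \<odot>\<^bsub>tensor_rep V W\<^esub> tensor_pair V W x y" for c
    unfolding tensor_pair_def tensor_rep_eq
    by (rule presented_rep.gen_smult[OF presented_tensor_rep])
      (use x y in \<open>auto simp: tensor_rels_def\<close>)
qed

text \<open>Linearity is applied one factor at a time: first x varies over V with y fixed in C, then
  y varies over W with x arbitrary.\<close>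

lemma spans_tensor_pair_basis:
  assumes B: "spans V B" and C: "spans W C"
  shows "spans (tensor_rep V W) ((\<lambda>(x, y). tensor_pair V W x y) ` (B \<times> C))"
proof (rule spans_trans[OF spans_tensor_pair])
  have BC: "B \<subseteq> carrier V" "C \<subseteq> carrier W" using assms by (auto simp: spans_def)
  show "(\<lambda>(x, y). tensor_pair V W x y) ` (B \<times> C) \<subseteq> carrier (tensor_rep V W)"
    using BC by (auto intro: tensor_pair_carrier)
  fix Y t
  assume Y: "subspace_of (tensor_rep V W) Y" "(\<lambda>(x, y). tensor_pair V W x y) ` (B \<times> C) \<subseteq> Y"
    and t: "t \<in> (\<lambda>(x, y). tensor_pair V W x y) ` (carrier V \<times> carrier W)"
  have 1: "tensor_pair V W x y \<in> Y" if y: "y \<in> C" and x: "x \<in> carrier V" for x y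
  proof -
    have "subspace_of V {x \<in> carrier V. tensor_pair V W x y \<in> Y}"
      using y BC
      by (intro V.linear_between_preimage[OF tensor_pair_linear_left linear_space_tensor_rep Y(1)]) auto
    from subspace_of_span_arg[OF this B _ x] show ?thesis using y BC Y(2) by auto
  qed
  have "tensor_pair V W x y \<in> Y" if x: "x \<in> carrier V" and y: "y \<in> carrier W" for x y
    using subspace_of_span_arg[OF W.linear_between_preimage[OF tensor_pair_linear_right[OF x]
        linear_space_tensor_rep Y(1)] C _ y] 1 x BC by auto
  with t show "t \<in> Y" by auto
qed

lemma bilinear_vanishes_on_tensor_rels:
  assumes "bilinear_form V W h" "r \<in> tensor_rels V W"
  shows "extend_free (case_prod h) r = 0"
proof -
  have left: "functional V (\<lambda>x. h x y)" if "y \<in> carrier W" for y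
    using assms(1) that by (simp add: bilinear_form_def)
  have right: "functional W (h x)" if "x \<in> carrier V" for x
    using assms(1) that by (simp add: bilinear_form_def)
  from assms(2) show ?thesis
    unfolding tensor_rels_def
    by (auto simp: extend_free_diff functional_add[OF left] functional_smult[OF left]
        functional_add[OF right] functional_smult[OF right])
qed

lemma functional_tensor_rep:
  "bilinear_form V W h \<Longrightarrow> functional (tensor_rep V W) (free_lift (case_prod h))"
  using presented_rep.functional_lift[OF presented_tensor_rep bilinear_vanishes_on_tensor_rels]
  by (simp add: tensor_rep_eq)

lemma free_lift_tensor_pair:
  "bilinear_form V W h \<Longrightarrow> x \<in> carrier V \<Longrightarrow> y \<in> carrier W \<Longrightarrow>
    free_lift (case_prod h) (tensor_pair V W x y) = h x y"
  using presented_rep.lift_gen[OF presented_tensor_rep bilinear_vanishes_on_tensor_rels]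
  by (simp add: tensor_pair_def)

end

section \<open>One-dimensional representations\<close>

lemma multilinear_plus:
  "multilinear r V f \<Longrightarrow> multilinear r V h \<Longrightarrow> multilinear r V (\<lambda>xs. f xs + h xs)"
  by (auto simp: multilinear_def algebra_simps)

lemma multilinear_times: "multilinear r V f \<Longrightarrow> multilinear r V (\<lambda>xs. c * f xs)"
  by (auto simp: multilinear_def algebra_simps)

lemma multilinear_sum:
  assumes "\<And>i. i \<in> I \<Longrightarrow> multilinear r V (f i)"
  shows "multilinear r V (\<lambda>xs. \<Sum>i\<in>I. f i xs)"
  using assms
proof (induction I rule: infinite_finite_induct)
  case (insert i I)
  then show ?case by (simp add: multilinear_plus)
qed (auto simp: multilinear_def)

text \<open>Only the factor at the changed position depends on the new entry.\<close>

lemma multilinear_prod: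
  assumes f: "\<And>i. i < r \<Longrightarrow> functional V (f i)"
  shows "multilinear r V (\<lambda>xs. \<Prod>i<r. f i (xs ! i))"
proof -
  have split: "(\<Prod>i<r. f i (xs[j := x] ! i)) = f j x * (\<Prod>i\<in>{..<r} - {j}. f i (xs ! i))"
    if "xs \<in> power_lists r V" "j < r" for xs j x
  proof -
    have "(\<Prod>i<r. f i (xs[j := x] ! i)) = f j (xs[j := x] ! j) * (\<Prod>i\<in>{..<r} - {j}. f i (xs[j := x] ! i))"
      using that by (intro prod.remove) auto
    also have "(\<Prod>i\<in>{..<r} - {j}. f i (xs[j := x] ! i)) = (\<Prod>i\<in>{..<r} - {j}. f i (xs ! i))"
      by (intro prod.cong) auto
    finally show ?thesis using that by (simp add: power_lists_def)
  qed
  show ?thesis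
    unfolding multilinear_def using f
    by (auto simp: split functional_add functional_smult algebra_simps)
qed

text \<open>One-dimensional representations with character \<theta>, witnessed by a generator d and
  a functional f. The condition f d = 1 excludes the zero space and makes f the coordinate with
  respect to d.\<close>

definition line ::
    "'g monoid \<Rightarrow> ('k::field, 'v, 'g) representation \<Rightarrow> ('g \<Rightarrow> 'k) \<Rightarrow> bool" where
  "line G L \<theta> \<longleftrightarrow> linear_rep L \<and> (\<exists>d f. spans L {d} \<and> functional L f \<and> f d = 1 \<and>
     (\<forall>g\<in>carrier G. \<forall>x\<in>carrier L. f (act L g x) = \<theta> g * f x))"

lemma (in linear_rep) lineI:
  assumes d: "spans V {d}" and f: "functional V f" and fd: "f d = 1"
    and act: "\<And>g. g \<in> carrier G \<Longrightarrow> f (act V g d) = \<theta> g"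
  shows "line G V \<theta>"
proof -
  have "f (act V g x) = \<theta> g * f x" if "g \<in> carrier G" "x \<in> carrier V" for g x
    by (rule functional_eq_on_span[OF functional_comp[OF f act_linear] functional_times[OF f] d _ that(2)])
      (use act[OF that(1)] fd in simp)
  then show ?thesis
    using assms linear_rep_axioms unfolding line_def by blast
qed

lemma line_tensor_power:
  assumes "line G L \<theta>"
  shows "line G (tensor_power k L) (\<lambda>g. \<theta> g ^ k)"
proof -
  interpret linear_rep L using assms by (simp add: line_def)
  obtain d f where d: "spans L {d}" "functional L f" "f d = 1"
      and act: "\<And>g x. g \<in> carrier G \<Longrightarrow> x \<in> carrier L \<Longrightarrow> f (act L g x) = \<theta> g * f x"
    using assms unfolding line_def by auto
  have dc: "d \<in> carrier L" using d by (simp add: spans_def)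
  let ?d = "pure_tensor k L (replicate k d)" and ?h = "\<lambda>xs. \<Prod>i<k. f (xs ! i)"
  have h: "multilinear k L ?h" using multilinear_prod[of k L "\<lambda>_. f"] d by simp
  have rep: "replicate k x \<in> power_lists k L" if "x \<in> carrier L" for x
    using that by (auto simp: power_lists_def)
  \<comment> \<open>The only list of length k over a single vector is constant; for k = 0 it is the
    empty list and the character is trivial.\<close>
  have "{xs. set xs \<subseteq> {d} \<and> length xs = k} = {replicate k d}"
    by (auto simp: replicate_length_same subset_iff intro: replicate_eqI)
  with spans_pure_tensor_basis[OF d(1), of k] have span: "spans (tensor_power k L) {?d}" by simp
  show ?thesis
  proof (rule linear_rep.lineI[OF linear_rep_tensor_power span functional_tensor_power[OF h]])
    show "free_lift ?h ?d = 1" using free_lift_pure_tensor[OF h rep[OF dc]] d by simp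
    show "free_lift ?h (act (tensor_power k L) g ?d) = \<theta> g ^ k" if "g \<in> carrier G" for g
      using free_lift_pure_tensor[OF h rep[OF act_closed[OF dc]]] act[OF that dc] d(3)
      by (simp add: act_pure_tensor rep[OF dc])
  qed
qed

lemma (in linear_rep) linear_rep_dual_rep: "linear_rep (dual_rep G V)"
proof -
  have "linear_space (dual_rep G V)"
    by (rule linear_spaceI) (auto simp: dual_rep_def extensional_def algebra_simps fun_eq_iff)
  moreover have "linear_between (dual_rep G V) (dual_rep G V) (act (dual_rep G V) g)" for g
    by (auto simp: linear_between_def dual_rep_def act_add act_smult)
  ultimately show ?thesis by (simp add: linear_rep_def linear_rep_axioms_def)
qed

text \<open>Every functional h on the line equals h(d) times f, so the restriction of f generates
  the dual, and evaluation at d is its coordinate.\<close>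

lemma line_dual_rep:
  assumes "line G L \<theta>" and inv: "\<And>g. g \<in> carrier G \<Longrightarrow> inv\<^bsub>G\<^esub> g \<in> carrier G"
  shows "line G (dual_rep G L) (\<lambda>g. \<theta> (inv\<^bsub>G\<^esub> g))"
proof -
  interpret linear_rep L using assms by (simp add: line_def)
  interpret D: linear_rep "dual_rep G L" by (rule linear_rep_dual_rep)
  obtain d f where d: "spans L {d}" "functional L f" "f d = 1"
      and act: "\<And>g x. g \<in> carrier G \<Longrightarrow> x \<in> carrier L \<Longrightarrow> f (act L g x) = \<theta> g * f x"
    using assms unfolding line_def by auto
  have dc: "d \<in> carrier L" using d by (simp add: spans_def)
  let ?f = "restrict f (carrier L)"
  have fc: "?f \<in> carrier (dual_rep G L)" using d(2) by (auto simp: dual_rep_def functional_def)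
  have all: "h x = h d * f x" if "h \<in> carrier (dual_rep G L)" "x \<in> carrier L" for h x
    by (rule functional_eq_on_span[OF _ functional_times[OF d(2)] d(1) _ that(2)])
      (use that d(3) in \<open>auto simp: functional_def dual_rep_def\<close>)
  show ?thesis
  proof (rule D.lineI)
    show "spans (dual_rep G L) {?f}"
      unfolding spans_def
    proof (intro conjI allI impI subsetI)
      fix Y h assume Y: "subspace_of (dual_rep G L) Y" "{?f} \<subseteq> Y" and h: "h \<in> carrier (dual_rep G L)"
      have "h = h d \<odot>\<^bsub>dual_rep G L\<^esub> ?f"
        using all[OF h] h by (auto simp: dual_rep_def extensional_def)
      with Y show "h \<in> Y" by (metis D.subspace_ofD(4) insert_subset)
    qed (use fc in auto)
    show "functional (dual_rep G L) (\<lambda>h. h d)" using dc by (auto simp: functional_def dual_rep_def)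
    show "?f d = 1" using d dc by simp
    show "act (dual_rep G L) g ?f d = \<theta> (inv\<^bsub>G\<^esub> g)" if "g \<in> carrier G" for g
      using dc act[OF inv[OF that] dc] d(3) by (simp add: dual_rep_def)
  qed
qed

section \<open>Isomorphisms detected by functionals\<close>

text \<open>Both spaces embed into the functions on the test set P and have the same image there;
  the group acts on these functions by one common formula, substitution by \<tau> and multiplication
  by \<rho>. The isomorphism is one embedding followed by the inverse of the other.\<close>

lemma rep_isoI_functionals:
  assumes "linear_rep A" "linear_rep M"
    and fA: "\<And>w. w \<in> P \<Longrightarrow> functional A (\<lambda>a. \<Phi> a w)"
    and fM: "\<And>w. w \<in> P \<Longrightarrow> functional M (\<lambda>a. \<Psi> a w)"
    and injA: "\<And>a. a \<in> carrier A \<Longrightarrow> (\<And>w. w \<in> P \<Longrightarrow> \<Phi> a w = 0) \<Longrightarrow> a = \<zero>\<^bsub>A\<^esub>"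
    and injM: "\<And>a. a \<in> carrier M \<Longrightarrow> (\<And>w. w \<in> P \<Longrightarrow> \<Psi> a w = 0) \<Longrightarrow> a = \<zero>\<^bsub>M\<^esub>"
    and AM: "\<And>a. a \<in> carrier A \<Longrightarrow> \<exists>b\<in>carrier M. \<forall>w\<in>P. \<Psi> b w = \<Phi> a w"
    and MA: "\<And>b. b \<in> carrier M \<Longrightarrow> \<exists>a\<in>carrier A. \<forall>w\<in>P. \<Phi> a w = \<Psi> b w"
    and \<tau>: "\<And>g w. g \<in> carrier G \<Longrightarrow> w \<in> P \<Longrightarrow> \<tau> g w \<in> P"
    and actA: "\<And>g a w. g \<in> carrier G \<Longrightarrow> a \<in> carrier A \<Longrightarrow> w \<in> P \<Longrightarrow> \<Phi> (act A g a) w = \<rho> g * \<Phi> a (\<tau> g w)"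
    and actM: "\<And>g a w. g \<in> carrier G \<Longrightarrow> a \<in> carrier M \<Longrightarrow> w \<in> P \<Longrightarrow> \<Psi> (act M g a) w = \<rho> g * \<Psi> a (\<tau> g w)"
  shows "rep_iso G A M"
proof -
  interpret A: linear_rep A by fact
  interpret M: linear_rep M by fact
  have eqA: "a = a'" if a: "a \<in> carrier A" "a' \<in> carrier A" and eq: "\<And>w. w \<in> P \<Longrightarrow> \<Phi> a w = \<Phi> a' w" for a a'
  proof -
    have "a \<ominus>\<^bsub>A\<^esub> a' = \<zero>\<^bsub>A\<^esub>" using a eq by (intro injA) (auto simp: A.functional_minus[OF fA])
    moreover have "a = (a \<ominus>\<^bsub>A\<^esub> a') \<oplus>\<^bsub>A\<^esub> a'" using a by (simp add: a_minus_def A.M.a_assoc A.M.l_neg)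
    ultimately show ?thesis using a by simp
  qed
  have eqM: "a = a'" if a: "a \<in> carrier M" "a' \<in> carrier M" and eq: "\<And>w. w \<in> P \<Longrightarrow> \<Psi> a w = \<Psi> a' w" for a a'
  proof -
    have "a \<ominus>\<^bsub>M\<^esub> a' = \<zero>\<^bsub>M\<^esub>" using a eq by (intro injM) (auto simp: M.functional_minus[OF fM])
    moreover have "a = (a \<ominus>\<^bsub>M\<^esub> a') \<oplus>\<^bsub>M\<^esub> a'" using a by (simp add: a_minus_def M.M.a_assoc M.M.l_neg)
    ultimately show ?thesis using a by simp
  qed
  \<comment> \<open>By \<open>eqM\<close> the choice is unique, and every identity about \<phi> can
    be checked on values.\<close>
  obtain \<phi> where \<phi>: "\<And>a. a \<in> carrier A \<Longrightarrow> \<phi> a \<in> carrier M"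
      "\<And>a w. a \<in> carrier A \<Longrightarrow> w \<in> P \<Longrightarrow> \<Psi> (\<phi> a) w = \<Phi> a w"
    using AM by metis
  show ?thesis
    unfolding rep_iso_def
  proof (intro exI[of _ \<phi>] conjI ballI allI)
    show "bij_betw \<phi> (carrier A) (carrier M)"
    proof (rule bij_betw_imageI)
      show "inj_on \<phi> (carrier A)" using \<phi> by (intro inj_onI eqA) metis+
      show "\<phi> ` carrier A = carrier M"
      proof (intro equalityI subsetI)
        fix b assume b: "b \<in> carrier M"
        then obtain a where a: "a \<in> carrier A" "\<And>w. w \<in> P \<Longrightarrow> \<Phi> a w = \<Psi> b w" using MA by metis
        then have "\<phi> a = b" using \<phi> b by (intro eqM) auto
        then show "b \<in> \<phi> ` carrier A" using a by auto
      qed (use \<phi> in auto)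
    qed
    show "\<phi> (x \<oplus>\<^bsub>A\<^esub> y) = \<phi> x \<oplus>\<^bsub>M\<^esub> \<phi> y" if "x \<in> carrier A" "y \<in> carrier A" for x y
      using that \<phi> by (intro eqM) (auto simp: functional_add[OF fA] functional_add[OF fM])
    show "\<phi> (c \<odot>\<^bsub>A\<^esub> x) = c \<odot>\<^bsub>M\<^esub> \<phi> x" if "x \<in> carrier A" for c x
      using that \<phi> by (intro eqM) (auto simp: functional_smult[OF fA] functional_smult[OF fM])
    show "\<phi> (act A g x) = act M g (\<phi> x)" if "g \<in> carrier G" "x \<in> carrier A" for g x
      using that \<phi> \<tau> by (intro eqM) (auto simp: actA actM)
  qed
qed

section \<open>Gram determinants\<close>

text \<open>The pairing induced by \<beta> on k-th exterior powers, evaluated at decomposable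
  elements.\<close>

definition gram :: "('u \<Rightarrow> 'v \<Rightarrow> 'k::field) \<Rightarrow> nat \<Rightarrow> 'u list \<Rightarrow> 'v list \<Rightarrow> 'k" where
  "gram \<beta> k us ws = Determinant.det (Matrix.mat k k (\<lambda>(i, j). \<beta> (us ! i) (ws ! j)))"

lemma gram_flip: "gram \<beta> k us ws = gram (\<lambda>x y. \<beta> y x) k ws us"
proof -
  let ?A = "Matrix.mat k k (\<lambda>(i, j). \<beta> (us ! i) (ws ! j))"
  have "transpose_mat ?A = Matrix.mat k k (\<lambda>(i, j). \<beta> (us ! j) (ws ! i))" by (rule eq_matI) auto
  then show ?thesis using Determinant.det_transpose[of ?A k] by (simp add: gram_def)
qed

text \<open>In this expansion every summand is a product with exactly one factor for each entry of
  us, which is the shape that \<open>multilinear_prod\<close> handles.\<close>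

lemma gram_leibniz:
  "gram \<beta> k us ws = (\<Sum>p | p permutes {0..<k}. signof p * (\<Prod>i<k. \<beta> (us ! i) (ws ! p i)))"
proof -
  let ?A = "Matrix.mat k k (\<lambda>(i, j). \<beta> (us ! i) (ws ! j))"
  have "gram \<beta> k us ws = (\<Sum>p | p permutes {0..<k}. signof p * (\<Prod>i = 0..<k. ?A $$ (i, p i)))"
    unfolding gram_def by (rule det_def') simp
  also have "\<dots> = (\<Sum>p | p permutes {0..<k}. signof p * (\<Prod>i<k. \<beta> (us ! i) (ws ! p i)))"
  proof (intro sum.cong refl arg_cong2[where f = "(*)"] prod.cong)
    fix p i assume "p \<in> {p. p permutes {0..<k}}" "i \<in> {..<k}"
    then show "?A $$ (i, p i) = \<beta> (us ! i) (ws ! p i)" using permutes_in_image[of p "{0..<k}" i] by simp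
  qed (rule atLeast0LessThan)
  finally show ?thesis .
qed

lemma alternating_gram_left:
  assumes "\<And>j. j < k \<Longrightarrow> functional U (\<lambda>x. \<beta> x (ws ! j))"
  shows "alternating k U (\<lambda>us. gram \<beta> k us ws)"
  unfolding alternating_def
proof (intro conjI ballI impI)
  show "multilinear k U (\<lambda>us. gram \<beta> k us ws)"
    unfolding gram_leibniz
  proof (intro multilinear_sum multilinear_times multilinear_prod[where f = "\<lambda>i x. \<beta> x (ws ! _ i)"])
    fix p i assume "p \<in> {p. p permutes {0..<k}}" "i < k"
    then show "functional U (\<lambda>x. \<beta> x (ws ! p i))" using permutes_in_image[of p "{0..<k}" i] by (intro assms) auto
  qed
  fix us assume us: "us \<in> power_lists k U" "\<not> distinct us"
  then obtain i j where ij: "i < k" "j < k" "i \<noteq> j" "us ! i = us ! j"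
    by (auto simp: distinct_conv_nth power_lists_def)
  show "gram \<beta> k us ws = 0"
    unfolding gram_def
    by (rule det_identical_rows[of _ k i j]) (use ij in \<open>auto intro: eq_vecI\<close>)
qed

lemma alternating_gram_right:
  assumes "\<And>i. i < k \<Longrightarrow> functional V (\<beta> (us ! i))"
  shows "alternating k V (\<lambda>ws. gram \<beta> k us ws)"
  using alternating_gram_left[of k V "\<lambda>x y. \<beta> y x" us] assms by (simp add: gram_flip[of \<beta>])

lemma gram_zero_row:
  assumes "i < k" "\<And>j. j < k \<Longrightarrow> \<beta> (us ! i) (ws ! j) = 0"
  shows "gram \<beta> k us ws = 0"
  unfolding gram_leibniz
proof (intro sum.neutral ballI)
  fix p assume "p \<in> {p. p permutes {0..<k}}"
  then have "p i < k" using permutes_in_image[of p "{0..<k}" i] assms(1) by auto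
  then have "(\<Prod>i<k. \<beta> (us ! i) (ws ! p i)) = 0" using assms by (intro prod_zero) auto
  then show "signof p * (\<Prod>i<k. \<beta> (us ! i) (ws ! p i)) = 0" by simp
qed

lemma gram_scale:
  assumes "\<And>i j. i < k \<Longrightarrow> j < k \<Longrightarrow> \<beta> (us ! i) (ws ! j) = c * \<beta>' (us' ! i) (ws' ! j)"
  shows "gram \<beta> k us ws = c ^ k * gram \<beta>' k us' ws'"
proof -
  have "Matrix.mat k k (\<lambda>(i, j). \<beta> (us ! i) (ws ! j)) = c \<cdot>\<^sub>m Matrix.mat k k (\<lambda>(i, j). \<beta>' (us' ! i) (ws' ! j))"
    using assms by (intro eq_matI) auto
  then show ?thesis unfolding gram_def by simp
qed

lemma alternating_append_left:
  assumes h: "alternating (l + m) V h" and ws: "ws \<in> power_lists m V"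
  shows "alternating l V (\<lambda>xs. h (xs @ ws))"
proof -
  have app: "xs @ ws \<in> power_lists (l + m) V" if "xs \<in> power_lists l V" for xs
    using that ws by (auto simp: power_lists_def)
  have "xs[i := x] @ ws = (xs @ ws)[i := x]" if "xs \<in> power_lists l V" "i < l" for xs i x
    using that by (simp add: power_lists_def list_update_append1)
  then show ?thesis
    using h app unfolding alternating_def multilinear_def by simp
qed

lemma alternating_append_right:
  assumes h: "alternating (l + m) V h" and xs: "xs \<in> power_lists l V"
  shows "alternating m V (\<lambda>ws. h (xs @ ws))"
proof -
  have app: "xs @ ws \<in> power_lists (l + m) V" if "ws \<in> power_lists m V" for ws
    using that xs by (auto simp: power_lists_def)
  have upd: "xs @ ws[i := x] = (xs @ ws)[l + i := x]" for ws i x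
    using xs by (simp add: power_lists_def list_update_append)
  show ?thesis
    using h app unfolding alternating_def multilinear_def upd by simp
qed

section \<open>Complementary exterior powers of dual spaces\<close>

text \<open>The value of a descended form is known on lists over the carrier only, so such a form
  cannot simply be rewritten as an equal function.\<close>

lemma alternating_cong:
  assumes h: "alternating r V h" and eq: "\<And>xs. xs \<in> power_lists r V \<Longrightarrow> h' xs = h xs"
    and V: "linear_space V"
  shows "alternating r V h'"
proof -
  interpret linear_space V by fact
  have "h' (xs[i := x]) = h (xs[i := x])" if "xs \<in> power_lists r V" "x \<in> carrier V" for xs i x
    using that by (intro eq power_lists_update)
  then show ?thesis
    using h eq unfolding alternating_def multilinear_def by simp
qed

text \<open>Each identity required of a multilinear form is linear in the parameter a, so it passes
  from a spanning set to all of M.\<close>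

lemma (in linear_rep) multilinear_on_span:
  assumes M: "linear_space M" and f: "\<And>ws. ws \<in> power_lists m V \<Longrightarrow> functional M (\<lambda>a. \<Phi> a ws)"
    and B: "spans M B" "\<And>b. b \<in> B \<Longrightarrow> multilinear m V (\<Phi> b)" and a: "a \<in> carrier M"
  shows "multilinear m V (\<Phi> a)"
  unfolding multilinear_def
proof (intro conjI ballI allI impI)
  fix ws i assume ws: "ws \<in> power_lists m V"
  note f' = f[OF power_lists_update[OF ws]]
  show "\<Phi> a (ws[i := x \<oplus> y]) = \<Phi> a (ws[i := x]) + \<Phi> a (ws[i := y])"
    if "i < m" "x \<in> carrier V" "y \<in> carrier V" for x y
    by (rule linear_space.functional_eq_on_span[OF M f' functional_plus[OF f' f'] B(1) _ a])
      (use that B(2) ws in \<open>auto simp: multilinear_def\<close>)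
  show "\<Phi> a (ws[i := c \<odot> x]) = c * \<Phi> a (ws[i := x])" if "i < m" "x \<in> carrier V" for c x
    by (rule linear_space.functional_eq_on_span[OF M f' functional_times[OF f'] B(1) _ a])
      (use that B(2) ws in \<open>auto simp: multilinear_def\<close>)
qed

lemma (in linear_rep) alternating_on_span:
  assumes M: "linear_space M" and f: "\<And>ws. ws \<in> power_lists m V \<Longrightarrow> functional M (\<lambda>a. \<Phi> a ws)"
    and B: "spans M B" "\<And>b. b \<in> B \<Longrightarrow> alternating m V (\<Phi> b)" and a: "a \<in> carrier M"
  shows "alternating m V (\<Phi> a)"
  unfolding alternating_def
proof (intro conjI ballI impI)
  show "multilinear m V (\<Phi> a)"
    using B(2) by (intro multilinear_on_span[OF M f B(1) _ a]) (auto simp: alternating_def)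
  show "\<Phi> a ws = 0" if "ws \<in> power_lists m V" "\<not> distinct ws" for ws
    by (rule linear_space.functional_eq_on_span[OF M f[OF that(1)] functional_null B(1) _ a])
      (use that B(2) in \<open>auto simp: alternating_def\<close>)
qed

lemma (in linear_rep) alternating_map:
  assumes h: "alternating r V h" and f: "linear_between V V f"
  shows "alternating r V (\<lambda>xs. h (map f xs))"
proof -
  have "map f xs \<in> power_lists r V" if "xs \<in> power_lists r V" for xs
    using that linear_betweenD(1)[OF f] by (auto simp: power_lists_def)
  then show ?thesis
    using h linear_betweenD[OF f] unfolding alternating_def multilinear_def
    by (auto simp: map_update distinct_map)
qed

text \<open>Being dual to each other makes the two spanning families bases and the pairing perfect,
  without forming a dual space.\<close>

locale dual_bases = U: linear_rep U + V: linear_rep V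
  for U :: "('k::field, 'u, 'g) representation" and V :: "('k, 'v, 'g) representation" +
  fixes \<beta> :: "'u \<Rightarrow> 'v \<Rightarrow> 'k" and n :: nat and u :: "nat \<Rightarrow> 'u" and v :: "nat \<Rightarrow> 'v"
  assumes \<beta>: "bilinear_form U V \<beta>"
    and u: "spans U (u ` {..<n})" and v: "spans V (v ` {..<n})"
    and dual: "i < n \<Longrightarrow> j < n \<Longrightarrow> \<beta> (u i) (v j) = (if i = j then 1 else 0)"
begin

lemma u_carrier: "i < n \<Longrightarrow> u i \<in> carrier U" and v_carrier: "i < n \<Longrightarrow> v i \<in> carrier V"
  using u v by (auto simp: spans_def)

lemma \<beta>_left: "y \<in> carrier V \<Longrightarrow> functional U (\<lambda>x. \<beta> x y)"
  and \<beta>_right: "x \<in> carrier U \<Longrightarrow> functional V (\<beta> x)"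
  using \<beta> by (auto simp: bilinear_form_def)

lemma gram_left: "ws \<in> power_lists k V \<Longrightarrow> alternating k U (\<lambda>us. gram \<beta> k us ws)"
  by (intro alternating_gram_left \<beta>_left) (auto simp: power_lists_def)

lemma gram_right: "us \<in> power_lists k U \<Longrightarrow> alternating k V (gram \<beta> k us)"
  by (intro alternating_gram_right \<beta>_right) (auto simp: power_lists_def)

text \<open>For S = T the matrix is the identity. Otherwise S has an element outside T, the
  cardinalities being equal, and the row of that element vanishes.\<close>

lemma gram_basis:
  assumes S: "S \<subseteq> {..<n}" "card S = k" and T: "T \<subseteq> {..<n}" "card T = k"
  shows "gram \<beta> k (map u (sorted_list_of_set S)) (map v (sorted_list_of_set T)) = (if S = T then 1 else 0)"
proof (cases "S = T")
  case True
  have fin: "finite S" using S(1) by (rule finite_subset) simp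
  have len: "length (sorted_list_of_set S) = k" using S by simp
  have lt: "sorted_list_of_set S ! i < n" if "i < k" for i
    using nth_mem[of i "sorted_list_of_set S"] that S fin len by auto
  have "Matrix.mat k k (\<lambda>(i, j). \<beta> (map u (sorted_list_of_set S) ! i) (map v (sorted_list_of_set S) ! j)) = 1\<^sub>m k"
    by (rule eq_matI) (use len lt in \<open>auto simp: dual nth_eq_iff_index_eq\<close>)
  then show ?thesis using True by (simp add: gram_def)
next
  case False
  have fin: "finite S" "finite T" using S(1) T(1) by (auto intro: finite_subset)
  have "\<not> S \<subseteq> T" using False card_subset_eq[OF fin(2)] S T by metis
  then obtain s where s: "s \<in> S" "s \<notin> T" by auto
  then obtain i where i: "i < k" "sorted_list_of_set S ! i = s"
    using fin S by (metis in_set_conv_nth length_sorted_list_of_set set_sorted_list_of_set)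
  have "\<beta> (map u (sorted_list_of_set S) ! i) (map v (sorted_list_of_set T) ! j) = 0" if "j < k" for j
  proof -
    have "sorted_list_of_set T ! j \<in> T" using that fin T by (metis length_sorted_list_of_set nth_mem set_sorted_list_of_set)
    then have "sorted_list_of_set T ! j < n" "s < n" "s \<noteq> sorted_list_of_set T ! j"
      using s S T by auto
    then show ?thesis using i that S T by (simp add: dual)
  qed
  then show ?thesis using False i(1) by (simp add: gram_zero_row)
qed

section \<open>The volume form\<close>

definition vol :: "'v list \<Rightarrow> 'k" where
  "vol = gram \<beta> n (map u [0..<n])"

lemma alternating_vol: "alternating n V vol"
  unfolding vol_def by (rule gram_right) (auto simp: power_lists_def u_carrier)

lemma sorted_list_lessThan: "sorted_list_of_set {..<n} = [0..<n]"
  by (simp add: lessThan_atLeast0)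

lemma vol_basis: "vol (map v [0..<n]) = 1"
  using gram_basis[of "{..<n}" n "{..<n}"] by (simp add: vol_def sorted_list_lessThan)

text \<open>An alternating form of top degree is determined by its value on the basis, since the
  full index set is the only one of size n. The factor is therefore the determinant of f.\<close>

lemma vol_map:
  assumes f: "linear_between V V f" and xs: "xs \<in> power_lists n V"
  shows "vol (map f xs) = vol (map (f \<circ> v) [0..<n]) * vol xs"
proof (rule V.alternating_eqI[OF v V.alternating_map[OF alternating_vol f] _ _ xs])
  let ?c = "vol (map (f \<circ> v) [0..<n])"
  show "alternating n V (\<lambda>xs. ?c * vol xs)"
    using alternating_vol by (auto simp: alternating_def multilinear_times)
  fix S assume "S \<subseteq> {..<n}" "card S = n"
  then have "S = {..<n}" using card_subset_eq[of "{..<n}" S] by simp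
  then show "vol (map f (map v (sorted_list_of_set S))) = ?c * vol (map v (sorted_list_of_set S))"
    by (simp add: sorted_list_lessThan vol_basis)
qed

text \<open>The matrix of pairings is a permutation matrix, so its transpose is its inverse. This
  shows nonvanishing without identifying the sign.\<close>

lemma vol_permuted_basis:
  assumes "distinct is" "set is = {..<n}"
  shows "vol (map v is) \<noteq> 0"
proof -
  have len: "length is = n" using assms distinct_card by fastforce
  let ?A = "Matrix.mat n n (\<lambda>(i, j). \<beta> (map u [0..<n] ! i) (map v is ! j))"
  have lt: "is ! j < n" if "j < n" for j using that assms(2) len nth_mem by blast
  have A: "?A $$ (i, j) = (if i = is ! j then 1 else 0)" if "i < n" "j < n" for i j
    using that lt len by (simp add: dual)
  have "transpose_mat ?A * ?A = 1\<^sub>m n"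
  proof (rule eq_matI)
    fix j k assume "j < dim_row (1\<^sub>m n)" "k < dim_col (1\<^sub>m n)"
    then have jk: "j < n" "k < n" by auto
    have "(transpose_mat ?A * ?A) $$ (j, k) = (\<Sum>i = 0..<n. ?A $$ (i, j) * ?A $$ (i, k))"
      using jk by (simp add: scalar_prod_def)
    also have "\<dots> = (\<Sum>i = 0..<n. if i = is ! j then (if is ! j = is ! k then 1 else 0) else 0)"
      using jk A by (intro sum.cong refl) auto
    also have "\<dots> = 1\<^sub>m n $$ (j, k)"
      using jk lt len assms(1) by (simp add: nth_eq_iff_index_eq)
    finally show "(transpose_mat ?A * ?A) $$ (j, k) = 1\<^sub>m n $$ (j, k)" .
  qed auto
  then have "Determinant.det (transpose_mat ?A) * Determinant.det ?A = 1"
    using Determinant.det_mult[of "transpose_mat ?A" n ?A] by simp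
  then show ?thesis unfolding vol_def gram_def by auto
qed

text \<open>This is \<Lambda>^l V = \<Lambda>^m V* \<otimes> det V with V* replaced by U. A pairing
  that g scales by \<open>\<kappa> g\<close> makes U the dual of V twisted by \<kappa>, so the m-th
  exterior power of U carries an extra factor \<open>\<kappa> g ^ m\<close>, and \<theta> is the
  determinant on V divided by it. The function \<gamma> supplies inverse operators; it becomes
  matrix inversion in the application.\<close>

theorem ext_power_complement:
  assumes n: "n = l + m" and D: "line G D \<theta>"
    and inverse: "\<And>g x. g \<in> carrier G \<Longrightarrow> x \<in> carrier V \<Longrightarrow> act V g (act V (\<gamma> g) x) = x"
    and \<kappa>: "\<And>g x y. g \<in> carrier G \<Longrightarrow> x \<in> carrier U \<Longrightarrow> y \<in> carrier V \<Longrightarrow>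
      \<beta> (act U g x) (act V g y) = \<kappa> g * \<beta> x y"
    and det: "\<And>g. g \<in> carrier G \<Longrightarrow> vol (map (act V g \<circ> v) [0..<n]) = \<kappa> g ^ m * \<theta> g"
  shows "rep_iso G (ext_power l V) (tensor_rep (ext_power m U) D)"
proof -
  interpret D: linear_rep D using D by (simp add: line_def)
  interpret A: linear_rep "ext_power l V" by (rule V.linear_rep_ext_power)
  interpret B: linear_rep "ext_power m U" by (rule U.linear_rep_ext_power)
  interpret T: tensor_pair_reps "ext_power m U" D ..
  interpret M: linear_rep "tensor_rep (ext_power m U) D" by (rule T.linear_rep_tensor_rep)
  let ?A = "ext_power l V" and ?B = "ext_power m U" and ?M = "tensor_rep (ext_power m U) D"
  obtain d f where d: "spans D {d}" "functional D f" "f d = 1"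
      and act_f: "\<And>g x. g \<in> carrier G \<Longrightarrow> x \<in> carrier D \<Longrightarrow> f (act D g x) = \<theta> g * f x"
    using D unfolding line_def by auto
  have dc: "d \<in> carrier D" using d by (simp add: spans_def)
  define \<Phi> where "\<Phi> a ws = quot_lift (\<lambda>xs. vol (xs @ ws)) a" for a ws
  \<comment> \<open>The line D contributes the scalar f x. Since f d = 1, tensoring with d leaves
    the form of a wedge unchanged, and D shows only in the action.\<close>
  define h where "h ws b x = quot_lift (\<lambda>us. gram \<beta> m us ws) b * f x" for ws b x
  define \<Psi> where "\<Psi> t ws = free_lift (case_prod (h ws)) t" for t ws
  let ?P = "power_lists m V"
  have vol: "alternating (l + m) V vol" using alternating_vol n by simp
  have fA: "functional ?A (\<lambda>a. \<Phi> a ws)" if "ws \<in> ?P" for ws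
    unfolding \<Phi>_def by (rule V.functional_ext_power[OF alternating_append_left[OF vol that]])
  have bil: "bilinear_form ?B D (h ws)" if "ws \<in> ?P" for ws
    unfolding bilinear_form_def h_def using U.functional_ext_power[OF gram_left[OF that]] d(2)
    by (simp add: functional_times functional_times_right)
  have fM: "functional ?M (\<lambda>t. \<Psi> t ws)" if "ws \<in> ?P" for ws
    unfolding \<Psi>_def by (rule T.functional_tensor_rep[OF bil[OF that]])
  have \<Phi>_wedge: "\<Phi> (wedge l V xs) ws = vol (xs @ ws)" if "xs \<in> power_lists l V" "ws \<in> ?P" for xs ws
    unfolding \<Phi>_def by (rule V.quot_lift_wedge[OF alternating_append_left[OF vol that(2)] that(1)])
  have \<Psi>_pair: "\<Psi> (tensor_pair ?B D (wedge m U us) x) ws = gram \<beta> m us ws * f x"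
    if "us \<in> power_lists m U" "x \<in> carrier D" "ws \<in> ?P" for us x ws
    unfolding \<Psi>_def T.free_lift_tensor_pair[OF bil[OF that(3)] U.wedge_carrier[OF that(1)] that(2)] h_def
    by (simp add: U.quot_lift_wedge[OF gram_left[OF that(3)] that(1)])
  have spanM: "spans ?M ((\<lambda>(x, y). tensor_pair ?B D x y) ` (wedge m U ` power_lists m U \<times> {d}))"
    by (rule T.spans_tensor_pair_basis[OF U.spans_wedge d(1)])
  have altA: "alternating m V (\<Phi> a)" if "a \<in> carrier ?A" for a
  proof (rule V.alternating_on_span[OF V.linear_space_ext_power fA V.spans_wedge _ that])
    fix b assume "b \<in> wedge l V ` power_lists l V"
    then obtain xs where xs: "xs \<in> power_lists l V" "b = wedge l V xs" by auto
    show "alternating m V (\<Phi> b)"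
      by (rule alternating_cong[OF alternating_append_right[OF vol xs(1)] _ V.linear_space_axioms])
        (simp add: xs \<Phi>_wedge)
  qed
  have altM: "alternating m V (\<Psi> t)" if "t \<in> carrier ?M" for t
  proof (rule V.alternating_on_span[OF T.linear_space_tensor_rep fM spanM _ that])
    fix b assume "b \<in> (\<lambda>(x, y). tensor_pair ?B D x y) ` (wedge m U ` power_lists m U \<times> {d})"
    then obtain us where us: "us \<in> power_lists m U" "b = tensor_pair ?B D (wedge m U us) d" by auto
    show "alternating m V (\<Psi> b)"
      by (rule alternating_cong[OF gram_right[OF us(1)] _ V.linear_space_axioms])
        (simp add: us \<Psi>_pair dc d(3))
  qed

  \<comment> \<open>Both sides are indexed by the m-subset C on which the forms are tested; on the
    left it stands for the wedge over the l complementary indices.\<close>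
  let ?I = "{C. C \<subseteq> {..<n} \<and> card C = m}"
  let ?t = "\<lambda>C. map v (sorted_list_of_set C)"
  let ?a = "\<lambda>C. wedge l V (map v (sorted_list_of_set ({..<n} - C)))"
  let ?b = "\<lambda>C. tensor_pair ?B D (wedge m U (map u (sorted_list_of_set C))) d"
  have finI: "finite ?I" by simp
  have t: "?t C \<in> ?P" if "C \<in> ?I" for C
    using that v_carrier by (intro map_sorted_list_power_lists[of n]) auto
  have ut: "map u (sorted_list_of_set C) \<in> power_lists m U" if "C \<in> ?I" for C
    using that u_carrier by (intro map_sorted_list_power_lists[of n]) auto
  have compl: "{..<n} - C \<subseteq> {..<n} \<and> card ({..<n} - C) = l" if "C \<in> ?I" for C
    using that n by (auto simp: card_Diff_subset[OF finite_subset])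
  have at: "map v (sorted_list_of_set ({..<n} - C)) \<in> power_lists l V" if "C \<in> ?I" for C
    using compl[OF that] v_carrier by (intro map_sorted_list_power_lists[of n]) auto
  have compl_image: "{S. S \<subseteq> {..<n} \<and> card S = l} = (\<lambda>C. {..<n} - C) ` ?I"
  proof (intro equalityI subsetI)
    fix S assume S: "S \<in> {S. S \<subseteq> {..<n} \<and> card S = l}"
    then have "S = {..<n} - ({..<n} - S)" "{..<n} - S \<in> ?I"
      using n by (auto simp: card_Diff_subset[OF finite_subset])
    then show "S \<in> (\<lambda>C. {..<n} - C) ` ?I" by blast
  qed (use compl in blast)
  have spanA: "spans ?A (?a ` ?I)"
    using V.spans_wedge_sorted[OF v, of l] unfolding compl_image image_image .
  have spanB: "spans ?M (?b ` ?I)"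
    using T.spans_tensor_pair_basis[OF U.spans_wedge_sorted[OF u, of m] d(1)]
    by (rule back_subst[of "spans ?M"]) auto
  have diagA: "\<Phi> (?a C) (?t C') = 0" if C: "C \<in> ?I" "C' \<in> ?I" "C' \<noteq> C" for C C'
  proof -
    have fin: "finite C" "finite C'" using C by (auto intro: finite_subset)
    \<comment> \<open>Distinct sets of equal size are not nested, so C' meets the complement of C
      and some basis vector occurs twice.\<close>
    have "\<not> C' \<subseteq> C" using C(3) card_subset_eq[OF fin(1)] C(1,2) by auto
    then obtain s where "s \<in> C'" "s \<in> {..<n} - C" using C by auto
    then have "\<not> distinct (map v (sorted_list_of_set ({..<n} - C)) @ ?t C')" using fin by auto
    then show ?thesis
      using vol at[OF C(1)] t[OF C(2)]
      by (simp add: \<Phi>_wedge alternating_def power_lists_def)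
  qed
  have nzA: "\<Phi> (?a C) (?t C) \<noteq> 0" if "C \<in> ?I" for C
  proof -
    have "finite C" using that by (auto intro: finite_subset)
    then have "vol (map v (sorted_list_of_set ({..<n} - C) @ sorted_list_of_set C)) \<noteq> 0"
      using that by (intro vol_permuted_basis) auto
    then show ?thesis using at[OF that] t[OF that] by (simp add: \<Phi>_wedge)
  qed
  have diagB: "\<Psi> (?b C) (?t C') = (if C = C' then 1 else 0)" if "C \<in> ?I" "C' \<in> ?I" for C C'
    using that gram_basis by (simp add: \<Psi>_pair[OF ut[OF that(1)] dc t[OF that(2)]] d(3))
  have ac: "?a C \<in> carrier ?A" if "C \<in> ?I" for C using spanA that by (auto simp: spans_def)
  have bc: "?b C \<in> carrier ?M" if "C \<in> ?I" for C using spanB that by (auto simp: spans_def)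

  show ?thesis
  proof (rule rep_isoI_functionals[where P = ?P and \<Phi> = \<Phi> and \<Psi> = \<Psi>
        and \<tau> = "\<lambda>g. map (act V (\<gamma> g))" and \<rho> = "\<lambda>g. \<kappa> g ^ m * \<theta> g"])
    show "a = \<zero>\<^bsub>?A\<^esub>" if "a \<in> carrier ?A" "\<And>w. w \<in> ?P \<Longrightarrow> \<Phi> a w = 0" for a
      by (rule A.diagonal_inj[OF finI spanA, of "\<lambda>C a. \<Phi> a (?t C)"])
        (use that fA t diagA nzA in auto)
    show "b = \<zero>\<^bsub>?M\<^esub>" if "b \<in> carrier ?M" "\<And>w. w \<in> ?P \<Longrightarrow> \<Psi> b w = 0" for b
      by (rule M.diagonal_inj[OF finI spanB, of "\<lambda>C a. \<Psi> a (?t C)"])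
        (use that fM t diagB in auto)
    show "\<exists>b\<in>carrier ?M. \<forall>w\<in>?P. \<Psi> b w = \<Phi> a w" if a: "a \<in> carrier ?A" for a
    proof -
      have "\<exists>b\<in>carrier ?M. \<forall>C\<in>?I. \<Psi> b (?t C) = \<Phi> a (?t C)"
        by (rule M.diagonal_surj[OF finI, where b = ?b and f = "\<lambda>C a. \<Psi> a (?t C)"])
          (use fM t diagB bc M.subspace_of_carrier in auto)
      then obtain b where b: "b \<in> carrier ?M" "\<And>C. C \<in> ?I \<Longrightarrow> \<Psi> b (?t C) = \<Phi> a (?t C)" by blast
      \<comment> \<open>Values were matched on increasing lists only; both forms are alternating in
        w, which extends the equality to every w.\<close>
      have "\<Psi> b w = \<Phi> a w" if "w \<in> ?P" for w
        by (rule V.alternating_eqI[OF v altM[OF b(1)] altA[OF a] _ that]) (use b(2) in auto)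
      then show ?thesis using b(1) by blast
    qed
    show "\<exists>a\<in>carrier ?A. \<forall>w\<in>?P. \<Phi> a w = \<Psi> b w" if b: "b \<in> carrier ?M" for b
    proof -
      have "\<exists>a\<in>carrier ?A. \<forall>C\<in>?I. \<Phi> a (?t C) = \<Psi> b (?t C)"
        by (rule A.diagonal_surj[OF finI, where b = ?a and f = "\<lambda>C a. \<Phi> a (?t C)"])
          (use fA t diagA nzA ac A.subspace_of_carrier in auto)
      then obtain a where a: "a \<in> carrier ?A" "\<And>C. C \<in> ?I \<Longrightarrow> \<Phi> a (?t C) = \<Psi> b (?t C)" by blast
      have "\<Phi> a w = \<Psi> b w" if "w \<in> ?P" for w
        by (rule V.alternating_eqI[OF v altA[OF a(1)] altM[OF b] _ that]) (use a(2) in auto)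
      then show ?thesis using a(1) by blast
    qed
    show \<tau>: "map (act V (\<gamma> g)) w \<in> ?P" if "w \<in> ?P" for g w
      using that by (rule V.power_lists_map_act)
    fix g w assume g: "g \<in> carrier G" and w: "w \<in> ?P"
    let ?w = "map (act V (\<gamma> g)) w"
    \<comment> \<open>Writing w as the image of \<open>?w\<close> under g lets g be pulled out of
      the whole list at once, producing the determinant on V.\<close>
    have gw: "map (act V g) ?w = w"
      unfolding map_map by (rule map_idI) (use w inverse[OF g] in \<open>auto simp: power_lists_def\<close>)
    show "\<Phi> (act ?A g a) w = (\<kappa> g ^ m * \<theta> g) * \<Phi> a ?w" if a: "a \<in> carrier ?A" for a
    proof (rule A.functional_eq_on_span[OF functional_comp[OF fA[OF w] A.act_linear]
          functional_times[OF fA[OF \<tau>[OF w]]] V.spans_wedge _ a])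
      fix b assume "b \<in> wedge l V ` power_lists l V"
      then obtain xs where xs: "xs \<in> power_lists l V" "b = wedge l V xs" by auto
      have "xs @ ?w \<in> power_lists n V" using xs(1) \<tau>[OF w, of g] n by (auto simp: power_lists_def)
      from vol_map[OF V.act_linear this, of g] det[OF g] gw
      have "vol (map (act V g) xs @ w) = \<kappa> g ^ m * \<theta> g * vol (xs @ ?w)" by simp
      then show "\<Phi> (act ?A g b) w = (\<kappa> g ^ m * \<theta> g) * \<Phi> b ?w"
        using xs w \<tau>[OF w] V.power_lists_map_act[OF xs(1)] by (simp add: V.act_wedge \<Phi>_wedge)
    qed
    show "\<Psi> (act ?M g t) w = (\<kappa> g ^ m * \<theta> g) * \<Psi> t ?w" if t: "t \<in> carrier ?M" for t
    proof (rule M.functional_eq_on_span[OF functional_comp[OF fM[OF w] M.act_linear]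
          functional_times[OF fM[OF \<tau>[OF w]]] spanM _ t])
      fix b assume "b \<in> (\<lambda>(x, y). tensor_pair ?B D x y) ` (wedge m U ` power_lists m U \<times> {d})"
      then obtain us where us: "us \<in> power_lists m U" "b = tensor_pair ?B D (wedge m U us) d" by auto
      \<comment> \<open>Semi-invariance of the pairing trades g on us for its inverse on w, at the
        cost of one factor \<open>\<kappa> g\<close> per row.\<close>
      have "gram \<beta> m (map (act U g) us) w = \<kappa> g ^ m * gram \<beta> m us ?w"
      proof (rule gram_scale)
        fix i j assume ij: "i < m" "j < m"
        then have c: "us ! i \<in> carrier U" "w ! j \<in> carrier V" using us(1) w by (auto simp: power_lists_def)
        show "\<beta> (map (act U g) us ! i) (w ! j) = \<kappa> g * \<beta> (us ! i) (?w ! j)"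
          using \<kappa>[OF g c(1), of "act V (\<gamma> g) (w ! j)"] c inverse[OF g c(2)] ij us(1) w
          by (simp add: power_lists_def)
      qed
      then show "\<Psi> (act ?M g b) w = (\<kappa> g ^ m * \<theta> g) * \<Psi> b ?w"
        using us w \<tau>[OF w] U.power_lists_map_act[OF us(1)] act_f[OF g dc] dc
        by (simp add: T.act_tensor_pair U.wedge_carrier U.act_wedge \<Psi>_pair)
    qed
  qed (use fA fM A.linear_rep_axioms M.linear_rep_axioms in auto)
qed

end

no_notation Matrix.vec_index (infixl \<open>$\<close> 100)
unbundle no fps_syntax

section \<open>The pairing of symmetric powers\<close>

lemma natural_rep_simps [simp]:
  "carrier natural_rep = UNIV" "\<zero>\<^bsub>natural_rep\<^esub> = 0" "x \<oplus>\<^bsub>natural_rep\<^esub> y = x + y"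
  "c \<odot>\<^bsub>natural_rep\<^esub> x = c *s x" "act natural_rep g x = g *v x"
  by (simp_all add: natural_rep_def)

interpretation E: linear_rep "natural_rep :: ('k::field, 'k^2, 'k^2^2) representation"
proof -
  have "linear_space (natural_rep :: ('k, 'k^2, 'k^2^2) representation)"
    by (rule linear_spaceI) (auto simp: algebra_simps vector_add_ldistrib vector_sadd_rdistrib)
  then show "linear_rep (natural_rep :: ('k, 'k^2, 'k^2^2) representation)"
    by (auto simp: linear_rep_def linear_rep_axioms_def linear_between_def
        matrix_vector_right_distrib vector_scalar_commute)
qed

section \<open>The area form and basis words\<close>

definition area_form :: "'k::field^2 \<Rightarrow> 'k^2 \<Rightarrow> 'k" where
  "area_form x y = x $ 1 * y $ 2 - x $ 2 * y $ 1"

lemma area_form_left: "functional natural_rep (\<lambda>x. area_form x y)"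
  and area_form_right: "functional natural_rep (area_form x)"
  by (auto simp: functional_def area_form_def algebra_simps)

text \<open>The origin of every factor det g in the pairing: the area form identifies E with its
  dual twisted by det E.\<close>

lemma area_form_act: "area_form (g *v x) (g *v y) = Determinants.det g * area_form x y"
  by (simp add: area_form_def matrix_vector_mult_def sum_2 det_2 algebra_simps)

text \<open>Booleans index the basis, so that basis tensors become binary words and the orbit of a
  word under S_r is recorded by its number of letters \<open>True\<close>.\<close>

definition unit_vector :: "bool \<Rightarrow> 'k::field^2" where
  "unit_vector b = axis (if b then 1 else 2) 1"

lemma unit_vector_nth [simp]:
  "unit_vector b $ 1 = (if b then 1 else 0)" "unit_vector b $ 2 = (if b then 0 else 1)"
  by (auto simp: unit_vector_def axis_def)

lemma area_form_unit_vector: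
  "area_form (unit_vector b) (unit_vector c) = (if b = c then 0 else if b then 1 else - 1)"
  by (simp add: area_form_def)

lemma spans_unit_vector:
  "spans (natural_rep :: ('k::field, 'k^2, 'k^2^2) representation) (range unit_vector)" (is "spans ?E _")
  unfolding spans_def
proof (intro conjI allI impI subsetI)
  fix Y and x :: "'k^2"
  assume Y: "subspace_of ?E Y" "range unit_vector \<subseteq> Y"
  have "x = x $ 1 *s unit_vector True + x $ 2 *s unit_vector False"
    by (simp add: Finite_Cartesian_Product.vec_eq_iff forall_2)
  also have "\<dots> \<in> Y"
    using E.subspace_ofD(3)[OF Y(1)] E.subspace_ofD(4)[OF Y(1)] subsetD[OF Y(2) rangeI] by simp
  finally show "x \<in> Y" .
qed simp

definition word_list :: "bool list \<Rightarrow> ('k::field^2) list" where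
  "word_list w = map unit_vector w"

lemma word_list_carrier: "length w = r \<Longrightarrow> word_list w \<in> power_lists r natural_rep"
  by (simp add: power_lists_def word_list_def)

lemma word_list_permute: "\<tau> permutes {..<length w} \<Longrightarrow> word_list (permute_list \<tau> w) = permute_list \<tau> (word_list w)"
  by (simp add: word_list_def permute_list_map)

lemma word_lists_image:
  "{xs :: ('k::field^2) list. set xs \<subseteq> range unit_vector \<and> length xs = r} = word_list ` {w. length w = r}"
proof (intro equalityI subsetI)
  fix xs :: "('k^2) list" assume xs: "xs \<in> {xs. set xs \<subseteq> range unit_vector \<and> length xs = r}"
  then have "xs \<in> map unit_vector ` lists UNIV" unfolding lists_image[symmetric] by auto
  with xs show "xs \<in> word_list ` {w. length w = r}" by (auto simp: word_list_def[abs_def])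
qed (auto simp: word_list_def)

definition tensor_form :: "nat \<Rightarrow> ('k::field^2) list \<Rightarrow> ('k^2) list \<Rightarrow> 'k" where
  "tensor_form r xs ys = (\<Prod>i<r. area_form (xs ! i) (ys ! i))"

lemma tensor_form_left: "multilinear r natural_rep (\<lambda>xs. tensor_form r xs ys)"
  unfolding tensor_form_def by (rule multilinear_prod) (rule area_form_left)

lemma tensor_form_right: "multilinear r natural_rep (tensor_form r xs)"
  unfolding tensor_form_def[abs_def] by (rule multilinear_prod) (rule area_form_right)

lemma tensor_form_act:
  "length xs = r \<Longrightarrow> length ys = r \<Longrightarrow>
    tensor_form r (map ((*v) g) xs) (map ((*v) g) ys) = Determinants.det g ^ r * tensor_form r xs ys"
  by (simp add: tensor_form_def area_form_act prod.distrib)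

text \<open>Reindexing the product by \<tau> moves a permutation of one argument to the inverse
  permutation of the other.\<close>

lemma tensor_form_permute:
  assumes \<tau>: "\<tau> permutes {..<r}" and len: "length xs = r" "length ys = r"
  shows "tensor_form r xs (permute_list \<tau> ys) = tensor_form r (permute_list (inv_into UNIV \<tau>) xs) ys"
proof -
  let ?h = "\<lambda>j. area_form (xs ! inv_into UNIV \<tau> j) (ys ! j)"
  have "tensor_form r (permute_list (inv_into UNIV \<tau>) xs) ys = prod ?h {..<r}"
    using len permutes_inv[OF \<tau>] by (auto simp: tensor_form_def permute_list_nth intro!: prod.cong)
  also have "\<dots> = prod (?h \<circ> \<tau>) {..<r}" by (rule prod.permute[OF \<tau>])
  also have "\<dots> = tensor_form r xs (permute_list \<tau> ys)"
    using len \<tau> by (auto simp: tensor_form_def permute_list_nth permutes_inverses intro!: prod.cong)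
  finally show ?thesis ..
qed

text \<open>The area form of two basis vectors is 1 or -1 when they differ and 0 otherwise, so
  negating every letter of a word yields its dual word up to sign.\<close>

lemma tensor_form_word_list:
  assumes "length w = r" "length w' = r"
  shows "tensor_form r (word_list (map Not w')) (word_list w) = 0 \<longleftrightarrow> w \<noteq> w'"
proof -
  have "tensor_form r (word_list (map Not w')) (word_list w) = 0 \<longleftrightarrow> (\<exists>i<r. w ! i \<noteq> w' ! i)"
    using assms by (auto simp: tensor_form_def word_list_def area_form_unit_vector split: if_splits)
  then show ?thesis using assms by (auto simp: list_eq_iff_nth_eq)
qed

section \<open>Pairing tensors with lists of vectors\<close>

definition tensor_pairing ::
    "nat \<Rightarrow> (('k::field^2) list \<Rightarrow>\<^sub>0 'k) set \<Rightarrow> ('k^2) list \<Rightarrow> 'k" where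
  "tensor_pairing r t ys = free_lift (\<lambda>xs. tensor_form r xs ys) t"

abbreviation (input) tensor_natural ::
    "nat \<Rightarrow> ('k::field, (('k^2) list \<Rightarrow>\<^sub>0 'k) set, 'k^2^2) representation" where
  "tensor_natural r \<equiv> tensor_power r natural_rep"

lemma functional_tensor_pairing: "functional (tensor_natural r) (\<lambda>t. tensor_pairing r t ys)"
  unfolding tensor_pairing_def by (rule E.functional_tensor_power[OF tensor_form_left])

lemma tensor_pairing_pure:
  "xs \<in> power_lists r natural_rep \<Longrightarrow>
    tensor_pairing r (pure_tensor r natural_rep xs) ys = tensor_form r xs ys"
  unfolding tensor_pairing_def by (rule E.free_lift_pure_tensor[OF tensor_form_left])

lemma multilinear_tensor_pairing:
  fixes t :: "(('k::field^2) list \<Rightarrow>\<^sub>0 'k) set"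
  assumes "t \<in> carrier (tensor_natural r)"
  shows "multilinear r natural_rep (tensor_pairing r t)"
proof (rule E.multilinear_on_span[OF E.linear_space_tensor_power functional_tensor_pairing
      E.spans_pure_tensor _ assms])
  fix b :: "(('k^2) list \<Rightarrow>\<^sub>0 'k) set"
  assume "b \<in> pure_tensor r natural_rep ` power_lists r natural_rep"
  then obtain xs where xs: "xs \<in> power_lists r natural_rep" "b = pure_tensor r natural_rep xs" by auto
  then have "tensor_pairing r b = tensor_form r xs" by (auto simp: tensor_pairing_pure)
  then show "multilinear r natural_rep (tensor_pairing r b)" using tensor_form_right by simp
qed

lemma tensor_pairing_act:
  fixes t :: "(('k::field^2) list \<Rightarrow>\<^sub>0 'k) set"
  assumes t: "t \<in> carrier (tensor_natural r)" and ys: "length ys = r"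
  shows "tensor_pairing r (act (tensor_natural r) g t) (map ((*v) g) ys)
    = Determinants.det g ^ r * tensor_pairing r t ys"
proof (rule linear_space.functional_eq_on_span[OF E.linear_space_tensor_power
      functional_comp[OF functional_tensor_pairing E.tensor_act_linear]
      functional_times[OF functional_tensor_pairing] E.spans_pure_tensor _ t])
  fix b :: "(('k^2) list \<Rightarrow>\<^sub>0 'k) set"
  assume "b \<in> pure_tensor r natural_rep ` power_lists r natural_rep"
  then obtain xs where xs: "xs \<in> power_lists r natural_rep" "b = pure_tensor r natural_rep xs" by auto
  then show "tensor_pairing r (act (tensor_natural r) g b) (map ((*v) g) ys)
      = Determinants.det g ^ r * tensor_pairing r b ys"
    using E.power_lists_map_act[OF xs(1), of g] ys
    by (simp add: E.act_pure_tensor tensor_pairing_pure natural_rep_simps(5)[abs_def] tensor_form_act power_lists_def)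
qed

lemma tensor_pairing_permute:
  fixes t :: "(('k::field^2) list \<Rightarrow>\<^sub>0 'k) set"
  assumes \<tau>: "\<tau> permutes {..<r}" and t: "t \<in> carrier (tensor_natural r)" and ys: "length ys = r"
  shows "tensor_pairing r (place_perm r natural_rep \<tau> t) ys
    = tensor_pairing r t (permute_list (inv_into UNIV \<tau>) ys)"
proof (rule linear_space.functional_eq_on_span[OF E.linear_space_tensor_power
      functional_comp[OF functional_tensor_pairing E.place_perm_linear[OF \<tau>]]
      functional_tensor_pairing E.spans_pure_tensor _ t])
  fix b :: "(('k^2) list \<Rightarrow>\<^sub>0 'k) set"
  assume "b \<in> pure_tensor r natural_rep ` power_lists r natural_rep"
  then obtain xs where xs: "xs \<in> power_lists r natural_rep" "b = pure_tensor r natural_rep xs" by auto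
  have "inv_into UNIV (inv_into UNIV \<tau>) = \<tau>" using \<tau> by (rule permutes_inv_inv)
  then have "tensor_form r (permute_list \<tau> xs) ys = tensor_form r xs (permute_list (inv_into UNIV \<tau>) ys)"
    using tensor_form_permute[OF permutes_inv[OF \<tau>], of xs ys] xs(1) ys by (simp add: power_lists_def)
  then show "tensor_pairing r (place_perm r natural_rep \<tau> b) ys
      = tensor_pairing r b (permute_list (inv_into UNIV \<tau>) ys)"
    using xs permute_list_power_lists[OF \<tau> xs(1)]
    by (simp add: E.place_perm_pure_tensor[OF \<tau>] tensor_pairing_pure)
qed

lemma finite_words: "finite {w :: bool list. length w = r}"
  using finite_lists_length_eq[of "UNIV :: bool set" r] by simp

lemma words_map_Not: "map Not ` {w. length w = r} = {w. length w = r}"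
proof (intro equalityI subsetI)
  fix w :: "bool list" assume "w \<in> {w. length w = r}"
  then show "w \<in> map Not ` {w. length w = r}"
    by (intro image_eqI[of _ _ "map Not w"]) (auto simp: comp_def)
qed auto

lemma spans_tensor_words:
  "spans (tensor_natural r)
    ((\<lambda>w. pure_tensor r natural_rep (word_list (map Not w)) :: (('k::field^2) list \<Rightarrow>\<^sub>0 'k) set) ` {w. length w = r})"
proof -
  have "(\<lambda>w. pure_tensor r natural_rep (word_list (map Not w)) :: (('k^2) list \<Rightarrow>\<^sub>0 'k) set) ` {w. length w = r}
    = pure_tensor r natural_rep ` word_list ` map Not ` {w. length w = r}"
    by (simp add: image_image)
  then show ?thesis
    using E.spans_pure_tensor_basis[OF spans_unit_vector, of r]
    unfolding words_map_Not word_lists_image by simp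
qed

lemma tensor_pairing_words:
  "length w = r \<Longrightarrow> length w' = r \<Longrightarrow>
    tensor_pairing r (pure_tensor r natural_rep (word_list (map Not w'))) (word_list w) = 0 \<longleftrightarrow> w \<noteq> w'"
  by (simp add: tensor_pairing_pure word_list_carrier tensor_form_word_list)

lemma tensor_pairing_nondegenerate:
  fixes t :: "(('k::field^2) list \<Rightarrow>\<^sub>0 'k) set"
  assumes t: "t \<in> carrier (tensor_natural r)" and "\<And>w. length w = r \<Longrightarrow> tensor_pairing r t (word_list w) = 0"
  shows "t = \<zero>\<^bsub>tensor_natural r\<^esub>"
  by (rule linear_space.diagonal_inj[OF E.linear_space_tensor_power finite_words spans_tensor_words,
        where f = "\<lambda>w t. tensor_pairing r t (word_list w)"])
    (use assms in \<open>auto simp: tensor_pairing_words functional_tensor_pairing\<close>)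

lemma tensor_pairing_inj:
  fixes t :: "(('k::field^2) list \<Rightarrow>\<^sub>0 'k) set"
  assumes t: "t \<in> carrier (tensor_natural r)" "t' \<in> carrier (tensor_natural r)"
    and eq: "\<And>w. length w = r \<Longrightarrow> tensor_pairing r t (word_list w) = tensor_pairing r t' (word_list w)"
  shows "t = t'"
proof -
  interpret T: linear_space "tensor_natural r" by (rule E.linear_space_tensor_power)
  have "t \<ominus>\<^bsub>tensor_natural r\<^esub> t' = \<zero>\<^bsub>tensor_natural r\<^esub>"
    using t eq by (intro tensor_pairing_nondegenerate) (auto simp: T.functional_minus[OF functional_tensor_pairing])
  moreover have "t = (t \<ominus>\<^bsub>tensor_natural r\<^esub> t') \<oplus>\<^bsub>tensor_natural r\<^esub> t'"
    using t by (simp add: a_minus_def T.M.a_assoc T.M.l_neg)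
  ultimately show ?thesis using t by simp
qed

text \<open>The pure tensors of negated words are in diagonal position against evaluation on words.
  Symmetric tensors are later constructed by prescribing their values in this way.\<close>

lemma tensor_pairing_surj:
  "\<exists>t\<in>carrier (tensor_natural r). \<forall>w\<in>{w. length w = r}. tensor_pairing r t (word_list w) = c w"
  by (rule linear_space.diagonal_surj[OF E.linear_space_tensor_power finite_words,
        where b = "\<lambda>w. pure_tensor r natural_rep (word_list (map Not w))"
          and f = "\<lambda>w t. tensor_pairing r t (word_list w)"])
    (auto simp: tensor_pairing_words functional_tensor_pairing word_list_carrier
      intro: E.pure_tensor_carrier linear_space.subspace_of_carrier[OF E.linear_space_tensor_power])

section \<open>Orbits of binary words\<close>

definition sorted_word :: "nat \<Rightarrow> nat \<Rightarrow> bool list" where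
  "sorted_word r a = replicate a True @ replicate (r - a) False"

lemma length_sorted_word [simp]: "a \<le> r \<Longrightarrow> length (sorted_word r a) = r"
  by (simp add: sorted_word_def)

lemma count_sorted_word [simp]: "count_list (sorted_word r a) True = a"
proof -
  have "count_list (replicate k x) y = (if x = y then k else 0)" for k and x y :: bool
    by (induction k) auto
  then show ?thesis by (simp add: sorted_word_def)
qed

lemma mset_sorted_word: "mset w = mset (sorted_word (length w) (count_list w True))"
proof (induction w)
  case (Cons b w)
  have "count_list w True \<le> length w" by (rule count_le_length)
  with Cons show ?case by (auto simp: sorted_word_def Suc_diff_le)
qed (simp add: sorted_word_def)

lemma word_is_permuted_sorted:
  obtains \<tau> where "\<tau> permutes {..<length w}" "permute_list \<tau> (sorted_word (length w) (count_list w True)) = w"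
  using mset_eq_permutation[OF mset_sorted_word[of w]] count_le_length[of w True]
  by (metis length_sorted_word)

section \<open>Pairing invariants with coinvariants\<close>

lemma sym_invariants_simps:
  "carrier (sym_invariants r V) =
    {w \<in> carrier (tensor_power r V). \<forall>\<tau>. \<tau> permutes {..<r} \<longrightarrow> place_perm r V \<tau> w = w}"
  "\<zero>\<^bsub>sym_invariants r V\<^esub> = \<zero>\<^bsub>tensor_power r V\<^esub>"
  "x \<oplus>\<^bsub>sym_invariants r V\<^esub> y = x \<oplus>\<^bsub>tensor_power r V\<^esub> y"
  "c \<odot>\<^bsub>sym_invariants r V\<^esub> x = c \<odot>\<^bsub>tensor_power r V\<^esub> x"
  "act (sym_invariants r V) = act (tensor_power r V)"
  by (simp_all add: sym_invariants_def)

abbreviation (input) invariants ::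
    "nat \<Rightarrow> ('k::field, (('k^2) list \<Rightarrow>\<^sub>0 'k) set, 'k^2^2) representation" where
  "invariants r \<equiv> sym_invariants r natural_rep"

abbreviation (input) coinvariants ::
    "nat \<Rightarrow> ('k::field, (('k^2) list \<Rightarrow>\<^sub>0 'k) set set, 'k^2^2) representation" where
  "coinvariants r \<equiv> sym_coinvariants r natural_rep"

lemma linear_space_coinvariants: "linear_space (coinvariants r)"
  using E.linear_rep_sym_coinvariants by (rule linear_rep.axioms)

text \<open>A permutation of the list moves to t as a place permutation, which fixes the invariant
  t. This is why pairing with t descends to the coinvariants.\<close>

lemma symmetric_tensor_pairing:
  fixes t :: "(('k::field^2) list \<Rightarrow>\<^sub>0 'k) set"
  assumes t: "t \<in> carrier (invariants r)"
  shows "symmetric r natural_rep (tensor_pairing r t)"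
  unfolding symmetric_def
proof (intro allI ballI impI)
  fix \<tau> and ys :: "('k^2) list"
  assume ys: "ys \<in> power_lists r natural_rep" and \<tau>: "\<tau> permutes {..<r}"
  have inv: "inv_into UNIV \<tau> permutes {..<r}" "inv_into UNIV (inv_into UNIV \<tau>) = \<tau>"
    using \<tau> by (simp_all add: permutes_inv permutes_inv_inv)
  have "tensor_pairing r (place_perm r natural_rep (inv_into UNIV \<tau>) t) ys
      = tensor_pairing r t (permute_list \<tau> ys)"
    using tensor_pairing_permute[OF inv(1), of t ys] t ys inv(2)
    by (simp add: sym_invariants_simps power_lists_def)
  then show "tensor_pairing r t (permute_list \<tau> ys) = tensor_pairing r t ys"
    using t inv(1) by (simp add: sym_invariants_simps)
qed

lemma multilinear_tensor_pairing_invariants: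
  "t \<in> carrier (invariants r) \<Longrightarrow> multilinear r natural_rep (tensor_pairing r t)"
  by (intro multilinear_tensor_pairing) (simp add: sym_invariants_simps)

definition sym_pairing ::
    "nat \<Rightarrow> (('k::field^2) list \<Rightarrow>\<^sub>0 'k) set \<Rightarrow> (('k^2) list \<Rightarrow>\<^sub>0 'k) set set \<Rightarrow> 'k" where
  "sym_pairing r t c = quot_lift (tensor_pairing r t) c"

lemma functional_sym_pairing:
  "t \<in> carrier (invariants r) \<Longrightarrow> functional (coinvariants r) (sym_pairing r t)"
  unfolding sym_pairing_def[abs_def]
  by (rule E.functional_sym_coinvariants[OF multilinear_tensor_pairing_invariants symmetric_tensor_pairing])

lemma sym_pairing_class:
  "t \<in> carrier (invariants r) \<Longrightarrow> ys \<in> power_lists r natural_rep \<Longrightarrow>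
    sym_pairing r t (sym_class r natural_rep ys) = tensor_pairing r t ys"
  unfolding sym_pairing_def
  by (rule E.quot_lift_sym_class[OF multilinear_tensor_pairing_invariants symmetric_tensor_pairing])

lemma spans_coinvariants: "spans (coinvariants r) (sym_class r natural_rep ` word_list ` {w. length w = r})"
  using E.spans_sym_class_basis[OF spans_unit_vector] unfolding word_lists_image .

text \<open>Linearity in the coinvariant comes with the descended functional. Linearity in t is
  verified on spanning classes, because a separate functional is descended for each t.\<close>

lemma bilinear_sym_pairing:
  "bilinear_form (invariants r) (coinvariants r) (sym_pairing r :: _ \<Rightarrow> _ \<Rightarrow> 'k::field)"
  unfolding bilinear_form_def
proof (intro conjI ballI functional_sym_pairing)
  interpret U: linear_rep "sym_invariants r natural_rep :: ('k, (('k^2) list \<Rightarrow>\<^sub>0 'k) set, 'k^2^2) representation"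
    by (rule E.linear_rep_sym_invariants)
  fix c :: "(('k^2) list \<Rightarrow>\<^sub>0 'k) set set" assume c: "c \<in> carrier (coinvariants r)"
  show "functional (invariants r) (\<lambda>t. sym_pairing r t c)"
    unfolding functional_def
  proof (intro conjI ballI allI)
    fix x :: "(('k^2) list \<Rightarrow>\<^sub>0 'k) set" assume x: "x \<in> carrier (invariants r)"
    show "sym_pairing r (x \<oplus>\<^bsub>invariants r\<^esub> y) c = sym_pairing r x c + sym_pairing r y c"
      if y: "y \<in> carrier (invariants r)" for y :: "(('k^2) list \<Rightarrow>\<^sub>0 'k) set"
    proof (rule linear_space.functional_eq_on_span[OF linear_space_coinvariants
          functional_sym_pairing[OF U.a_closed[OF x y]]
          functional_plus[OF functional_sym_pairing[OF x] functional_sym_pairing[OF y]]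
          spans_coinvariants _ c])
      fix s :: "(('k^2) list \<Rightarrow>\<^sub>0 'k) set set" assume "s \<in> sym_class r natural_rep ` word_list ` {w. length w = r} "
      then obtain w where w: "s = sym_class r natural_rep (word_list w)" "length w = r" by auto
      have "tensor_pairing r (x \<oplus>\<^bsub>invariants r\<^esub> y) (word_list w)
          = tensor_pairing r x (word_list w) + tensor_pairing r y (word_list w)"
        using x y by (simp add: sym_invariants_simps functional_add[OF functional_tensor_pairing])
      then show "sym_pairing r (x \<oplus>\<^bsub>invariants r\<^esub> y) s = sym_pairing r x s + sym_pairing r y s"
        unfolding w(1) using x y w(2) by (simp add: sym_pairing_class word_list_carrier)
    qed
    show "sym_pairing r (a \<odot>\<^bsub>invariants r\<^esub> x) c = a * sym_pairing r x c" for a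
    proof (rule linear_space.functional_eq_on_span[OF linear_space_coinvariants
          functional_sym_pairing[OF U.smult_in[OF x]]
          functional_times[OF functional_sym_pairing[OF x]]
          spans_coinvariants _ c])
      fix s :: "(('k^2) list \<Rightarrow>\<^sub>0 'k) set set" assume "s \<in> sym_class r natural_rep ` word_list ` {w. length w = r} "
      then obtain w where w: "s = sym_class r natural_rep (word_list w)" "length w = r" by auto
      have "tensor_pairing r (a \<odot>\<^bsub>invariants r\<^esub> x) (word_list w) = a * tensor_pairing r x (word_list w)"
        using x by (simp add: sym_invariants_simps functional_smult[OF functional_tensor_pairing])
      then show "sym_pairing r (a \<odot>\<^bsub>invariants r\<^esub> x) s = a * sym_pairing r x s"
        unfolding w(1) using x w(2) by (simp add: sym_pairing_class word_list_carrier)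
    qed
  qed
qed

lemma length_word_list: "length (word_list w) = length w"
  by (simp add: word_list_def)

lemma count_list_permute:
  "\<tau> permutes {..<length w} \<Longrightarrow> count_list (permute_list \<tau> w) x = count_list w x"
  by (metis count_mset mset_permute_list)

text \<open>Up to sign, t is the sum of the S_r-orbit of basis words with r - a letters
  \<open>True\<close> (for a at most r), obtained without dividing by the order of a stabilizer. It
  is invariant because the prescribed values depend on the letter count only and determine the
  tensor.\<close>

lemma invariant_with_pairing:
  "\<exists>t\<in>carrier (invariants r :: ('k::field, _, _) representation). \<forall>w. length w = r \<longrightarrow>
    tensor_pairing r t (word_list w) = (if count_list w True = a then 1 else 0)"
proof -
  obtain t :: "(('k^2) list \<Rightarrow>\<^sub>0 'k) set" where t: "t \<in> carrier (tensor_natural r)"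
      and val: "\<And>w. length w = r \<Longrightarrow> tensor_pairing r t (word_list w) = (if count_list w True = a then 1 else 0)"
    using tensor_pairing_surj[of r "\<lambda>w. if count_list w True = a then 1 else 0"] by auto
  have "place_perm r natural_rep \<tau> t = t" if \<tau>: "\<tau> permutes {..<r}" for \<tau>
  proof (rule tensor_pairing_inj[OF linear_betweenD(1)[OF E.place_perm_linear[OF \<tau>] t] t])
    fix w :: "bool list" assume w: "length w = r"
    have inv: "inv_into UNIV \<tau> permutes {..<length w}" using permutes_inv[OF \<tau>] w by simp
    show "tensor_pairing r (place_perm r natural_rep \<tau> t) (word_list w) = tensor_pairing r t (word_list w)"
      using tensor_pairing_permute[OF \<tau> t, of "word_list w"] w val count_list_permute[OF inv]
      by (simp add: length_word_list flip: word_list_permute[OF inv])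
  qed
  with t val show ?thesis by (auto simp: sym_invariants_simps)
qed

section \<open>Monomials and the dual basis of invariants\<close>

definition monomial_class :: "nat \<Rightarrow> nat \<Rightarrow> (('k::field^2) list \<Rightarrow>\<^sub>0 'k) set set" where
  "monomial_class r a = sym_class r natural_rep (word_list (sorted_word r a))"

lemma sym_class_word:
  assumes "length w = r"
  shows "(sym_class r natural_rep (word_list w) :: (('k::field^2) list \<Rightarrow>\<^sub>0 'k) set set)
    = monomial_class r (count_list w True)"
proof -
  obtain \<tau> where \<tau>: "\<tau> permutes {..<length w}" "permute_list \<tau> (sorted_word (length w) (count_list w True)) = w"
    by (rule word_is_permuted_sorted)
  have le: "count_list w True \<le> r" using count_le_length[of w] assms by simp
  have "(word_list w :: ('k^2) list) = permute_list \<tau> (word_list (sorted_word r (count_list w True)))"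
    using word_list_permute[of \<tau> "sorted_word r (count_list w True)"] \<tau> assms le by simp
  then show ?thesis
    unfolding monomial_class_def
    using E.sym_class_permute[of \<tau> r "word_list (sorted_word r (count_list w True)) :: ('k^2) list"] \<tau>(1) assms le
    by (simp add: word_list_carrier)
qed

lemma monomial_class_carrier: "a \<le> r \<Longrightarrow> monomial_class r a \<in> carrier (coinvariants r)"
  unfolding monomial_class_def by (intro E.sym_class_carrier word_list_carrier) simp

lemma spans_monomial_class:
  "spans (coinvariants r) (monomial_class r ` {..<Suc r} :: (('k::field^2) list \<Rightarrow>\<^sub>0 'k) set set set)"
proof (rule spans_trans[OF spans_coinvariants])
  fix Y :: "(('k^2) list \<Rightarrow>\<^sub>0 'k) set set set" and c :: "(('k^2) list \<Rightarrow>\<^sub>0 'k) set set"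
  assume Y: "monomial_class r ` {..<Suc r} \<subseteq> Y"
    and "c \<in> sym_class r natural_rep ` word_list ` {w. length w = r}"
  then obtain w where w: "c = sym_class r natural_rep (word_list w)" "length w = r" by auto
  then have "c = monomial_class r (count_list w True)" "count_list w True < Suc r"
    using sym_class_word count_le_length[of w True] by auto
  then show "c \<in> Y" using Y by auto
qed (auto simp: monomial_class_carrier)

lemma sym_pairing_monomial:
  assumes "t \<in> carrier (invariants r)" "a \<le> r"
  shows "sym_pairing r t (monomial_class r a) = tensor_pairing r t (word_list (sorted_word r a))"
  unfolding monomial_class_def using assms by (simp add: sym_pairing_class word_list_carrier)

lemma sym_pairing_word:
  assumes "t \<in> carrier (invariants r)" "length w = r"
  shows "tensor_pairing r t (word_list w) = sym_pairing r t (monomial_class r (count_list w True))"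
  by (simp add: assms sym_pairing_class word_list_carrier flip: sym_class_word[OF assms(2)])

lemma sym_dual_bases:
  obtains u where "dual_bases (invariants r :: ('k::field, _, _) representation) (coinvariants r)
    (sym_pairing r) (Suc r) u (monomial_class r)"
proof -
  interpret U: linear_rep "sym_invariants r natural_rep :: ('k, (('k^2) list \<Rightarrow>\<^sub>0 'k) set, 'k^2^2) representation"
    by (rule E.linear_rep_sym_invariants)
  interpret V: linear_rep "sym_coinvariants r natural_rep :: ('k, (('k^2) list \<Rightarrow>\<^sub>0 'k) set set, 'k^2^2) representation"
    by (rule E.linear_rep_sym_coinvariants)
  have "\<forall>a. \<exists>t\<in>carrier (invariants r :: ('k, _, _) representation). \<forall>w. length w = r \<longrightarrow>
      tensor_pairing r t (word_list w) = (if count_list w True = a then 1 else 0)"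
    by (intro allI invariant_with_pairing)
  then have "\<exists>u. \<forall>a. u a \<in> carrier (invariants r :: ('k, _, _) representation) \<and> (\<forall>w. length w = r \<longrightarrow>
      tensor_pairing r (u a) (word_list w) = (if count_list w True = a then 1 else 0))"
    unfolding Bex_def by (rule choice)
  then obtain u where u: "\<And>a. u a \<in> carrier (invariants r :: ('k, _, _) representation)"
      "\<And>a w. length w = r \<Longrightarrow> tensor_pairing r (u a) (word_list w) = (if count_list w True = a then 1 else 0)"
    by blast
  have dual: "sym_pairing r (u a) (monomial_class r b) = (if a = b then 1 else 0)" if "b < Suc r" for a b
    using that u by (auto simp: sym_pairing_monomial)
  have left: "functional (invariants r) (\<lambda>t. sym_pairing r t (monomial_class r a :: (('k^2) list \<Rightarrow>\<^sub>0 'k) set set))"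
    if "a < Suc r" for a
    by (rule bspec[OF conjunct1[OF bilinear_sym_pairing[unfolded bilinear_form_def]] monomial_class_carrier])
      (use that in simp)
  \<comment> \<open>The class of every word is a monomial class, so an invariant that pairs to zero
    with all monomials pairs to zero with all words and vanishes. Separation then gives
    spanning.\<close>
  have span: "spans (invariants r) (u ` {..<Suc r})"
  proof (rule U.separating_imp_spans[where f = "\<lambda>a t. sym_pairing r t (monomial_class r a)"])
    fix t :: "(('k^2) list \<Rightarrow>\<^sub>0 'k) set"
    assume t: "t \<in> carrier (invariants r)"
      and zero: "\<And>s. s \<in> {..<Suc r} \<Longrightarrow> sym_pairing r t (monomial_class r s) = 0"
    have "tensor_pairing r t (word_list w) = 0" if "length w = r" for w
      using sym_pairing_word[OF t that] zero count_le_length[of w True] that by auto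
    then show "t = \<zero>\<^bsub>invariants r\<^esub>"
      using tensor_pairing_nondegenerate[of t r] t by (simp add: sym_invariants_simps)
  qed (use u left dual in auto)
  show thesis
  proof (rule that, unfold_locales)
    show "bilinear_form (invariants r) (coinvariants r) (sym_pairing r :: _ \<Rightarrow> _ \<Rightarrow> 'k)"
      by (rule bilinear_sym_pairing)
    show "spans (invariants r) (u ` {..<Suc r})" by (rule span)
  qed (auto simp: spans_monomial_class dual)
qed

section \<open>The pairing and the action of matrices\<close>

lemma sym_pairing_act:
  fixes t :: "(('k::field^2) list \<Rightarrow>\<^sub>0 'k) set"
  assumes t: "t \<in> carrier (invariants r)" and c: "c \<in> carrier (coinvariants r)"
  shows "sym_pairing r (act (invariants r) g t) (act (coinvariants r) g c)
    = Determinants.det g ^ r * sym_pairing r t c"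
proof -
  interpret U: linear_rep "sym_invariants r natural_rep :: ('k, (('k^2) list \<Rightarrow>\<^sub>0 'k) set, 'k^2^2) representation"
    by (rule E.linear_rep_sym_invariants)
  interpret V: linear_rep "sym_coinvariants r natural_rep :: ('k, (('k^2) list \<Rightarrow>\<^sub>0 'k) set set, 'k^2^2) representation"
    by (rule E.linear_rep_sym_coinvariants)
  have gt: "act (invariants r) g t \<in> carrier (invariants r)" using t by (rule U.act_closed)
  show ?thesis
  proof (rule V.functional_eq_on_span[OF functional_comp[OF functional_sym_pairing[OF gt] V.act_linear]
        functional_times[OF functional_sym_pairing[OF t]] spans_coinvariants _ c])
    fix s :: "(('k^2) list \<Rightarrow>\<^sub>0 'k) set set"
    assume "s \<in> sym_class r natural_rep ` word_list ` {w. length w = r}"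
    then obtain w where w: "s = sym_class r natural_rep (word_list w)" "length w = r" by auto
    have wl: "word_list w \<in> power_lists r (natural_rep :: ('k, _, _) representation)"
      using w(2) by (rule word_list_carrier)
    have tT: "t \<in> carrier (tensor_natural r)" using t by (simp add: sym_invariants_simps)
    have len: "length (word_list w :: ('k^2) list) = r" using w(2) by (simp add: length_word_list)
    show "sym_pairing r (act (invariants r) g t) (act (coinvariants r) g s) = Determinants.det g ^ r * sym_pairing r t s"
      using tensor_pairing_act[OF tT len, of g] E.power_lists_map_act[OF wl, of g]
      unfolding w(1) E.act_sym_class[OF wl] sym_pairing_class[OF t wl]
      by (simp add: sym_pairing_class[OF gt, unfolded sym_invariants_simps(5)] sym_invariants_simps(5) natural_rep_simps(5)[abs_def])
  qed
qed

text \<open>The group law on Sym^r E; it yields the multiplicativity of the determinant and the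
  cancellation of g against its inverse.\<close>

lemma act_coinvariants_mult:
  fixes c :: "(('k::field^2) list \<Rightarrow>\<^sub>0 'k) set set"
  assumes c: "c \<in> carrier (coinvariants r)"
  shows "act (coinvariants r) (g ** h) c = act (coinvariants r) g (act (coinvariants r) h c)"
proof -
  interpret V: linear_rep "sym_coinvariants r natural_rep :: ('k, (('k^2) list \<Rightarrow>\<^sub>0 'k) set set, 'k^2^2) representation"
    by (rule E.linear_rep_sym_coinvariants)
  show ?thesis
  proof (rule V.linear_between_eq_on_span[OF V.act_linear linear_between_comp[OF V.act_linear V.act_linear]
        V.linear_space_axioms spans_coinvariants _ c])
    fix s :: "(('k^2) list \<Rightarrow>\<^sub>0 'k) set set"
    assume "s \<in> sym_class r natural_rep ` word_list ` {w. length w = r}"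
    then obtain w where w: "s = sym_class r natural_rep (word_list w)" "length w = r" by auto
    have wl: "word_list w \<in> power_lists r (natural_rep :: ('k, _, _) representation)"
      using w(2) by (rule word_list_carrier)
    show "act (coinvariants r) (g ** h) s = act (coinvariants r) g (act (coinvariants r) h s)"
      unfolding w(1) E.act_sym_class[OF wl] E.act_sym_class[OF E.power_lists_map_act[OF wl]] map_map
      by (simp add: natural_rep_simps(5)[abs_def] comp_def matrix_vector_mul_assoc)
  qed
qed

lemma act_coinvariants_one:
  fixes c :: "(('k::field^2) list \<Rightarrow>\<^sub>0 'k) set set"
  assumes c: "c \<in> carrier (coinvariants r)"
  shows "act (coinvariants r) (Finite_Cartesian_Product.mat 1) c = c"
proof -
  interpret V: linear_rep "sym_coinvariants r natural_rep :: ('k, (('k^2) list \<Rightarrow>\<^sub>0 'k) set set, 'k^2^2) representation"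
    by (rule E.linear_rep_sym_coinvariants)
  have id: "linear_between (coinvariants r) (coinvariants r) (\<lambda>c :: (('k^2) list \<Rightarrow>\<^sub>0 'k) set set. c)"
    by (simp add: linear_between_def)
  show ?thesis
  proof (rule V.linear_between_eq_on_span[OF V.act_linear id V.linear_space_axioms spans_coinvariants _ c])
    fix s :: "(('k^2) list \<Rightarrow>\<^sub>0 'k) set set"
    assume "s \<in> sym_class r natural_rep ` word_list ` {w. length w = r}"
    then obtain w where w: "s = sym_class r natural_rep (word_list w)" "length w = r" by auto
    have wl: "word_list w \<in> power_lists r (natural_rep :: ('k, _, _) representation)"
      using w(2) by (rule word_list_carrier)
    have "map (act natural_rep (Finite_Cartesian_Product.mat 1)) (word_list w) = (word_list w :: ('k^2) list)"
      by (rule map_idI) simp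
    then show "act (coinvariants r) (Finite_Cartesian_Product.mat 1) s = s"
      unfolding w(1) E.act_sym_class[OF wl] by simp
  qed
qed

section \<open>The determinant of a symmetric power\<close>

text \<open>Dehomogenization: the vector is read as x1 X + x2 Y with Y set to 1, so that forms of
  degree r become polynomials of degree at most r.\<close>

definition linear_poly :: "'k::field^2 \<Rightarrow> 'k poly" where
  "linear_poly x = [:x $ 2, x $ 1:]"

lemma linear_poly_add: "linear_poly (x + y) = linear_poly x + linear_poly y"
  and linear_poly_smult: "linear_poly (c *s x) = Polynomial.smult c (linear_poly x)"
  by (simp_all add: linear_poly_def)

lemma multilinear_coeff_prod:
  "multilinear r natural_rep (\<lambda>xs. poly.coeff (prod_list (map linear_poly xs)) a)"
proof -
  have "prod_list (map linear_poly (xs[i := x])) =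
      prod_list (map linear_poly (take i xs)) * linear_poly x * prod_list (map linear_poly (drop (Suc i) xs))"
    if "i < length xs" for xs :: "('a^2) list" and i x
    unfolding upd_conv_take_nth_drop[OF that] by (simp add: mult.assoc)
  then show ?thesis
    by (auto simp: multilinear_def power_lists_def linear_poly_add linear_poly_smult algebra_simps)
qed

lemma symmetric_coeff_prod:
  "symmetric r natural_rep (\<lambda>xs. poly.coeff (prod_list (map linear_poly xs)) a)"
proof -
  have "prod_list (map linear_poly (permute_list \<tau> xs)) = prod_list (map linear_poly xs)"
    if "\<tau> permutes {..<length xs}" for \<tau> and xs :: "('a^2) list"
    by (metis mset_map mset_permute_list prod_mset_prod_list that)
  then show ?thesis by (simp add: symmetric_def power_lists_def)
qed

text \<open>The coordinate at X^a Y^(r-a), obtained by multiplying linear forms. In contrast to the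
  pairing with a chosen dual basis it can be computed on images under g.\<close>

definition coefficient :: "nat \<Rightarrow> (('k::field^2) list \<Rightarrow>\<^sub>0 'k) set set \<Rightarrow> 'k" where
  "coefficient a = quot_lift (\<lambda>xs. poly.coeff (prod_list (map linear_poly xs)) a)"

lemma functional_coefficient: "functional (coinvariants r) (coefficient a)"
  unfolding coefficient_def
  by (rule E.functional_sym_coinvariants[OF multilinear_coeff_prod symmetric_coeff_prod])

lemma coefficient_class:
  "xs \<in> power_lists r natural_rep \<Longrightarrow>
    coefficient a (sym_class r natural_rep xs) = poly.coeff (prod_list (map linear_poly xs)) a"
  unfolding coefficient_def
  by (rule E.quot_lift_sym_class[OF multilinear_coeff_prod symmetric_coeff_prod])

text \<open>The two linear polynomials encode the columns of g, the images of X and Y.\<close>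

lemma coefficient_act_monomial_class:
  assumes "b \<le> r"
  shows "coefficient a (act (coinvariants r) g (monomial_class r b)) =
    poly.coeff ([:g $ 2 $ 1, g $ 1 $ 1:] ^ b * [:g $ 2 $ 2, g $ 1 $ 2:] ^ (r - b)) a"
proof -
  have wl: "word_list (sorted_word r b) \<in> power_lists r natural_rep"
    using assms by (intro word_list_carrier) simp
  have col: "linear_poly (g *v unit_vector True) = [:g $ 2 $ 1, g $ 1 $ 1:]"
      "linear_poly (g *v unit_vector False) = [:g $ 2 $ 2, g $ 1 $ 2:]"
    by (simp_all add: linear_poly_def matrix_vector_mult_def sum_2)
  show ?thesis
    unfolding monomial_class_def E.act_sym_class[OF wl] coefficient_class[OF E.power_lists_map_act[OF wl]]
    by (simp add: word_list_def sorted_word_def map_replicate_const[symmetric] prod_list_replicate col)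
qed

lemma coefficient_monomial_class:
  assumes "b \<le> r"
  shows "coefficient a (monomial_class r b) = (if a = b then 1 else 0 :: 'k::field)"
proof -
  have "word_list (sorted_word r b) \<in> power_lists r (natural_rep :: ('k, _, _) representation)"
    using assms by (intro word_list_carrier) simp
  moreover have "linear_poly (unit_vector True) = [:0, 1 :: 'k:]" "linear_poly (unit_vector False) = (1 :: 'k poly)"
    by (simp_all add: linear_poly_def one_pCons)
  then have "prod_list (map linear_poly (word_list (sorted_word r b))) = Polynomial.monom (1 :: 'k) b"
    by (simp add: word_list_def sorted_word_def prod_list_replicate monom_altdef)
  ultimately show ?thesis
    unfolding monomial_class_def by (simp add: coefficient_class)
qed

text \<open>Both functionals take the same values on the monomial basis. This makes the matrix
  behind the volume form explicit although the dual basis of invariants was only chosen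
  abstractly.\<close>

lemma sym_pairing_eq_coefficient:
  fixes c :: "(('k::field^2) list \<Rightarrow>\<^sub>0 'k) set set"
  assumes "dual_bases (invariants r) (coinvariants r) (sym_pairing r) (Suc r) u (monomial_class r)"
    and "a \<le> r" "c \<in> carrier (coinvariants r)"
  shows "sym_pairing r (u a) c = coefficient a c"
proof -
  interpret dual_bases "sym_invariants r natural_rep :: ('k, _, _) representation"
      "sym_coinvariants r natural_rep" "sym_pairing r" "Suc r" u "monomial_class r"
    by fact
  show ?thesis
    by (rule V.functional_eq_on_span[OF \<beta>_right functional_coefficient v _ assms(3)])
      (use assms(2) in \<open>auto simp: u_carrier dual coefficient_monomial_class\<close>)
qed

section \<open>The matrix of Sym^r g in the monomial basis\<close>

definition power_det :: "nat \<Rightarrow> 'k::field^2^2 \<Rightarrow> 'k" where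
  "power_det r g = Determinant.det (Matrix.mat (Suc r) (Suc r) (\<lambda>(a, b).
     poly.coeff ([:g $ 2 $ 1, g $ 1 $ 1:] ^ b * [:g $ 2 $ 2, g $ 1 $ 2:] ^ (r - b)) a))"

lemma vol_act_monomial_class:
  fixes g :: "'k::field^2^2"
  assumes "dual_bases (invariants r) (coinvariants r) (sym_pairing r) (Suc r) u (monomial_class r)"
  shows "dual_bases.vol (sym_pairing r) (Suc r) u (map (act (coinvariants r) g \<circ> monomial_class r) [0..<Suc r])
    = power_det r g"
proof -
  interpret dual_bases "sym_invariants r natural_rep :: ('k, _, _) representation"
      "sym_coinvariants r natural_rep" "sym_pairing r" "Suc r" u "monomial_class r"
    by fact
  show ?thesis
    unfolding vol_def gram_def power_det_def
  proof (intro arg_cong[where f = Determinant.det] cong_mat refl)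
    fix a b assume ab: "a < Suc r" "b < Suc r"
    then have "map u [0..<Suc r] ! a = u a"
      "map (act (coinvariants r) g \<circ> monomial_class r) [0..<Suc r] ! b = act (coinvariants r) g (monomial_class r b)"
      by (simp_all del: upt_Suc)
    then show "(case (a, b) of (a, b) \<Rightarrow> sym_pairing r (map u [0..<Suc r] ! a)
          (map (act (coinvariants r) g \<circ> monomial_class r) [0..<Suc r] ! b)) =
        (case (a, b) of (a, b) \<Rightarrow> poly.coeff ([:g $ 2 $ 1, g $ 1 $ 1:] ^ b * [:g $ 2 $ 2, g $ 1 $ 2:] ^ (r - b)) a)"
      using ab by (simp add: sym_pairing_eq_coefficient[OF assms] v_carrier coefficient_act_monomial_class)
  qed
qed

text \<open>Multiplicativity is inherited from the volume form through \<open>vol_map\<close> and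
  the group law, instead of being extracted from the matrix entries.\<close>

lemma power_det_mult: "power_det r (g ** h) = power_det r g * power_det r (h :: 'k::field^2^2)"
proof -
  obtain u where bases: "dual_bases (invariants r :: ('k, _, _) representation) (coinvariants r)
      (sym_pairing r) (Suc r) u (monomial_class r)"
    by (rule sym_dual_bases)
  interpret dual_bases "sym_invariants r natural_rep :: ('k, _, _) representation"
      "sym_coinvariants r natural_rep" "sym_pairing r" "Suc r" u "monomial_class r"
    by (rule bases)
  let ?v = "map (act (coinvariants r) h \<circ> monomial_class r) [0..<Suc r]"
  have gh: "map (act (coinvariants r) (g ** h) \<circ> monomial_class r) [0..<Suc r] = map (act (coinvariants r) g) ?v"
    using v_carrier by (auto simp: act_coinvariants_mult simp del: upt_Suc)
  have "?v \<in> power_lists (Suc r) (coinvariants r)"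
    using v_carrier by (auto simp: power_lists_def simp del: upt_Suc)
  from vol_map[OF V.act_linear this, of g] show ?thesis
    unfolding gh[symmetric] vol_act_monomial_class[OF bases] .
qed

text \<open>Reversing the order of the factors turns \<open>y ^ (r - b)\<close> into
  \<open>y ^ b\<close>, and 0 + 1 + ... + r = r(r+1)/2.\<close>

lemma prod_powers:
  fixes x y :: "'k::field"
  shows "(\<Prod>b = 0..<Suc r. x ^ b * y ^ (r - b)) = (x * y) ^ (r * (r + 1) div 2)"
proof -
  have sum: "(\<Sum>b<Suc r. b) = r * (r + 1) div 2"
    using gauss_sum_nat[of r] by (simp add: atLeast0AtMost lessThan_Suc_atMost)
  have "(\<Prod>b<Suc r. y ^ (r - b)) = (\<Prod>b<Suc r. y ^ b)"
    using prod.nat_diff_reindex[of "\<lambda>b. y ^ b" "Suc r"] by simp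
  then show ?thesis
    by (simp only: prod.distrib atLeast0LessThan power_sum[symmetric] sum power_mult_distrib)
qed

text \<open>The image of X is a multiple of X, so column b is divisible by X^b. With exponents in
  increasing order the matrix is lower triangular although g is upper triangular.\<close>

lemma power_det_upper:
  fixes g :: "'k::field^2^2"
  assumes "g $ 2 $ 1 = 0"
  shows "power_det r g = (g $ 1 $ 1 * g $ 2 $ 2) ^ (r * (r + 1) div 2)"
proof -
  let ?A = "Matrix.mat (Suc r) (Suc r) (\<lambda>(a, b).
     poly.coeff ([:g $ 2 $ 1, g $ 1 $ 1:] ^ b * [:g $ 2 $ 2, g $ 1 $ 2:] ^ (r - b)) a)"
  have coeff: "poly.coeff ([:g $ 2 $ 1, g $ 1 $ 1:] ^ b * q) a
      = (if a < b then 0 else (g $ 1 $ 1) ^ b * poly.coeff q (a - b))" for a b q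
  proof -
    have "[:g $ 2 $ 1, g $ 1 $ 1:] = Polynomial.monom (g $ 1 $ 1) 1"
      using assms by (simp add: monom_Suc monom_0)
    then show ?thesis by (simp add: monom_power coeff_monom_mult)
  qed
  have "Determinant.det ?A = prod_list (diag_mat ?A)"
    by (rule det_lower_triangular[of "Suc r"]) (auto simp: coeff)
  also have "\<dots> = (\<Prod>b = 0..<Suc r. (g $ 1 $ 1) ^ b * (g $ 2 $ 2) ^ (r - b))"
    by (simp add: prod_list_diag_prod coeff coeff_0_power del: prod.op_ivl_Suc)
  finally show ?thesis unfolding power_det_def prod_powers .
qed

lemma coeff_linear_power_top: "poly.coeff ([:a, c:] ^ n) n = c ^ n"
  and coeff_linear_power_above: "n < k \<Longrightarrow> poly.coeff ([:a, c:] ^ n) k = 0"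
proof -
  have le: "Polynomial.degree ([:a, c:] ^ n) \<le> n" for n
    using degree_power_le[of "[:a, c:]" n] by (rule order_trans) simp
  show "n < k \<Longrightarrow> poly.coeff ([:a, c:] ^ n) k = 0" for n k
    using le[of n] by (intro coeff_eq_0) simp
  then show "poly.coeff ([:a, c:] ^ n) n = c ^ n"
    by (induction n) auto
qed

text \<open>The image of Y is a constant after dehomogenization, so column b has degree at most b
  and the matrix is upper triangular. The diagonal entries are the coefficients of degree b.\<close>

lemma power_det_lower:
  fixes g :: "'k::field^2^2"
  assumes "g $ 1 $ 2 = 0"
  shows "power_det r g = (g $ 1 $ 1 * g $ 2 $ 2) ^ (r * (r + 1) div 2)"
proof -
  let ?A = "Matrix.mat (Suc r) (Suc r) (\<lambda>(a, b).
     poly.coeff ([:g $ 2 $ 1, g $ 1 $ 1:] ^ b * [:g $ 2 $ 2, g $ 1 $ 2:] ^ (r - b)) a)"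
  have const: "[:g $ 2 $ 2, g $ 1 $ 2:] ^ k = [:(g $ 2 $ 2) ^ k:]" for k
    using assms by (induction k) (auto simp: one_pCons)
  have "Determinant.det ?A = prod_list (diag_mat ?A)"
    by (rule det_upper_triangular[of _ "Suc r"]) (auto simp: const coeff_linear_power_above)
  also have "\<dots> = (\<Prod>b = 0..<Suc r. (g $ 1 $ 1) ^ b * (g $ 2 $ 2) ^ (r - b))"
    by (simp add: prod_list_diag_prod const coeff_linear_power_top mult.commute del: prod.op_ivl_Suc)
  finally show ?thesis unfolding power_det_def prod_powers .
qed

definition matrix2 :: "'k::field \<Rightarrow> 'k \<Rightarrow> 'k \<Rightarrow> 'k \<Rightarrow> 'k^2^2" where
  "matrix2 a b c d = vector [vector [a, b], vector [c, d]]"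

lemma matrix2_nth [simp]:
  "matrix2 a b c d $ 1 $ 1 = a" "matrix2 a b c d $ 1 $ 2 = b"
  "matrix2 a b c d $ 2 $ 1 = c" "matrix2 a b c d $ 2 $ 2 = d"
  by (simp_all add: matrix2_def vector_2)

text \<open>Matrices with nonzero upper left entry are products of triangular ones, and multiplication
  by a transvection makes that entry nonzero.\<close>

lemma power_det_eq:
  fixes g :: "'k::field^2^2"
  assumes "invertible g"
  shows "power_det r g = Determinants.det g ^ (r * (r + 1) div 2)"
proof -
  let ?e = "r * (r + 1) div 2"
  have nonzero: "power_det r g = Determinants.det g ^ ?e" if "g $ 1 $ 1 \<noteq> 0" for g :: "'k^2^2"
  proof -
    let ?L = "matrix2 1 0 (g $ 2 $ 1 / g $ 1 $ 1) 1"
    let ?U = "matrix2 (g $ 1 $ 1) (g $ 1 $ 2) 0 (g $ 2 $ 2 - g $ 2 $ 1 * g $ 1 $ 2 / g $ 1 $ 1)"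
    have "g = ?L ** ?U"
      using that by (simp add: Finite_Cartesian_Product.vec_eq_iff forall_2 matrix_matrix_mult_def sum_2)
    then have "power_det r g = power_det r ?L * power_det r ?U"
      using power_det_mult by metis
    also have "\<dots> = (g $ 1 $ 1 * (g $ 2 $ 2 - g $ 2 $ 1 * g $ 1 $ 2 / g $ 1 $ 1)) ^ ?e"
      by (simp add: power_det_lower power_det_upper)
    also have "g $ 1 $ 1 * (g $ 2 $ 2 - g $ 2 $ 1 * g $ 1 $ 2 / g $ 1 $ 1) = Determinants.det g"
      using that by (simp add: det_2 field_simps)
    finally show ?thesis .
  qed
  show ?thesis
  proof (cases "g $ 1 $ 1 = 0")
    case True
    let ?R = "matrix2 1 0 1 1 :: 'k^2^2"
    have "Determinants.det g \<noteq> 0" using assms by (simp add: invertible_det_nz)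
    then have "g $ 1 $ 2 \<noteq> 0" using True by (auto simp: det_2)
    then have "power_det r (g ** ?R) = Determinants.det (g ** ?R) ^ ?e"
      using True by (intro nonzero) (simp add: matrix_matrix_mult_def sum_2)
    moreover have "power_det r ?R = 1" by (simp add: power_det_lower)
    moreover have "Determinants.det ?R = 1" by (simp add: det_2)
    ultimately show ?thesis by (simp add: power_det_mult Determinants.det_mul)
  qed (rule nonzero)
qed

section \<open>Trivial exterior powers and comparison of lines\<close>

lemma line_ext_power_0:
  assumes "linear_rep V"
  shows "line G (ext_power 0 V) (\<lambda>_. 1)"
proof -
  interpret linear_rep V by fact
  have h: "alternating 0 V (\<lambda>_. 1)" by (auto simp: alternating_def multilinear_def power_lists_def)
  have nil: "[] \<in> power_lists 0 V" by (simp add: power_lists_def)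
  have "spans V (carrier V)" by (simp add: spans_def)
  moreover have "{xs. set xs \<subseteq> carrier V \<and> length xs = 0} = {[]}" by auto
  ultimately have "spans (ext_power 0 V) {wedge 0 V []}" using spans_wedge_basis[of "carrier V" 0] by simp
  from linear_rep.lineI[OF linear_rep_ext_power this functional_ext_power[OF h]] show ?thesis
    by (simp add: act_wedge[OF nil] quot_lift_wedge[OF h nil])
qed

lemma line_tensor_rep:
  assumes "line G L \<theta>" "line G L' \<theta>'"
  shows "line G (tensor_rep L L') (\<lambda>g. \<theta> g * \<theta>' g)"
proof -
  interpret tensor_pair_reps L L' using assms by (simp add: tensor_pair_reps_def line_def)
  obtain d f where d: "spans L {d}" "functional L f" "f d = 1"
      and act: "\<And>g x. g \<in> carrier G \<Longrightarrow> x \<in> carrier L \<Longrightarrow> f (act L g x) = \<theta> g * f x"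
    using assms(1) unfolding line_def by auto
  obtain d' f' where d': "spans L' {d'}" "functional L' f'" "f' d' = 1"
      and act': "\<And>g x. g \<in> carrier G \<Longrightarrow> x \<in> carrier L' \<Longrightarrow> f' (act L' g x) = \<theta>' g * f' x"
    using assms(2) unfolding line_def by auto
  have dc: "d \<in> carrier L" "d' \<in> carrier L'" using d d' by (simp_all add: spans_def)
  have bil: "bilinear_form L L' (\<lambda>x y. f x * f' y)"
    using d(2) d'(2) by (simp add: bilinear_form_def functional_times functional_times_right)
  have span: "spans (tensor_rep L L') {tensor_pair L L' d d'}"
    using spans_tensor_pair_basis[OF d(1) d'(1)] by simp
  show ?thesis
    by (rule linear_rep.lineI[OF linear_rep_tensor_rep span functional_tensor_rep[OF bil]])
      (simp_all add: act_tensor_pair free_lift_tensor_pair[OF bil] dc d(3) d'(3) act act')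
qed

text \<open>A single functional detects a line, so a one-element set of test arguments suffices; the
  preimage of a value is that multiple of the generator.\<close>

lemma rep_iso_lines:
  assumes "line G L \<theta>" "line G L' \<theta>"
  shows "rep_iso G L L'"
proof -
  interpret L: linear_rep L using assms by (simp add: line_def)
  interpret L': linear_rep L' using assms by (simp add: line_def)
  obtain d f where d: "spans L {d}" "functional L f" "f d = 1"
      and act: "\<And>g x. g \<in> carrier G \<Longrightarrow> x \<in> carrier L \<Longrightarrow> f (act L g x) = \<theta> g * f x"
    using assms(1) unfolding line_def by auto
  obtain d' f' where d': "spans L' {d'}" "functional L' f'" "f' d' = 1"
      and act': "\<And>g x. g \<in> carrier G \<Longrightarrow> x \<in> carrier L' \<Longrightarrow> f' (act L' g x) = \<theta> g * f' x"
    using assms(2) unfolding line_def by auto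
  have dc: "d \<in> carrier L" "d' \<in> carrier L'" using d d' by (simp_all add: spans_def)
  show ?thesis
  proof (rule rep_isoI_functionals[where P = "{()}" and \<Phi> = "\<lambda>x _. f x" and \<Psi> = "\<lambda>x _. f' x"
        and \<tau> = "\<lambda>_ w. w" and \<rho> = \<theta>])
    show "x = \<zero>\<^bsub>L\<^esub>" if "x \<in> carrier L" "\<And>w. w \<in> {()} \<Longrightarrow> f x = 0" for x
      by (rule L.diagonal_inj[of "{()}" "\<lambda>_. d" "\<lambda>_. f"]) (use that d in auto)
    show "x = \<zero>\<^bsub>L'\<^esub>" if "x \<in> carrier L'" "\<And>w. w \<in> {()} \<Longrightarrow> f' x = 0" for x
      by (rule L'.diagonal_inj[of "{()}" "\<lambda>_. d'" "\<lambda>_. f'"]) (use that d' in auto)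
    show "\<exists>y\<in>carrier L'. \<forall>w\<in>{()}. f' y = f x" for x
      using dc d' by (intro bexI[of _ "f x \<odot>\<^bsub>L'\<^esub> d'"]) (auto simp: functional_smult)
    show "\<exists>y\<in>carrier L. \<forall>w\<in>{()}. f y = f' x" for x
      using dc d by (intro bexI[of _ "f' x \<odot>\<^bsub>L\<^esub> d"]) (auto simp: functional_smult)
  qed (use d d' act act' L.linear_rep_axioms L'.linear_rep_axioms in auto)
qed

section \<open>The general linear group\<close>

lemma group_GL2: "group (GL2 :: ('k::field^2^2) monoid)"
proof (rule groupI)
  fix A :: "'k^2^2" assume "A \<in> carrier GL2"
  then obtain B where "A ** B = Finite_Cartesian_Product.mat 1" "B ** A = Finite_Cartesian_Product.mat 1"
    by (auto simp: GL2_def invertible_def)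
  then show "\<exists>B\<in>carrier GL2. B \<otimes>\<^bsub>GL2\<^esub> A = \<one>\<^bsub>GL2\<^esub>"
    by (intro bexI[of _ B]) (auto simp: GL2_def invertible_def)
next
  show "\<one>\<^bsub>GL2\<^esub> \<in> carrier (GL2 :: ('k^2^2) monoid)"
    by (simp add: GL2_def invertible_det_nz)
qed (simp_all add: GL2_def invertible_mult matrix_mul_assoc)

lemma GL2_inverse:
  assumes "g \<in> carrier (GL2 :: ('k::field^2^2) monoid)"
  shows "g ** (inv\<^bsub>GL2\<^esub> g) = Finite_Cartesian_Product.mat 1"
  using group.r_inv[OF group_GL2 assms] by (simp add: GL2_def)

lemma det_GL2_inverse:
  assumes "g \<in> carrier (GL2 :: ('k::field^2^2) monoid)"
  shows "Determinants.det g * Determinants.det (inv\<^bsub>GL2\<^esub> g) = 1"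
  unfolding Determinants.det_mul[symmetric] GL2_inverse[OF assms] by simp

text \<open>The area form of the two entries is the coordinate with respect to the wedge of the two
  basis vectors, and g scales it by its determinant.\<close>

lemma line_det_rep: "line GL2 (det_rep :: ('k::field, _, _) representation) Determinants.det"
proof -
  let ?E = "natural_rep :: ('k, 'k^2, 'k^2^2) representation"
  let ?v = "\<lambda>i :: nat. unit_vector (i = 0) :: 'k^2" and ?h = "\<lambda>xs :: ('k^2) list. area_form (xs ! 0) (xs ! 1)"
  let ?e = "[unit_vector True, unit_vector False] :: ('k^2) list"
  have range_eq: "range unit_vector = ?v ` {..<2}"
    by (auto simp: lessThan_nat_numeral lessThan_Suc image_iff) (metis (full_types))
  have "spans ?E (?v ` {..<2})" unfolding range_eq[symmetric] by (rule spans_unit_vector)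
  \<comment> \<open>There is only one 2-subset of a 2-element set, so a single wedge spans.\<close>
  moreover have "{S. S \<subseteq> {..<2} \<and> card S = 2} = {{..<2 :: nat}}"
    using card_subset_eq[of "{..<2 :: nat}"] by auto
  moreover have "map ?v (sorted_list_of_set {..<2}) = ?e"
    by (simp add: lessThan_atLeast0 numeral_2_eq_2)
  ultimately have span: "spans (ext_power 2 ?E) {wedge 2 ?E ?e}"
    using E.spans_wedge_sorted[of ?v 2 2] by simp
  have "multilinear 2 ?E ?h"
    unfolding multilinear_def
    by (auto simp: power_lists_def less_2_cases_iff nth_list_update area_form_def algebra_simps)
  then have h: "alternating 2 ?E ?h"
    by (auto simp: alternating_def power_lists_def area_form_def length_Suc_conv numeral_2_eq_2)
  have e: "?e \<in> power_lists 2 ?E" by (simp add: power_lists_def)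
  show ?thesis
    unfolding det_rep_def
  proof (rule linear_rep.lineI[OF E.linear_rep_ext_power span E.functional_ext_power[OF h]])
    show "quot_lift ?h (wedge 2 ?E ?e) = 1"
      unfolding E.quot_lift_wedge[OF h e] by (simp add: area_form_unit_vector)
    show "quot_lift ?h (act (ext_power 2 ?E) g (wedge 2 ?E ?e)) = Determinants.det g" for g
      unfolding E.act_wedge[OF e] E.quot_lift_wedge[OF h E.power_lists_map_act[OF e]]
      by (simp add: area_form_act area_form_unit_vector)
  qed
qed

text \<open>The twist \<theta> is the power of det g with exponent r(r+1)/2 - rm. The condition is
  written multiplicatively so that it makes sense for negative exponents as well, with D a power of
  the dual.\<close>

lemma ext_power_sym_iso:
  fixes D :: "('k::field, 'd, 'k^2^2) representation"
  assumes r: "Suc r = l + m" and D: "line GL2 D \<theta>"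
    and \<theta>: "\<And>g. g \<in> carrier GL2 \<Longrightarrow>
      Determinants.det g ^ (r * (r + 1) div 2) = (Determinants.det g ^ r) ^ m * \<theta> g"
  shows "rep_iso GL2 (ext_power l (coinvariants r)) (tensor_rep (ext_power m (invariants r)) D)"
proof -
  obtain u where bases: "dual_bases (invariants r :: ('k, _, _) representation) (coinvariants r)
      (sym_pairing r) (Suc r) u (monomial_class r)"
    by (rule sym_dual_bases)
  show ?thesis
  proof (rule dual_bases.ext_power_complement[OF bases r D,
        where \<gamma> = "\<lambda>g. inv\<^bsub>GL2\<^esub> g" and \<kappa> = "\<lambda>g. Determinants.det g ^ r"])
    fix g :: "'k^2^2" and x :: "(('k^2) list \<Rightarrow>\<^sub>0 'k) set set"
    assume "g \<in> carrier GL2" "x \<in> carrier (coinvariants r)"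
    then show "act (coinvariants r) g (act (coinvariants r) (inv\<^bsub>GL2\<^esub> g) x) = x"
      by (simp add: GL2_inverse act_coinvariants_one flip: act_coinvariants_mult)
  next
    fix g :: "'k^2^2" assume g: "g \<in> carrier GL2"
    then show "dual_bases.vol (sym_pairing r) (Suc r) u (map (act (coinvariants r) g \<circ> monomial_class r) [0..<Suc r])
        = (Determinants.det g ^ r) ^ m * \<theta> g"
      unfolding vol_act_monomial_class[OF bases] \<theta>[OF g, symmetric]
      by (intro power_det_eq) (simp add: GL2_def)
  qed (rule sym_pairing_act)
qed

text \<open>From r + 1 = l + m follows r + 1 - 2m = l - m, hence r(r+1) = (l - m)(l + m - 1) + 2rm;
  the even summand 2rm comes out of the division by 2. Integers are used because l - m may be
  negative.\<close>

lemma exponent_identity: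
  assumes "Suc r = l + m"
  shows "int (r * (r + 1) div 2) = int (r * m) + ((int l - int m) * (int l + int m - 1)) div 2"
proof -
  have r: "int r = int l + int m - 1" using assms by linarith
  have "int (r * (r + 1) div 2) = (int r * (int r + 1)) div 2"
    by (simp add: zdiv_int algebra_simps)
  also have "int r * (int r + 1) = (int l - int m) * (int l + int m - 1) + 2 * (int r * int m)"
    unfolding r by (simp add: algebra_simps)
  finally show ?thesis by simp
qed

theorem corollary3p4:
  fixes l m :: nat
  shows
    "let E = (natural_rep :: ('k::field, 'k^2, 'k^2^2) representation);
         A = ext_power l (sym_coinvariants (l + m - 1) E);
         B = ext_power m (sym_invariants (l + m - 1) E);
         e = ((int l - int m) * (int l + int m - 1)) div 2
     in if 0 \<le> e
        then rep_iso GL2 A (tensor_rep B (tensor_power (nat e) det_rep))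
        else rep_iso GL2 A (tensor_rep B (tensor_power (nat (- e)) (dual_rep GL2 det_rep)))"
proof -
  define r where "r = l + m - 1"
  define e where "e = ((int l - int m) * (int l + int m - 1)) div 2"
  let ?A = "ext_power l (sym_coinvariants r (natural_rep :: ('k, 'k^2, 'k^2^2) representation))"
  let ?B = "ext_power m (sym_invariants r (natural_rep :: ('k, 'k^2, 'k^2^2) representation))"
  have pos: "line GL2 (tensor_power k (det_rep :: ('k, _, _) representation)) (\<lambda>g. Determinants.det g ^ k)" for k
    by (rule line_tensor_power[OF line_det_rep])
  have neg: "line GL2 (tensor_power k (dual_rep GL2 (det_rep :: ('k, _, _) representation)))
      (\<lambda>g. Determinants.det (inv\<^bsub>GL2\<^esub> g) ^ k)" for k
    by (intro line_tensor_power line_dual_rep[OF line_det_rep] group.inv_closed[OF group_GL2])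
  have main: "if 0 \<le> e then rep_iso GL2 ?A (tensor_rep ?B (tensor_power (nat e) det_rep))
      else rep_iso GL2 ?A (tensor_rep ?B (tensor_power (nat (- e)) (dual_rep GL2 det_rep)))"
  \<comment> \<open>For l = m = 0 truncated subtraction gives r = 0, so r + 1 = l + m fails and the
    complement theorem does not apply. Both sides are then lines with trivial character.\<close>
  proof (cases "l + m = 0")
    case True
    then have "l = 0" "m = 0" "e = 0" by (auto simp: e_def)
    moreover have "rep_iso GL2 (ext_power 0 (sym_coinvariants r (natural_rep :: ('k, 'k^2, 'k^2^2) representation)))
        (tensor_rep (ext_power 0 (sym_invariants r natural_rep)) (tensor_power 0 det_rep))"
      using line_tensor_rep[OF line_ext_power_0[OF E.linear_rep_sym_invariants] pos[of 0]]
      by (intro rep_iso_lines[OF line_ext_power_0[OF E.linear_rep_sym_coinvariants]]) simp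
    ultimately show ?thesis by simp
  next
    case False
    then have r: "Suc r = l + m" by (simp add: r_def)
    have e: "int (r * (r + 1) div 2) = int (r * m) + e" unfolding e_def by (rule exponent_identity[OF r])
    show ?thesis
    proof (cases "0 \<le> e")
      case True
      then have "r * (r + 1) div 2 = r * m + nat e" using e by linarith
      then have "rep_iso GL2 ?A (tensor_rep ?B (tensor_power (nat e) det_rep))"
        by (intro ext_power_sym_iso[OF r pos]) (simp add: power_add power_mult)
      with True show ?thesis by simp
    next
      case False
      \<comment> \<open>For negative e the identity is read as rm = r(r+1)/2 + |e|, which keeps all
        exponents natural.\<close>
      then have k: "r * m = r * (r + 1) div 2 + nat (- e)" using e by linarith
      have "Determinants.det g ^ (r * (r + 1) div 2)
          = (Determinants.det g ^ r) ^ m * Determinants.det (inv\<^bsub>GL2\<^esub> g) ^ nat (- e)"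
        if "g \<in> carrier GL2" for g :: "'k^2^2"
      proof -
        \<comment> \<open>The surplus |e| factors det g cancel against the determinants of the
          inverse that come from the dual.\<close>
        have "(Determinants.det g ^ r) ^ m * Determinants.det (inv\<^bsub>GL2\<^esub> g) ^ nat (- e)
            = Determinants.det g ^ (r * (r + 1) div 2) *
              (Determinants.det g * Determinants.det (inv\<^bsub>GL2\<^esub> g)) ^ nat (- e)"
          unfolding power_mult[symmetric] k power_add power_mult_distrib by (simp only: mult.assoc)
        then show ?thesis unfolding det_GL2_inverse[OF that] by simp
      qed
      then have "rep_iso GL2 ?A (tensor_rep ?B (tensor_power (nat (- e)) (dual_rep GL2 det_rep)))"
        by (intro ext_power_sym_iso[OF r neg])
      with False show ?thesis by simp
    qed
  qed
  then show ?thesis unfolding r_def e_def Let_def .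
qed

end
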